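(* Let $(G,\theta)$ be a reductive symmetric pair, and $\mathfrak{p}$ its anisotropic space. For any $x\in\mathfrak{p}$, the closure in $\mathfrak{p}$ of the decomposition class $\mathcal{D}(x)$ of $x$ is a union of decomposition classes.
   Context: All groups and varieties are over $\mathbb{C}$. A reductive symmetric pair $(G,\theta)$ consists of a reductive complex algebraic group $G$ and an involution $\theta$ of $G$; $K=(G^\theta)^\circ$; $\mathfrak{g}=\mathfrak{k}\oplus\mathfrak{p}$ is the decomposition of the Lie algebra of $G$ into $+1$ and $-1$ eigenspaces of the differential of $\theta$, and $\mathfrak{p}$ is called the anisotropic space. For $u\in\mathfrak{p}$, $\mathfrak{c}_{\mathfrak{p}}(u)$ is the centralizer of $u$ in $\mathfrak{p}$. Two elements $u,v\in\mathfrak{p}$ with Chevalley–Jordan decompositions $u=u_s+u_n$, $v=v_s+v_n$ have the same decomposition class when there exists $g\in K$ such that $g\cdot\mathfrak{c}_{\mathfrak{p}}(u_s)=\mathfrak{c}_{\mathfrak{p}}(v_s)$ and $gu_n=v_n$. This is an equivalence relation on $\mathfrak{p}$, whose equivalence classes are the decomposition classes; $\mathcal{D}(x)$ denotes the class containing $x$. *)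

theory Defs
  imports "HOL-Analysis.Analysis" "HOL-Algebra.Coset"
begin

section \<open>Linear algebraic groups over the complex numbers\<close>

text \<open>
  Reductive groups are affine, so an algebraic group is given here as a Zariski closed subgroup of
  some general linear group, with arbitrary finite index type for the matrices.  Accordingly, Lie
  algebras are spaces of matrices, the adjoint action is conjugation, and the Chevalley--Jordan
  decomposition is that of matrices.  Matrix multiplication is written \<open>**\<close>; the type-class
  product on matrices, which is componentwise, is never used.
\<close>

type_synonym 'n cmat = "complex ^ 'n ^ 'n"

inductive_set poly_fun :: "('n::finite cmat \<Rightarrow> complex) set" where
  const: "(\<lambda>_. c) \<in> poly_fun"
| coord: "(\<lambda>A. A $ i $ j) \<in> poly_fun"
| add: "f \<in> poly_fun \<Longrightarrow> g \<in> poly_fun \<Longrightarrow> (\<lambda>A. f A + g A) \<in> poly_fun"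
| mult: "f \<in> poly_fun \<Longrightarrow> g \<in> poly_fun \<Longrightarrow> (\<lambda>A. f A * g A) \<in> poly_fun"

definition zariski :: "'n::finite cmat topology" where
  "zariski = topology (\<lambda>U. \<exists>S \<subseteq> poly_fun. U = {A. \<exists>f\<in>S. f A \<noteq> 0})"

lemma openin_zariski:
  fixes U :: "'n::finite cmat set"
  shows "openin zariski U \<longleftrightarrow> (\<exists>S \<subseteq> poly_fun. U = {A. \<exists>f\<in>S. f A \<noteq> 0})"
proof -
  have "istopology (\<lambda>U. \<exists>S \<subseteq> (poly_fun :: ('n cmat \<Rightarrow> complex) set). U = {A. \<exists>f\<in>S. f A \<noteq> 0})"
    (is "istopology ?P")
    unfolding istopology_def
  proof (intro conjI allI impI)
    fix U V assume "?P U" "?P V"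
    then obtain S T where S: "S \<subseteq> poly_fun" "U = {A. \<exists>f\<in>S. f A \<noteq> 0}"
      and T: "T \<subseteq> poly_fun" "V = {A. \<exists>f\<in>T. f A \<noteq> 0}" by blast
    let ?R = "{\<lambda>A. f A * g A | f g. f \<in> S \<and> g \<in> T}"
    have "?R \<subseteq> poly_fun" using S(1) T(1) by (auto intro!: poly_fun.mult)
    moreover have "U \<inter> V = {A. \<exists>f\<in>?R. f A \<noteq> 0}"
    proof (rule Set.set_eqI)
      fix A
      have "A \<in> U \<inter> V \<longleftrightarrow> (\<exists>f\<in>S. \<exists>g\<in>T. f A * g A \<noteq> 0)"
        by (simp add: S(2) T(2))
      also have "\<dots> \<longleftrightarrow> (\<exists>f\<in>?R. f A \<noteq> 0)"
      proof
        assume "\<exists>f\<in>S. \<exists>g\<in>T. f A * g A \<noteq> 0"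
        then obtain f g where fg: "f \<in> S" "g \<in> T" "f A * g A \<noteq> 0" by blast
        show "\<exists>h\<in>?R. h A \<noteq> 0"
          by (rule bexI[of _ "\<lambda>A. f A * g A"]) (use fg in auto)
      next
        assume "\<exists>h\<in>?R. h A \<noteq> 0"
        then obtain h where "h \<in> ?R" "h A \<noteq> 0" ..
        then obtain f g where "f \<in> S" "g \<in> T" "h = (\<lambda>A. f A * g A)" by auto
        with \<open>h A \<noteq> 0\<close> show "\<exists>f\<in>S. \<exists>g\<in>T. f A * g A \<noteq> 0" by auto
      qed
      also have "\<dots> \<longleftrightarrow> A \<in> {A. \<exists>f\<in>?R. f A \<noteq> 0}" by (rule mem_Collect_eq[symmetric])
      finally show "A \<in> U \<inter> V \<longleftrightarrow> A \<in> {A. \<exists>f\<in>?R. f A \<noteq> 0}" .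
    qed
    ultimately show "?P (U \<inter> V)" by blast
  next
    fix \<U> assume "\<forall>U\<in>\<U>. ?P U"
    then have "\<forall>U\<in>\<U>. \<exists>S. S \<subseteq> poly_fun \<and> U = {A. \<exists>f\<in>S. f A \<noteq> 0}" by blast
    then obtain S where S: "\<forall>U\<in>\<U>. S U \<subseteq> poly_fun \<and> U = {A. \<exists>f\<in>S U. f A \<noteq> 0}"
      by (rule bchoice[THEN exE])
    have "\<Union>(S ` \<U>) \<subseteq> poly_fun"
    proof (rule UN_least)
      fix U assume "U \<in> \<U>"
      from bspec[OF S this] show "S U \<subseteq> poly_fun" by (rule conjunct1)
    qed
    moreover have "\<Union>\<U> = {A. \<exists>f\<in>\<Union>(S ` \<U>). f A \<noteq> 0}"
    proof (rule Set.set_eqI)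
      fix A
      have "A \<in> U \<longleftrightarrow> (\<exists>f\<in>S U. f A \<noteq> 0)" if "U \<in> \<U>" for U
      proof -
        have "U = {A. \<exists>f\<in>S U. f A \<noteq> 0}" using bspec[OF S that] by (rule conjunct2)
        then have "(A \<in> U) = (A \<in> {A. \<exists>f\<in>S U. f A \<noteq> 0})" by (rule arg_cong)
        then show ?thesis by (simp only: mem_Collect_eq)
      qed
      then show "A \<in> \<Union>\<U> \<longleftrightarrow> A \<in> {A. \<exists>f\<in>\<Union>(S ` \<U>). f A \<noteq> 0}" by simp
    qed
    ultimately show "?P (\<Union>\<U>)" by blast
  qed
  then show ?thesis by (simp add: zariski_def)
qed

lemma topspace_zariski [simp]: "topspace zariski = UNIV"
proof -
  have "openin zariski (UNIV :: 'n::finite cmat set)"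
    unfolding openin_zariski
    by (rule exI[of _ "{\<lambda>_. 1}"]) (auto intro: poly_fun.const)
  then show ?thesis using openin_subset by fastforce
qed

lemma closedin_zariski:
  fixes C :: "'n::finite cmat set"
  shows "closedin zariski C \<longleftrightarrow> (\<exists>S \<subseteq> poly_fun. C = {A. \<forall>f\<in>S. f A = 0})"
proof -
  have "- C = {A. \<exists>f\<in>S. f A \<noteq> 0} \<longleftrightarrow> C = {A. \<forall>f\<in>S. f A = 0}" for S :: "('n cmat \<Rightarrow> complex) set"
    by blast
  then show ?thesis
    by (simp add: closedin_def openin_zariski Compl_eq_Diff_UNIV[symmetric])
qed

definition GL :: "'n::finite cmat monoid" where
  "GL = \<lparr>carrier = {A. invertible A}, mult = (**), one = mat 1\<rparr>"

text \<open>As the coordinate ring of the general linear group is a localisation of the polynomial ring,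
  its Zariski topology is the subspace topology.\<close>

definition algebraic_group :: "'n::finite cmat set \<Rightarrow> bool" where
  "algebraic_group G \<longleftrightarrow> subgroup G GL \<and> closedin (subtopology zariski (carrier GL)) G"

definition identity_component :: "'n::finite cmat set \<Rightarrow> 'n cmat set" where
  "identity_component G = connected_component_of_set (subtopology zariski G) (mat 1)"

definition nilpotent_mat :: "'n::finite cmat \<Rightarrow> bool" where
  "nilpotent_mat N \<longleftrightarrow> (\<exists>k::nat. (((**) N) ^^ k) (mat 1) = 0)"

definition unipotent_group :: "'n::finite cmat set \<Rightarrow> bool" where
  "unipotent_group N \<longleftrightarrow> (\<forall>A\<in>N. nilpotent_mat (A - mat 1))"

text \<open>The unipotent radical, the largest closed connected normal unipotent subgroup, is trivial.
  The group itself need not be connected.\<close>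

definition reductive_group :: "'n::finite cmat set \<Rightarrow> bool" where
  "reductive_group G \<longleftrightarrow> algebraic_group G \<and>
     (\<forall>N. algebraic_group N \<and> N \<lhd> (GL\<lparr>carrier := G\<rparr>) \<and> connectedin zariski N \<and> unipotent_group N
        \<longrightarrow> N = {mat 1})"

section \<open>Lie algebras and differentials\<close>

text \<open>The Lie algebra is the Zariski tangent space at the identity.  For polynomial functions
  the real Frechet derivative is the usual complex linear differential.\<close>

definition lie_algebra :: "'n::finite cmat set \<Rightarrow> 'n cmat set" where
  "lie_algebra G = {X. \<forall>f\<in>poly_fun. (\<forall>A\<in>G. f A = 0) \<longrightarrow> frechet_derivative f (at (mat 1)) X = 0}"

definition regular_map :: "('n::finite cmat \<Rightarrow> 'n cmat) \<Rightarrow> bool" where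
  "regular_map F \<longleftrightarrow> (\<forall>i j. \<exists>f\<in>poly_fun. \<exists>k::nat. \<forall>A. invertible A \<longrightarrow> F A $ i $ j = f A / det A ^ k)"

text \<open>Regular functions on a closed subgroup are restrictions of regular functions on the
  general linear group.  The differential at the identity, as a map on the Lie algebra, is computed
  with any regular extension; lemma \<open>differential_eq\<close> below shows that the choice is irrelevant.\<close>

definition regular_extension ::
    "'n::finite cmat set \<Rightarrow> ('n cmat \<Rightarrow> 'n cmat) \<Rightarrow> ('n cmat \<Rightarrow> 'n cmat) \<Rightarrow> bool" where
  "regular_extension G \<phi> F \<longleftrightarrow> regular_map F \<and> (\<forall>A\<in>G. F A = \<phi> A)"

definition differential :: "'n::finite cmat set \<Rightarrow> ('n cmat \<Rightarrow> 'n cmat) \<Rightarrow> 'n cmat \<Rightarrow> 'n cmat" where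
  "differential G \<phi> = frechet_derivative (SOME F. regular_extension G \<phi> F) (at (mat 1))"

lemma poly_fun_sum:
  "finite I \<Longrightarrow> (\<And>i. i \<in> I \<Longrightarrow> f i \<in> poly_fun) \<Longrightarrow> (\<lambda>A. \<Sum>i\<in>I. f i A) \<in> poly_fun"
  by (induction rule: finite_induct) (auto intro: poly_fun.intros)

lemma poly_fun_prod:
  "finite I \<Longrightarrow> (\<And>i. i \<in> I \<Longrightarrow> f i \<in> poly_fun) \<Longrightarrow> (\<lambda>A. \<Prod>i\<in>I. f i A) \<in> poly_fun"
  by (induction rule: finite_induct) (auto intro: poly_fun.intros)

lemma poly_fun_power: "f \<in> poly_fun \<Longrightarrow> (\<lambda>A. f A ^ k) \<in> poly_fun"
  by (induction k) (auto intro: poly_fun.intros)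

lemma poly_fun_diff: "f \<in> poly_fun \<Longrightarrow> g \<in> poly_fun \<Longrightarrow> (\<lambda>A. f A - g A) \<in> poly_fun"
  using poly_fun.add[of f "\<lambda>A. (-1) * g A"] poly_fun.mult[OF poly_fun.const[of "-1"], of g]
  by simp

lemma poly_fun_det: "(det :: 'n::finite cmat \<Rightarrow> complex) \<in> poly_fun"
proof -
  have "(\<lambda>A::'n cmat. \<Sum>p\<in>{p. p permutes UNIV}. of_int (sign p) * (\<Prod>i\<in>UNIV. A $ i $ p i)) \<in> poly_fun"
    by (intro poly_fun_sum poly_fun_prod poly_fun.intros) (auto simp: finite_permutations)
  then show ?thesis by (simp add: det_def[abs_def])
qed

lemma poly_fun_differentiable: "f \<in> poly_fun \<Longrightarrow> f differentiable at A"
proof (induction rule: poly_fun.induct)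
  case (coord i j)
  have "bounded_linear (\<lambda>A::'a cmat. A $ i $ j)"
    using bounded_linear_compose[OF bounded_linear_vec_nth bounded_linear_vec_nth] by blast
  then show ?case by (rule bounded_linear_imp_differentiable)
qed auto

lemma open_invertible: "open {A::'n::finite cmat. invertible A}"
proof -
  have "continuous_on UNIV (det :: 'n cmat \<Rightarrow> complex)"
    by (intro continuous_at_imp_continuous_on ballI differentiable_imp_continuous_within
        poly_fun_differentiable poly_fun_det)
  then have "open (det -` (- {0}) :: 'n cmat set)"
    by (intro open_vimage) auto
  then show ?thesis by (simp add: vimage_def invertible_det_nz)
qed

lemma frechet_vec_nth2:
  fixes F :: "'n::finite cmat \<Rightarrow> 'n cmat"
  assumes "F differentiable at A"
  shows "((\<lambda>A. F A $ i $ j) has_derivative (\<lambda>X. frechet_derivative F (at A) X $ i $ j)) (at A)"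
  using assms
  by (intro bounded_linear.has_derivative[OF bounded_linear_vec_nth])
     (simp add: frechet_derivative_works[symmetric])

lemma regular_map_differentiable:
  fixes F :: "'n::finite cmat \<Rightarrow> 'n cmat"
  assumes "regular_map F" "invertible A"
  shows "F differentiable at A"
proof -
  have "(\<lambda>A. F A $ i $ j) differentiable at A" for i j
  proof -
    obtain f k where f: "f \<in> poly_fun" "\<And>A. invertible A \<Longrightarrow> F A $ i $ j = f A / det A ^ k"
      using assms(1) unfolding regular_map_def by metis
    have "det A \<noteq> 0" using assms(2) by (simp add: invertible_det_nz)
    then have "(\<lambda>A. f A / det A ^ k) differentiable at A"
      by (intro differentiable_divide differentiable_power poly_fun_differentiable f(1) poly_fun_det) auto
    then obtain D where "((\<lambda>A. f A / det A ^ k) has_derivative D) (at A)"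
      by (auto simp: differentiable_def)
    then have "((\<lambda>A. F A $ i $ j) has_derivative D) (at A)"
      by (rule has_derivative_transform_within_open[OF _ open_invertible]) (use assms f in auto)
    then show ?thesis by (auto simp: differentiable_def)
  qed
  then have nth: "(\<lambda>A. F A $ i $ j \<bullet> c) differentiable at A" for i j and c :: complex
    by (rule differentiable_inner) (rule differentiable_const)
  have "(\<lambda>A. F A \<bullet> b) differentiable at A" if b: "b \<in> Basis" for b
  proof -
    obtain i j c where "b = axis i (axis j c)"
      using b unfolding Basis_vec_def by blast
    then show ?thesis using nth[of i j c] by (simp add: inner_axis)
  qed
  then show ?thesis
    using differentiable_componentwise_within[of F A UNIV] by simp
qed

lemma differential_eq:
  fixes G :: "'n::finite cmat set"
  assumes G: "algebraic_group G" and F: "regular_extension G \<phi> F" and X: "X \<in> lie_algebra G"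
  shows "differential G \<phi> X = frechet_derivative F (at (mat 1)) X"
proof -
  define F' where "F' = (SOME F. regular_extension G \<phi> F)"
  have F': "regular_extension G \<phi> F'" unfolding F'_def using F by (metis someI)
  have inv1: "invertible (mat 1 :: 'n cmat)" by (simp add: invertible_det_nz)
  have G1: "mat 1 \<in> G" and GGL: "G \<subseteq> {A. invertible A}"
    using G by (auto simp: algebraic_group_def GL_def subgroup_def)
  have dF: "F differentiable at (mat 1)" and dF': "F' differentiable at (mat 1)"
    using F F' inv1 by (auto simp: regular_extension_def intro: regular_map_differentiable)
  have "frechet_derivative F' (at (mat 1)) X $ i $ j = frechet_derivative F (at (mat 1)) X $ i $ j"
    for i j
  proof -
    obtain f k where f: "f \<in> poly_fun" "\<And>A. invertible A \<Longrightarrow> F A $ i $ j = f A / det A ^ k"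
      using F unfolding regular_extension_def regular_map_def by metis
    obtain g l where g: "g \<in> poly_fun" "\<And>A. invertible A \<Longrightarrow> F' A $ i $ j = g A / det A ^ l"
      using F' unfolding regular_extension_def regular_map_def by metis
    let ?q = "\<lambda>A. f A * det A ^ l - g A * det A ^ k"
    let ?d = "\<lambda>A. F A $ i $ j - F' A $ i $ j"
    have q: "?q \<in> poly_fun"
      by (intro poly_fun_diff poly_fun.mult poly_fun_power f g poly_fun_det)
    have dq: "?d A * det A ^ (k + l) = ?q A" if "invertible A" for A
    proof -
      have "det A \<noteq> 0" using that by (simp add: invertible_det_nz)
      then have "F A $ i $ j * det A ^ k = f A" "F' A $ i $ j * det A ^ l = g A"
        using f(2)[OF that] g(2)[OF that] by auto
      then show ?thesis by (simp add: power_add algebra_simps flip: \<open>_ = f A\<close> \<open>_ = g A\<close>)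
    qed
    have "\<forall>A\<in>G. ?q A = 0"
    proof
      fix A assume "A \<in> G"
      then have "invertible A" "?d A = 0"
        using F F' GGL by (auto simp: regular_extension_def)
      then show "?q A = 0" using dq[of A] by simp
    qed
    then have q0: "frechet_derivative ?q (at (mat 1)) X = 0"
      using X q by (simp add: lie_algebra_def)
    have d1: "?d (mat 1) = 0" using F F' G1 by (simp add: regular_extension_def)
    let ?D = "\<lambda>X. frechet_derivative F (at (mat 1)) X $ i $ j - frechet_derivative F' (at (mat 1)) X $ i $ j"
    have 1: "(?d has_derivative ?D) (at (mat 1))"
      by (intro has_derivative_diff frechet_vec_nth2 dF dF')
    obtain E where 2: "((\<lambda>A::'n cmat. det A ^ (k + l)) has_derivative E) (at (mat 1))"
      using poly_fun_differentiable[OF poly_fun_power[OF poly_fun_det]]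
      by (auto simp: differentiable_def)
    have "((\<lambda>A. ?d A * det A ^ (k + l)) has_derivative ?D) (at (mat 1))"
      using has_derivative_mult[OF 1 2] d1 by simp
    then have "(?q has_derivative ?D) (at (mat 1))"
      by (rule has_derivative_transform_within_open[OF _ open_invertible])
         (use inv1 in simp, rule dq, simp)
    from frechet_derivative_at[OF this] have "?D X = 0"
      using q0 by (rule fun_cong[THEN trans])
    then show ?thesis by simp
  qed
  then show ?thesis by (simp add: differential_def F'_def[symmetric] vec_eq_iff)
qed

section \<open>Symmetric pairs and decomposition classes\<close>

text \<open>The trivial involution is allowed.\<close>

definition reductive_symmetric_pair :: "'n::finite cmat set \<Rightarrow> ('n cmat \<Rightarrow> 'n cmat) \<Rightarrow> bool" where
  "reductive_symmetric_pair G \<theta> \<longleftrightarrow> reductive_group G \<and>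
     \<theta> \<in> hom (GL\<lparr>carrier := G\<rparr>) (GL\<lparr>carrier := G\<rparr>) \<and>
     (\<exists>F. regular_extension G \<theta> F) \<and>
     (\<forall>g\<in>G. \<theta> (\<theta> g) = g)"

definition symmetric_subgroup :: "'n::finite cmat set \<Rightarrow> ('n cmat \<Rightarrow> 'n cmat) \<Rightarrow> 'n cmat set" where
  "symmetric_subgroup G \<theta> = identity_component {g\<in>G. \<theta> g = g}"

definition anisotropic_space :: "'n::finite cmat set \<Rightarrow> ('n cmat \<Rightarrow> 'n cmat) \<Rightarrow> 'n cmat set" where
  "anisotropic_space G \<theta> = {X \<in> lie_algebra G. differential G \<theta> X = - X}"

definition adjoint :: "'n::finite cmat \<Rightarrow> 'n cmat \<Rightarrow> 'n cmat" where
  "adjoint g X = g ** X ** matrix_inv g"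

definition centralizer_in :: "'n::finite cmat set \<Rightarrow> 'n cmat \<Rightarrow> 'n cmat set" where
  "centralizer_in \<pp> u = {y \<in> \<pp>. y ** u - u ** y = 0}"

definition semisimple_mat :: "'n::finite cmat \<Rightarrow> bool" where
  "semisimple_mat S \<longleftrightarrow>
     (\<exists>P :: 'n cmat. invertible P \<and> (\<forall>i j. i \<noteq> j \<longrightarrow> (matrix_inv P ** S ** P) $ i $ j = 0))"

definition jordan_decomposition :: "'n::finite cmat \<Rightarrow> 'n cmat \<Rightarrow> 'n cmat \<Rightarrow> bool" where
  "jordan_decomposition u s n \<longleftrightarrow>
     u = s + n \<and> semisimple_mat s \<and> nilpotent_mat n \<and> s ** n = n ** s"

text \<open>The Jordan parts are unique, and those of an element of the anisotropic space lie in it again;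
  so the existential quantifiers over the parts pick out the usual ones.\<close>

definition decomposition_rel ::
    "'n::finite cmat set \<Rightarrow> ('n cmat \<Rightarrow> 'n cmat) \<Rightarrow> ('n cmat \<times> 'n cmat) set" where
  "decomposition_rel G \<theta> =
     {(u, v). u \<in> anisotropic_space G \<theta> \<and> v \<in> anisotropic_space G \<theta> \<and>
       (\<exists>us un vs vn. jordan_decomposition u us un \<and> jordan_decomposition v vs vn \<and>
         (\<exists>g \<in> symmetric_subgroup G \<theta>.
            adjoint g ` centralizer_in (anisotropic_space G \<theta>) us
              = centralizer_in (anisotropic_space G \<theta>) vs \<and>
            adjoint g un = vn))}"

definition decomposition_class ::
    "'n::finite cmat set \<Rightarrow> ('n cmat \<Rightarrow> 'n cmat) \<Rightarrow> 'n cmat \<Rightarrow> 'n cmat set" where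
  "decomposition_class G \<theta> x = decomposition_rel G \<theta> `` {x}"

end

theory Submission
  imports Defs "HOL-Library.Function_Algebras" "HOL-Computational_Algebra.Fundamental_Theorem_Algebra"
    "HOL-Complex_Analysis.Cauchy_Integral_Formula"
begin

text \<open>Let \<open>x = s + n\<close> be the Jordan decomposition, \<open>cp s\<close> the centralizer of \<open>s\<close> in \<open>\<pp>\<close>, and
  \<open>center s\<close> the space of semisimple elements of \<open>\<pp>\<close> that commute with \<open>cp s\<close>. Instead of the
  class of \<open>x\<close> itself, consider the family \<open>E\<close> of all \<open>K\<close>-conjugates of the elements
  \<open>s + m + n\<close> with \<open>m\<close> in \<open>center s\<close>. It contains the class (\<open>class_in_center_family\<close>), and a
  polynomial function that vanishes on the class vanishes on \<open>E\<close>, because \<open>s + \<tau> m\<close> has the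
  same centralizer as \<open>s\<close> for small complex \<open>\<tau>\<close> (\<open>center_family_in_closure\<close>). So both have the
  same Zariski closure \<open>Z\<close>, and it has to be shown that with a point \<open>y = t + r\<close> of \<open>\<pp>\<close> the set
  \<open>Z\<close> contains the whole class of \<open>y\<close>. As \<open>Z\<close> is stable under \<open>K\<close>, this amounts to \<open>y + m\<close>
  being in \<open>Z\<close> for all \<open>m\<close> in \<open>center t\<close>.

  The family \<open>E\<close> is the image of an algebraic set under a polynomial map. Therefore \<open>y\<close> is not
  only a Zariski limit but a Euclidean limit of points of \<open>E\<close> (\<open>zariski_limit_is_limit\<close>). Since
  \<open>\<pp>\<close> is the sum of \<open>cp t\<close> and of the commutators of \<open>y\<close> with the Lie algebra of \<open>K\<close>, every
  point of \<open>\<pp>\<close> close to \<open>y\<close> is conjugate under \<open>K\<close> to a point of \<open>cp t\<close> close to \<open>y\<close>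
  (\<open>local_slice\<close>). So \<open>y\<close> is a limit of points \<open>u\<close> of \<open>E\<close> that lie in \<open>cp t\<close>. When such a point
  is close to \<open>y\<close>, the centralizer of its semisimple part is contained in \<open>cp t\<close>
  (\<open>centralizer_semicontinuous\<close>). Then \<open>m\<close> commutes with that centralizer, which means that
  \<open>u + m\<close> belongs to \<open>E\<close> again. Passing to the limit, \<open>y + m\<close> is in \<open>Z\<close>
  (\<open>class_closure_invariant\<close>).

  The theorem on limits is proved by commutative algebra and a compactness argument: a prime
  ideal of the source lying over \<open>y\<close>, Noether normalization of the closure of its image, and
  the equation satisfied by a function that separates \<open>y\<close> from the other points over the same
  base point; see \<open>limit_of_image_prime\<close>. Exponentials can be used because one-parameter groups
  in the directions of the Lie algebras stay in the groups (\<open>mexp_in_group\<close>, \<open>mexp_in_K\<close>): a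
  polynomial function vanishing on the group has all derivatives along such a curve equal to
  zero at the identity.\<close>

section \<open>Prime ideals and minimal relations over a subring\<close>

text \<open>Rings are given by carrier sets, because the arguments below compare many rings of
  polynomial functions, in fewer variables or pulled back along maps, inside one ring of
  functions.\<close>

definition subring_set :: "'r::comm_ring_1 set \<Rightarrow> bool" where
  "subring_set C \<longleftrightarrow> 1 \<in> C \<and> (\<forall>a\<in>C. \<forall>b\<in>C. a + b \<in> C \<and> a * b \<in> C \<and> - a \<in> C)"

definition prime_in :: "'r::comm_ring_1 set \<Rightarrow> 'r set \<Rightarrow> bool" where
  "prime_in R P \<longleftrightarrow> P \<subseteq> R \<and> 0 \<in> P \<and> 1 \<notin> P \<and> (\<forall>a\<in>P. \<forall>b\<in>P. a + b \<in> P)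
     \<and> (\<forall>a\<in>R. \<forall>b\<in>P. a * b \<in> P) \<and> (\<forall>a\<in>R. \<forall>b\<in>R. a * b \<in> P \<longrightarrow> a \<in> P \<or> b \<in> P)"

definition polys_over :: "'r::comm_ring_1 set \<Rightarrow> 'r poly set" where
  "polys_over C = {p. \<forall>i. coeff p i \<in> C}"

lemma subring_setD:
  assumes "subring_set C"
  shows "0 \<in> C" "1 \<in> C" "a \<in> C \<Longrightarrow> b \<in> C \<Longrightarrow> a + b \<in> C" "a \<in> C \<Longrightarrow> b \<in> C \<Longrightarrow> a * b \<in> C"
    "a \<in> C \<Longrightarrow> - a \<in> C" "a \<in> C \<Longrightarrow> b \<in> C \<Longrightarrow> a - b \<in> C"
proof -
  have *: "1 \<in> C" "\<And>a b. a \<in> C \<Longrightarrow> b \<in> C \<Longrightarrow> a + b \<in> C" "\<And>a b. a \<in> C \<Longrightarrow> b \<in> C \<Longrightarrow> a * b \<in> C"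
    "\<And>a. a \<in> C \<Longrightarrow> - a \<in> C"
    using assms by (auto simp: subring_set_def)
  show "0 \<in> C" using *(2)[OF *(1) *(4)[OF *(1)]] by simp
  show "1 \<in> C" "a \<in> C \<Longrightarrow> b \<in> C \<Longrightarrow> a + b \<in> C" "a \<in> C \<Longrightarrow> b \<in> C \<Longrightarrow> a * b \<in> C"
    "a \<in> C \<Longrightarrow> - a \<in> C"
    by (fact *)+
  show "a - b \<in> C" if "a \<in> C" "b \<in> C"
    using *(2)[OF that(1) *(4)[OF that(2)]] by simp
qed

lemma subring_set_sum:
  assumes "subring_set C" "\<And>i. i \<in> A \<Longrightarrow> f i \<in> C"
  shows "sum f A \<in> C"
  using assms(2) by (induction A rule: infinite_finite_induct) (auto intro: subring_setD[OF assms(1)])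

lemma subring_set_power:
  assumes "subring_set C" "a \<in> C" shows "a ^ n \<in> C"
  by (induction n) (use assms in \<open>auto intro: subring_setD[OF assms(1)]\<close>)

lemma prime_inD:
  assumes "prime_in R P"
  shows "P \<subseteq> R" "0 \<in> P" "1 \<notin> P" "a \<in> P \<Longrightarrow> b \<in> P \<Longrightarrow> a + b \<in> P" "a \<in> R \<Longrightarrow> b \<in> P \<Longrightarrow> a * b \<in> P"
    "a \<in> R \<Longrightarrow> b \<in> P \<Longrightarrow> b * a \<in> P"
    "a \<in> R \<Longrightarrow> b \<in> R \<Longrightarrow> a * b \<in> P \<Longrightarrow> a \<in> P \<or> b \<in> P"
  using assms by (auto simp: prime_in_def mult.commute)

lemma prime_in_diff:
  assumes "prime_in R P" "subring_set R" "a \<in> P" "b \<in> P"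
  shows "a - b \<in> P"
proof -
  have "(-1) * b \<in> P"
    using prime_inD(5)[OF assms(1) subring_setD(5)[OF assms(2) subring_setD(2)[OF assms(2)]] assms(4)] .
  then show ?thesis using prime_inD(4)[OF assms(1,3), of "- b"] by simp
qed

lemma prime_in_sum:
  assumes "prime_in R P" "\<And>i. i \<in> A \<Longrightarrow> f i \<in> P"
  shows "sum f A \<in> P"
  using assms(2) by (induction A rule: infinite_finite_induct) (auto intro: prime_inD[OF assms(1)])

lemma prime_in_power:
  assumes "prime_in R P" "subring_set R" "a \<in> R" "a \<notin> P"
  shows "a ^ n \<notin> P"
proof (induction n)
  case (Suc n)
  then show ?case using prime_inD(7)[OF assms(1,3) subring_set_power[OF assms(2,3), of n]] assms(4) by auto
qed (use prime_inD(3)[OF assms(1)] in simp)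

lemma polys_over_coeff: "p \<in> polys_over C \<Longrightarrow> coeff p i \<in> C"
  by (simp add: polys_over_def)

lemma polys_over_closed:
  assumes C: "subring_set C"
  shows "0 \<in> polys_over C" "1 \<in> polys_over C"
    "p \<in> polys_over C \<Longrightarrow> q \<in> polys_over C \<Longrightarrow> p + q \<in> polys_over C"
    "p \<in> polys_over C \<Longrightarrow> q \<in> polys_over C \<Longrightarrow> p - q \<in> polys_over C"
    "p \<in> polys_over C \<Longrightarrow> q \<in> polys_over C \<Longrightarrow> p * q \<in> polys_over C"
    "a \<in> C \<Longrightarrow> p \<in> polys_over C \<Longrightarrow> smult a p \<in> polys_over C"
    "a \<in> C \<Longrightarrow> monom a n \<in> polys_over C"
    "a \<in> C \<Longrightarrow> [:a:] \<in> polys_over C"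
  by (auto simp: polys_over_def coeff_mult coeff_1 coeff_pCons split: nat.split
      intro!: subring_setD[OF C] subring_set_sum[OF C])

lemma poly_in_subring:
  assumes C: "subring_set C" and "p \<in> polys_over C" "b \<in> C" shows "poly p b \<in> C"
  unfolding poly_altdef using assms(2,3)
  by (auto intro!: subring_set_sum[OF C] subring_setD[OF C] subring_set_power[OF C] simp: polys_over_def)

text \<open>Leading coefficients need not be invertible, so they are cleared by multiplying the
  dividend with a power of that of the divisor. The degree of the quotient matters in the proof
  that a minimal relation is irreducible.\<close>

lemma pseudo_division:
  assumes C: "subring_set C" and f: "f \<in> polys_over C" and g: "g \<in> polys_over C" "g \<noteq> 0"
  shows "\<exists>l. \<exists>q\<in>polys_over C. \<exists>r\<in>polys_over C. smult (lead_coeff g ^ l) f = q * g + r \<and>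
           (r = 0 \<or> degree r < degree g) \<and> degree q \<le> degree f - degree g"
  using f
proof (induction "degree f" arbitrary: f rule: less_induct)
  case less
  note cl = polys_over_closed[OF C]
  show ?case
  proof (cases "degree f < degree g")
    case True
    then show ?thesis
      by (intro exI[of _ 0] bexI[of _ 0] bexI[of _ f]) (use less.prems cl in auto)
  next
    case False
    define d where "d = degree f - degree g"
    define m where "m = monom (lead_coeff f) d"
    define f' where "f' = smult (lead_coeff g) f - m * g"
    have m: "m \<in> polys_over C" unfolding m_def by (intro cl polys_over_coeff less.prems)
    have f': "f' \<in> polys_over C" unfolding f'_def
      by (intro cl polys_over_coeff less.prems m g)
    have dm: "degree m \<le> d" by (simp add: m_def degree_monom_le)
    have le: "degree f' \<le> degree f" unfolding f'_def
      by (intro degree_diff_le order.trans[OF degree_smult_le] order.trans[OF degree_mult_le])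
         (use dm False in \<open>auto simp: d_def\<close>)
    have "coeff (m * g) (degree f) = lead_coeff f * lead_coeff g"
      using False by (simp add: m_def coeff_monom_mult d_def)
    then have top: "coeff f' (degree f) = 0" by (simp add: f'_def mult.commute)
    show ?thesis
    proof (cases "degree f = 0")
      case True
      then have "f' = 0" using le top by (metis le_zero_eq leading_coeff_0_iff)
      then have "smult (lead_coeff g ^ 1) f = m * g + 0" by (simp add: f'_def)
      then show ?thesis using m cl(1) dm unfolding d_def by (metis)
    next
      case nz: False
      then have "degree f' < degree f" using le top
        by (metis le_neq_implies_less leading_coeff_0_iff degree_0 neq0_conv)
      from less.hyps[OF this f'] obtain l q r where
        q: "q \<in> polys_over C" and r: "r \<in> polys_over C" "r = 0 \<or> degree r < degree g"
        and e: "smult (lead_coeff g ^ l) f' = q * g + r" and dq: "degree q \<le> degree f' - degree g" by blast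
      let ?q = "q + smult (lead_coeff g ^ l) m"
      have "smult (lead_coeff g ^ Suc l) f = ?q * g + r"
      proof -
        have "smult (lead_coeff g ^ l) f' = smult (lead_coeff g ^ Suc l) f - smult (lead_coeff g ^ l) m * g"
          by (simp add: f'_def smult_diff_right mult.commute)
        then show ?thesis using e by (simp add: algebra_simps)
      qed
      moreover have "?q \<in> polys_over C"
        by (intro cl q m subring_set_power[OF C] polys_over_coeff g)
      moreover have "degree ?q \<le> degree f - degree g"
        using dq dm le by (intro degree_add_le order.trans[OF degree_smult_le]) (auto simp: d_def)
      ultimately show ?thesis using r by blast
    qed
  qed
qed

text \<open>Up to a factor this is the minimal polynomial of \<open>b\<close> over the fraction field of \<open>C\<close>
  modulo \<open>P\<close>. A relation counts as trivial when all its coefficients lie in \<open>P\<close>.\<close>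

definition min_relation :: "'r::comm_ring_1 set \<Rightarrow> 'r set \<Rightarrow> 'r \<Rightarrow> 'r poly \<Rightarrow> bool" where
  "min_relation C P b \<mu> \<longleftrightarrow> \<mu> \<in> polys_over C \<and> poly \<mu> b \<in> P \<and> lead_coeff \<mu> \<notin> P \<and> degree \<mu> > 0 \<and>
     (\<forall>p\<in>polys_over C. poly p b \<in> P \<and> degree p < degree \<mu> \<longrightarrow> (\<forall>i. coeff p i \<in> P))"

text \<open>Polynomials matter modulo \<open>P\<close> only, where a leading coefficient may become zero; then
  there is an equivalent polynomial of lower degree.\<close>

lemma drop_leading_term:
  assumes R: "subring_set R" and P: "prime_in R P" and C: "subring_set C" "C \<subseteq> R" and b: "b \<in> R"
    and p: "p \<in> polys_over C" and lead: "lead_coeff p \<in> P"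
  shows "\<exists>p'\<in>polys_over C. (degree p' < degree p \<or> p' = 0) \<and> poly p b - poly p' b \<in> P \<and>
           (\<forall>i. coeff p i \<in> P \<longleftrightarrow> coeff p' i \<in> P)"
proof -
  define p' where "p' = p - monom (lead_coeff p) (degree p)"
  have "p' \<in> polys_over C" unfolding p'_def by (intro polys_over_closed[OF C(1)] p polys_over_coeff)
  moreover have "degree p' < degree p \<or> p' = 0"
  proof -
    have "degree p' \<le> degree p" unfolding p'_def by (intro degree_diff_le) (auto simp: degree_monom_le)
    moreover have "coeff p' (degree p) = 0" by (simp add: p'_def)
    ultimately show ?thesis by (metis le_neq_implies_less leading_coeff_0_iff)
  qed
  moreover have "poly p b - poly p' b \<in> P"
    using prime_inD(6)[OF P subring_set_power[OF R b] lead] by (simp add: p'_def poly_monom)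
  moreover have "coeff p i \<in> P \<longleftrightarrow> coeff p' i \<in> P" for i
    using lead prime_inD(2)[OF P] by (auto simp: p'_def)
  ultimately show ?thesis by blast
qed

lemma min_relation_exists:
  assumes R: "subring_set R" and P: "prime_in R P" and C: "subring_set C" "C \<subseteq> R" and b: "b \<in> R"
    and ex: "p \<in> polys_over C" "poly p b \<in> P" "coeff p i \<notin> P"
  shows "\<exists>\<mu>. min_relation C P b \<mu>"
proof -
  define W where "W = {p\<in>polys_over C. poly p b \<in> P \<and> (\<exists>i. coeff p i \<notin> P)}"
  have "p \<in> W" using ex by (auto simp: W_def)
  then obtain \<mu> where \<mu>: "\<mu> \<in> W" and min: "\<And>q. degree q < degree \<mu> \<Longrightarrow> q \<notin> W"
    using exists_least_iff[of "\<lambda>n. \<exists>q\<in>W. degree q = n"] by metis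
  have lead: "lead_coeff \<mu> \<notin> P"
  proof
    assume l: "lead_coeff \<mu> \<in> P"
    obtain p' where p': "p' \<in> polys_over C" "degree p' < degree \<mu> \<or> p' = 0" "poly \<mu> b - poly p' b \<in> P"
      "\<forall>i. coeff \<mu> i \<in> P \<longleftrightarrow> coeff p' i \<in> P"
      using drop_leading_term[OF R P C b _ l] \<mu> by (auto simp: W_def)
    have "poly p' b \<in> P" using prime_in_diff[OF P R _ p'(3), of "poly \<mu> b"] \<mu> by (auto simp: W_def)
    moreover have "\<exists>i. coeff p' i \<notin> P" using \<mu> p'(4) by (auto simp: W_def)
    ultimately have "p' \<in> W" "p' \<noteq> 0" using p'(1) prime_inD(2)[OF P] by (auto simp: W_def)
    then show False using min p'(2) by blast
  qed
  have "degree \<mu> > 0"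
  proof (rule ccontr)
    assume "\<not> degree \<mu> > 0"
    then obtain c where "\<mu> = [:c:]" using degree_eq_zeroE by blast
    then show False using lead \<mu> by (simp add: W_def)
  qed
  then show ?thesis using \<mu> lead min by (auto simp: min_relation_def W_def)
qed

text \<open>This replaces inverting \<open>p(b)\<close> in the field generated by \<open>b\<close>. Among the multiples of
  \<open>p(b)\<close> modulo \<open>P\<close> outside \<open>P\<close>, written as polynomials in \<open>b\<close>, one of least degree is
  constant: otherwise dividing \<open>\<mu>\<close> by it would give a factorization of the minimal relation.\<close>

lemma multiple_in_coefficients:
  assumes R: "subring_set R" and P: "prime_in R P" and C: "subring_set C" "C \<subseteq> R" and b: "b \<in> R"
    and \<mu>: "min_relation C P b \<mu>" and p: "p \<in> polys_over C" "poly p b \<notin> P"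
  shows "\<exists>s\<in>polys_over C. \<exists>h\<in>C. h \<notin> P \<and> poly s b * poly p b - h \<in> P"
proof -
  note cl = polys_over_closed[OF C(1)]
  have mu: "\<mu> \<in> polys_over C" "poly \<mu> b \<in> P" "lead_coeff \<mu> \<notin> P" "degree \<mu> > 0"
    and mumin: "\<And>p i. p \<in> polys_over C \<Longrightarrow> poly p b \<in> P \<Longrightarrow> degree p < degree \<mu> \<Longrightarrow> coeff p i \<in> P"
    using \<mu> by (auto simp: min_relation_def)
  have CR: "polys_over C \<subseteq> polys_over R" using C(2) by (auto simp: polys_over_def)
  have val: "poly q b \<in> R" if "q \<in> polys_over C" for q
    using poly_in_subring[OF R _ b] that CR by blast
  have mu0: "\<mu> \<noteq> 0" using mu(4) by auto
  define W where "W = {w\<in>polys_over C. degree w < degree \<mu> \<and> poly w b \<notin> P \<and>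
     (\<exists>s\<in>polys_over C. poly s b * poly p b - poly w b \<in> P)}"
  have "\<exists>w. w \<in> W"
  proof -
    obtain l q r where q: "q \<in> polys_over C" and r: "r \<in> polys_over C" "r = 0 \<or> degree r < degree \<mu>"
      and e: "smult (lead_coeff \<mu> ^ l) p = q * \<mu> + r"
      using pseudo_division[OF C(1) p(1) mu(1) mu0] by blast
    from arg_cong[OF e, of "\<lambda>p. poly p b"]
    have e': "lead_coeff \<mu> ^ l * poly p b - poly r b = poly q b * poly \<mu> b" by (simp add: algebra_simps)
    have in_P: "lead_coeff \<mu> ^ l * poly p b - poly r b \<in> P"
      unfolding e' by (rule prime_inD(5)[OF P val[OF q] mu(2)])
    have lR: "lead_coeff \<mu> \<in> R" using C(2) mu(1) polys_over_coeff by blast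
    have "poly r b \<notin> P"
    proof
      assume "poly r b \<in> P"
      from prime_inD(4)[OF P in_P this] have "lead_coeff \<mu> ^ l * poly p b \<in> P" by simp
      then show False
        using prime_inD(7)[OF P subring_set_power[OF R lR] val[OF p(1)]] prime_in_power[OF P R lR mu(3)] p(2)
        by blast
    qed
    moreover have "degree r < degree \<mu>" using r(2) mu(4) by auto
    moreover have "[:lead_coeff \<mu> ^ l:] \<in> polys_over C"
      by (intro cl subring_set_power[OF C(1)] polys_over_coeff mu(1))
    ultimately have "r \<in> W" using r(1) in_P unfolding W_def
      by (auto intro!: bexI[of _ "[:lead_coeff \<mu> ^ l:]"])
    then show ?thesis ..
  qed
  then obtain w where w: "w \<in> W" and min: "\<And>q. degree q < degree w \<Longrightarrow> q \<notin> W"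
    using exists_least_iff[of "\<lambda>n. \<exists>q\<in>W. degree q = n"] by metis
  obtain s where s: "s \<in> polys_over C" "poly s b * poly p b - poly w b \<in> P" using w by (auto simp: W_def)
  have wC: "w \<in> polys_over C" "poly w b \<notin> P" "degree w < degree \<mu>" using w by (auto simp: W_def)
  have reduce: "w' \<notin> polys_over C \<or> poly w' b \<in> P" if "degree w' < degree w" "poly s' b * poly p b - poly w' b \<in> P"
    "s' \<in> polys_over C" for w' s'
    using min[OF that(1)] that wC(3) unfolding W_def by auto
  have wlead: "lead_coeff w \<notin> P"
  proof
    assume l: "lead_coeff w \<in> P"
    obtain p' where p': "p' \<in> polys_over C" "degree p' < degree w \<or> p' = 0" "poly w b - poly p' b \<in> P"
      using drop_leading_term[OF R P C b wC(1) l] by blast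
    have "poly p' b \<notin> P" using prime_inD(4)[OF P p'(3), of "poly p' b"] wC(2) by auto
    moreover have "poly s b * poly p b - poly p' b \<in> P"
      using prime_inD(4)[OF P s(2) p'(3)] by simp
    moreover have "p' \<noteq> 0" using calculation(1) prime_inD(2)[OF P] by auto
    ultimately show False using reduce s(1) p'(1,2) by blast
  qed
  have "degree w = 0"
  proof (rule ccontr)
    assume dw: "degree w \<noteq> 0"
    then have w0: "w \<noteq> 0" by auto
    obtain l q r where q: "q \<in> polys_over C" and r: "r \<in> polys_over C" "r = 0 \<or> degree r < degree w"
      and e: "smult (lead_coeff w ^ l) \<mu> = q * w + r" and dq: "degree q \<le> degree \<mu> - degree w"
      using pseudo_division[OF C(1) mu(1) wC(1) w0] by blast
    have dr: "degree r < degree w" using r(2) dw by auto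
    from arg_cong[OF e, of "\<lambda>p. poly p b"]
    have e': "lead_coeff w ^ l * poly \<mu> b = poly q b * poly w b + poly r b" by simp
    have lR: "lead_coeff w \<in> R" "lead_coeff \<mu> \<in> R" using C(2) wC(1) mu(1) polys_over_coeff by blast+
    have P1: "poly q b * poly w b + poly r b \<in> P"
      unfolding e'[symmetric] by (rule prime_inD(5)[OF P subring_set_power[OF R lR(1)] mu(2)])
    have "poly r b \<in> P"
    proof -
      have "poly (- (q * s)) b * poly p b - poly r b
          = - 1 * (poly q b * (poly s b * poly p b - poly w b)) - (poly q b * poly w b + poly r b)"
        by (simp add: algebra_simps)
      also have "\<dots> \<in> P"
        by (intro prime_in_diff[OF P R] P1 prime_inD(5)[OF P] s val q subring_setD[OF R])
      finally have "poly (- (q * s)) b * poly p b - poly r b \<in> P" .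
      moreover have "- (q * s) \<in> polys_over C"
        using cl(4)[OF cl(1) cl(5)[OF q s(1)]] by simp
      ultimately show ?thesis using reduce[OF dr] r(1) by blast
    qed
    from prime_in_diff[OF P R P1 this] have "poly q b * poly w b \<in> P" by simp
    then have "poly q b \<in> P" using prime_inD(7)[OF P val[OF q] val[OF wC(1)]] wC(2) by blast
    moreover have "degree q < degree \<mu>" using dq dw wC(3) by linarith
    ultimately have qP: "coeff q i \<in> P" for i using mumin q by blast
    have "coeff (q * w) (degree \<mu>) \<in> P" unfolding coeff_mult
      using C(2) wC(1) by (intro prime_in_sum[OF P] prime_inD(6)[OF P] qP) (auto simp: polys_over_def)
    moreover have "coeff (q * w) (degree \<mu>) = lead_coeff w ^ l * lead_coeff \<mu>"
      using arg_cong[OF e, of "\<lambda>p. coeff p (degree \<mu>)"] dr wC(3) by (simp add: coeff_eq_0)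
    ultimately show False
      using prime_inD(7)[OF P subring_set_power[OF R lR(1)] lR(2)] prime_in_power[OF P R lR(1) wlead] mu(3)
      by auto
  qed
  then obtain h where h: "w = [:h:]" using degree_eq_zeroE by blast
  have "h \<in> C" using wC(1) polys_over_coeff[of w C 0] h by simp
  then show ?thesis using s wC(2) h by auto
qed

section \<open>Polynomial functions\<close>

inductive_set polyfun :: "'v set \<Rightarrow> (('v \<Rightarrow> complex) \<Rightarrow> complex) set" for V where
  const: "(\<lambda>_. c) \<in> polyfun V"
| coord: "v \<in> V \<Longrightarrow> (\<lambda>x. x v) \<in> polyfun V"
| add: "f \<in> polyfun V \<Longrightarrow> g \<in> polyfun V \<Longrightarrow> (\<lambda>x. f x + g x) \<in> polyfun V"
| mult: "f \<in> polyfun V \<Longrightarrow> g \<in> polyfun V \<Longrightarrow> (\<lambda>x. f x * g x) \<in> polyfun V"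

lemma polyfun_minus: "f \<in> polyfun V \<Longrightarrow> (\<lambda>x. - f x) \<in> polyfun V"
  using polyfun.mult[OF polyfun.const[of "-1"], of f V] by simp

lemma polyfun_diff: "f \<in> polyfun V \<Longrightarrow> g \<in> polyfun V \<Longrightarrow> (\<lambda>x. f x - g x) \<in> polyfun V"
  using polyfun.add[OF _ polyfun_minus, of f V g] by simp

lemma polyfun_sum:
  "(\<And>i. i \<in> A \<Longrightarrow> f i \<in> polyfun V) \<Longrightarrow> (\<lambda>x. \<Sum>i\<in>A. f i x) \<in> polyfun V"
  by (induction A rule: infinite_finite_induct) (auto intro: polyfun.intros)

lemma polyfun_prod:
  "(\<And>i. i \<in> A \<Longrightarrow> f i \<in> polyfun V) \<Longrightarrow> (\<lambda>x. \<Prod>i\<in>A. f i x) \<in> polyfun V"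
  by (induction A rule: infinite_finite_induct) (auto intro: polyfun.intros)

lemma subring_polyfun: "subring_set (polyfun V)"
  unfolding subring_set_def
  by (auto simp: plus_fun_def times_fun_def one_fun_def fun_Compl_def
      intro: polyfun.intros polyfun_minus)

lemma polyfun_mono: "f \<in> polyfun U \<Longrightarrow> U \<subseteq> V \<Longrightarrow> f \<in> polyfun V"
  by (induction rule: polyfun.induct) (auto intro: polyfun.intros)

lemma polyfun_compose:
  "f \<in> polyfun V \<Longrightarrow> (\<And>v. v \<in> V \<Longrightarrow> g v \<in> polyfun W) \<Longrightarrow> (\<lambda>x. f (\<lambda>v. g v x)) \<in> polyfun W"
  by (induction rule: polyfun.induct) (auto intro: polyfun.intros)

lemma polyfun_cong: "f \<in> polyfun V \<Longrightarrow> (\<And>v. v \<in> V \<Longrightarrow> x v = y v) \<Longrightarrow> f x = f y"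
  by (induction rule: polyfun.induct) auto

lemma sum_fun_apply: "(\<Sum>i\<in>A. f i) x = (\<Sum>i\<in>A. f i x)"
  by (induction A rule: infinite_finite_induct) auto

lemma power_fun_apply: "(f ^ n) x = (f x :: complex) ^ n"
  by (induction n) auto

definition specialize :: "'x \<Rightarrow> ('x \<Rightarrow> complex) poly \<Rightarrow> complex poly" where
  "specialize \<pi> p = map_poly (\<lambda>f. f \<pi>) p"

lemma coeff_specialize [simp]: "coeff (specialize \<pi> p) i = coeff p i \<pi>"
  by (simp add: specialize_def coeff_map_poly)

lemma specialize_add: "specialize \<pi> (p + q) = specialize \<pi> p + specialize \<pi> q"
  by (rule poly_eqI) simp

lemma specialize_mult: "specialize \<pi> (p * q) = specialize \<pi> p * specialize \<pi> q"
  by (rule poly_eqI) (simp add: coeff_mult sum_fun_apply)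

lemma specialize_smult: "specialize \<pi> (smult a p) = smult (a \<pi>) (specialize \<pi> p)"
  by (rule poly_eqI) simp

lemma degree_specialize: "degree (specialize \<pi> p) \<le> degree p"
  by (rule degree_le) (simp add: coeff_eq_0)

lemma poly_specialize: "poly (specialize \<pi> p) (b \<pi>) = poly p b \<pi>"
proof -
  have "poly (specialize \<pi> p) t = (\<Sum>i\<le>degree p. coeff p i \<pi> * t ^ i)" for t
    unfolding poly_altdef using degree_specialize[of \<pi> p]
    by (auto simp: le_degree intro!: sum.mono_neutral_left)
  then show ?thesis unfolding poly_altdef[of p]
    by (simp add: sum_fun_apply power_fun_apply)
qed

section \<open>Extension of zeros of a prime ideal\<close>

lemma polyfun_insert:
  assumes "Q \<in> polyfun (insert b U)"
  shows "\<exists>p\<in>polys_over (polyfun U). Q = poly p (\<lambda>x. x b)"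
  using assms
proof (induction rule: polyfun.induct)
  note cl = polys_over_closed[OF subring_polyfun[of U]]
  case (const c)
  show ?case by (intro bexI[of _ "[:\<lambda>_. c:]"] cl polyfun.const) (simp add: fun_eq_iff)
next
  note cl = polys_over_closed[OF subring_polyfun[of U]]
  case (coord v)
  show ?case
  proof (cases "v = b")
    case True
    then show ?thesis
      by (intro bexI[of _ "monom 1 1"] cl subring_setD[OF subring_polyfun]) (simp add: fun_eq_iff poly_monom)
  next
    case False
    then show ?thesis using coord
      by (intro bexI[of _ "[:\<lambda>x. x v:]"] cl polyfun.coord) (auto simp: fun_eq_iff)
  qed
next
  note cl = polys_over_closed[OF subring_polyfun[of U]]
  case (add f g)
  then obtain p q where "p \<in> polys_over (polyfun U)" "q \<in> polys_over (polyfun U)"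
    "f = poly p (\<lambda>x. x b)" "g = poly q (\<lambda>x. x b)" by blast
  then show ?case by (intro bexI[of _ "p + q"] cl) (auto simp: fun_eq_iff)
next
  note cl = polys_over_closed[OF subring_polyfun[of U]]
  case (mult f g)
  then obtain p q where "p \<in> polys_over (polyfun U)" "q \<in> polys_over (polyfun U)"
    "f = poly p (\<lambda>x. x b)" "g = poly q (\<lambda>x. x b)" by blast
  then show ?case by (intro bexI[of _ "p * q"] cl) (auto simp: fun_eq_iff)
qed

lemma poly_coord_update:
  assumes "p \<in> polys_over (polyfun U)" "b \<notin> U"
  shows "poly p (\<lambda>x. x b) (\<pi>(b := \<tau>)) = poly (specialize \<pi> p) \<tau>"
proof -
  have "coeff p i (\<pi>(b := \<tau>)) = coeff p i \<pi>" for i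
    using assms by (intro polyfun_cong[OF polys_over_coeff[OF assms(1)]]) auto
  then have "specialize (\<pi>(b := \<tau>)) p = specialize \<pi> p" by (intro poly_eqI) simp
  then show ?thesis using poly_specialize[of "\<pi>(b := \<tau>)" p "\<lambda>x. x b"] by simp
qed

text \<open>The zero set of the elimination ideal of \<open>P\<close> in the variables \<open>U\<close>. Points keep all their
  coordinates; those outside \<open>U\<close> are arbitrary.\<close>

definition vanishing :: "(('v \<Rightarrow> complex) \<Rightarrow> complex) set \<Rightarrow> 'v set \<Rightarrow> ('v \<Rightarrow> complex) set" where
  "vanishing P U = {\<pi>. \<forall>q\<in>P \<inter> polyfun U. q \<pi> = 0}"

text \<open>A member of the ideal that involves one more variable \<open>b\<close> is divided by the minimal
  relation. The remainder is a relation of lower degree, so all its coefficients lie in \<open>P\<close> and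
  vanish at \<open>\<pi>\<close>. Hence the member vanishes at every root of the specialized relation.\<close>

lemma root_extends_point:
  assumes P: "prime_in (polyfun V) P" and V: "insert b U \<subseteq> V" and b: "b \<notin> U"
    and \<mu>: "min_relation (polyfun U) P (\<lambda>x. x b) \<mu>"
    and \<pi>: "\<pi> \<in> vanishing P U" "lead_coeff \<mu> \<pi> \<noteq> 0" "poly (specialize \<pi> \<mu>) \<tau> = 0"
  shows "\<pi>(b := \<tau>) \<in> vanishing P (insert b U)"
proof -
  let ?C = "polyfun U" and ?b = "\<lambda>x. x b"
  have C: "subring_set ?C" "?C \<subseteq> polyfun V" using V polyfun_mono subring_polyfun by blast+
  have bV: "?b \<in> polyfun V" using V by (auto intro: polyfun.coord)
  have val: "poly q ?b \<in> polyfun V" if "q \<in> polys_over ?C" for q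
    using that C(2) by (intro poly_in_subring[OF subring_polyfun _ bV]) (auto simp: polys_over_def)
  have mu: "\<mu> \<in> polys_over ?C" "poly \<mu> ?b \<in> P"  "degree \<mu> > 0"
    and mumin: "\<And>p i. p \<in> polys_over ?C \<Longrightarrow> poly p ?b \<in> P \<Longrightarrow> degree p < degree \<mu> \<Longrightarrow> coeff p i \<in> P"
    using \<mu> by (auto simp: min_relation_def)
  have "Q (\<pi>(b := \<tau>)) = 0" if Q: "Q \<in> P" "Q \<in> polyfun (insert b U)" for Q
  proof -
    obtain f where f: "f \<in> polys_over ?C" "Q = poly f ?b" using polyfun_insert[OF Q(2)] by blast
    obtain l q r where q: "q \<in> polys_over ?C" and r: "r \<in> polys_over ?C" "r = 0 \<or> degree r < degree \<mu>"
      and e: "smult (lead_coeff \<mu> ^ l) f = q * \<mu> + r"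
      using pseudo_division[OF C(1) f(1) mu(1)] mu(3) by fastforce
    from arg_cong[OF e, of "\<lambda>p. poly p ?b"]
    have "poly r ?b = lead_coeff \<mu> ^ l * poly f ?b - poly q ?b * poly \<mu> ?b" by simp
    also have "\<dots> \<in> P"
      using C(2) mu(1,2) f Q(1) val[OF q]
      by (intro prime_in_diff[OF P subring_polyfun] prime_inD(5)[OF P] subring_set_power[OF subring_polyfun])
        (auto simp: polys_over_def)
    finally have "coeff r i \<in> P" for i using mumin[OF r(1)] r(2) mu(3) by auto
    then have "specialize \<pi> r = 0"
      using \<pi>(1) r(1) by (intro poly_eqI) (auto simp: vanishing_def polys_over_def)
    with arg_cong[OF e, of "\<lambda>p. poly (specialize \<pi> p) \<tau>"]
    have "poly (specialize \<pi> f) \<tau> = 0"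
      using \<pi>(2,3) by (simp add: specialize_add specialize_mult specialize_smult power_fun_apply)
    then show ?thesis using poly_coord_update[OF f(1) b] f(2) by simp
  qed
  then show ?thesis by (auto simp: vanishing_def)
qed

text \<open>The extension theorem of elimination theory. If \<open>b\<close> is transcendental modulo \<open>P\<close>, all but
  finitely many values extend a point. Otherwise the roots of the minimal relation do, and \<open>v\<close>
  cannot vanish at the extended point because a multiple of it is a function of the old
  variables that does not vanish there.\<close>

lemma extend_point:
  assumes P: "prime_in (polyfun V) P" and V: "insert b U \<subseteq> V" and b: "b \<notin> U"
    and v: "v \<in> polyfun (insert b U)" "v \<notin> P"
  shows "\<exists>u\<in>polyfun U. u \<notin> P \<and> (\<forall>\<pi>\<in>vanishing P U. u \<pi> \<noteq> 0 \<longrightarrow>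
           (\<exists>\<tau>. \<pi>(b := \<tau>) \<in> vanishing P (insert b U) \<and> v (\<pi>(b := \<tau>)) \<noteq> 0))"
proof -
  let ?C = "polyfun U" and ?b = "\<lambda>x. x b"
  have C: "subring_set ?C" "?C \<subseteq> polyfun V" using V polyfun_mono subring_polyfun by blast+
  have bV: "?b \<in> polyfun V" using V by (auto intro: polyfun.coord)
  obtain p where p: "p \<in> polys_over ?C" "v = poly p ?b" using polyfun_insert[OF v(1)] by blast
  show ?thesis
  proof (cases "\<exists>q\<in>polys_over ?C. poly q ?b \<in> P \<and> (\<exists>i. coeff q i \<notin> P)")
    case False
    have "\<exists>i. coeff p i \<notin> P"
    proof (rule ccontr)
      assume "\<nexists>i. coeff p i \<notin> P"
      then have "poly p ?b \<in> P" unfolding poly_altdef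
        by (intro prime_in_sum[OF P] prime_inD(6)[OF P] subring_set_power[OF subring_polyfun] bV) auto
      then show False using v p by simp
    qed
    then obtain i where i: "coeff p i \<notin> P" ..
    have "\<exists>\<tau>. \<pi>(b := \<tau>) \<in> vanishing P (insert b U) \<and> v (\<pi>(b := \<tau>)) \<noteq> 0"
      if \<pi>: "\<pi> \<in> vanishing P U" "coeff p i \<pi> \<noteq> 0" for \<pi>
    proof -
      have "specialize \<pi> p \<noteq> 0" using \<pi>(2) by (metis coeff_specialize coeff_0)
      then have "finite {\<tau>. poly (specialize \<pi> p) \<tau> = 0}" by (rule poly_roots_finite)
      then obtain \<tau> where \<tau>: "poly (specialize \<pi> p) \<tau> \<noteq> 0"
        using infinite_UNIV_char_0 by (metis (mono_tags, lifting) UNIV_eq_I mem_Collect_eq)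
      have "Q (\<pi>(b := \<tau>)) = 0" if Q: "Q \<in> P" "Q \<in> polyfun (insert b U)" for Q
      proof -
        obtain f where f: "f \<in> polys_over ?C" "Q = poly f ?b" using polyfun_insert[OF Q(2)] by blast
        then have "coeff f i \<in> P" for i using False Q(1) by auto
        then have "specialize \<pi> f = 0"
          using \<pi>(1) f(1) by (intro poly_eqI) (auto simp: vanishing_def polys_over_def)
        then show ?thesis using poly_coord_update[OF f(1) b] f(2) by simp
      qed
      moreover have "v (\<pi>(b := \<tau>)) \<noteq> 0" using poly_coord_update[OF p(1) b] p(2) \<tau> by simp
      ultimately show ?thesis by (auto simp: vanishing_def)
    qed
    then show ?thesis using i polys_over_coeff[OF p(1)] by blast
  next
    case True
    then obtain \<mu> where \<mu>: "min_relation ?C P ?b \<mu>"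
      using min_relation_exists[OF subring_polyfun P C bV] by blast
    obtain s h where s: "s \<in> polys_over ?C" and h: "h \<in> ?C" "h \<notin> P" "poly s ?b * poly p ?b - h \<in> P"
      using multiple_in_coefficients[OF subring_polyfun P C bV \<mu> p(1)] v p by auto
    have mu: "\<mu> \<in> polys_over ?C" "lead_coeff \<mu> \<notin> P" "degree \<mu> > 0" using \<mu> by (auto simp: min_relation_def)
    have lead: "lead_coeff \<mu> \<in> ?C" using mu(1) polys_over_coeff by blast
    have "\<exists>\<tau>. \<pi>(b := \<tau>) \<in> vanishing P (insert b U) \<and> v (\<pi>(b := \<tau>)) \<noteq> 0"
      if \<pi>: "\<pi> \<in> vanishing P U" "(lead_coeff \<mu> * h) \<pi> \<noteq> 0" for \<pi>
    proof -
      have l: "lead_coeff \<mu> \<pi> \<noteq> 0" "h \<pi> \<noteq> 0" using \<pi>(2) by auto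
      then have "degree (specialize \<pi> \<mu>) > 0"
        using le_degree[of "specialize \<pi> \<mu>" "degree \<mu>"] mu(3) by simp
      then obtain \<tau> where "poly (specialize \<pi> \<mu>) \<tau> = 0"
        using fundamental_theorem_of_algebra_alt[of "specialize \<pi> \<mu>"] by fastforce
      from root_extends_point[OF P V b \<mu> \<pi>(1) l(1) this]
      have *: "\<pi>(b := \<tau>) \<in> vanishing P (insert b U)" .
      have bI: "?b \<in> polyfun (insert b U)" by (auto intro: polyfun.coord)
      have CI: "?C \<subseteq> polyfun (insert b U)" using polyfun_mono by blast
      have "poly s ?b * poly p ?b - h \<in> polyfun (insert b U)"
        by (intro subring_setD[OF subring_polyfun] poly_in_subring[OF subring_polyfun _ bI]
            CI[THEN subsetD] h) (use s p(1) CI in \<open>auto simp: polys_over_def\<close>)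
      then have "(poly s ?b * poly p ?b - h) (\<pi>(b := \<tau>)) = 0"
        using * h(3) unfolding vanishing_def by blast
      moreover have "h (\<pi>(b := \<tau>)) = h \<pi>" using b by (intro polyfun_cong[OF h(1)]) auto
      ultimately have "v (\<pi>(b := \<tau>)) \<noteq> 0" using l(2) p(2) by auto
      with * show ?thesis by blast
    qed
    moreover have "lead_coeff \<mu> * h \<in> ?C" by (intro subring_setD[OF subring_polyfun] lead h)
    moreover have "lead_coeff \<mu> * h \<notin> P" using prime_inD(7)[OF P] lead h C(2) mu(2) by blast
    ultimately show ?thesis by blast
  qed
qed

lemma extend_point_iterated:
  assumes P: "prime_in (polyfun V) P" and W: "finite W" "U \<union> W \<subseteq> V" "U \<inter> W = {}"
    and v: "v \<in> polyfun (U \<union> W)" "v \<notin> P"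
  shows "\<exists>u\<in>polyfun U. u \<notin> P \<and> (\<forall>\<pi>\<in>vanishing P U. u \<pi> \<noteq> 0 \<longrightarrow>
           (\<exists>\<pi>'\<in>vanishing P (U \<union> W). (\<forall>i\<in>U. \<pi>' i = \<pi> i) \<and> v \<pi>' \<noteq> 0))"
  using W v
proof (induction W arbitrary: v rule: finite_induct)
  case empty
  then show ?case by auto
next
  case (insert b W)
  then have *: "insert b (U \<union> W) \<subseteq> V" "b \<notin> U \<union> W" "v \<in> polyfun (insert b (U \<union> W))" by auto
  obtain w where w: "w \<in> polyfun (U \<union> W)" "w \<notin> P"
    and w': "\<And>\<pi>. \<pi> \<in> vanishing P (U \<union> W) \<Longrightarrow> w \<pi> \<noteq> 0 \<Longrightarrow>
      \<exists>\<tau>. \<pi>(b := \<tau>) \<in> vanishing P (insert b (U \<union> W)) \<and> v (\<pi>(b := \<tau>)) \<noteq> 0"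
    using extend_point[OF P * insert.prems(4)] by blast
  obtain u where u: "u \<in> polyfun U" "u \<notin> P" and u': "\<And>\<pi>. \<pi> \<in> vanishing P U \<Longrightarrow> u \<pi> \<noteq> 0 \<Longrightarrow>
      \<exists>\<pi>'\<in>vanishing P (U \<union> W). (\<forall>i\<in>U. \<pi>' i = \<pi> i) \<and> w \<pi>' \<noteq> 0"
    using insert.IH[OF _ _ w] insert.prems(1,2) by blast
  show ?case
  proof (intro bexI[of _ u] conjI ballI impI u)
    fix \<pi> assume "\<pi> \<in> vanishing P U" "u \<pi> \<noteq> 0"
    then obtain \<pi>' where p': "\<pi>' \<in> vanishing P (U \<union> W)" "\<forall>i\<in>U. \<pi>' i = \<pi> i" "w \<pi>' \<noteq> 0" using u' by blast
    then obtain \<tau> where "\<pi>'(b := \<tau>) \<in> vanishing P (insert b (U \<union> W))" "v (\<pi>'(b := \<tau>)) \<noteq> 0" using w' by blast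
    moreover have "\<forall>i\<in>U. (\<pi>'(b := \<tau>)) i = \<pi> i" using p'(2) *(2) by auto
    ultimately show "\<exists>\<pi>'\<in>vanishing P (U \<union> insert b W). (\<forall>i\<in>U. \<pi>' i = \<pi> i) \<and> v \<pi>' \<noteq> 0"
      unfolding Un_insert_right by blast
  qed
qed

section \<open>Linear dependence over a domain\<close>

text \<open>Gaussian elimination without division; the number of vectors exceeds the number \<open>card S\<close>
  of coordinates.\<close>

lemma linear_dependence:
  fixes C :: "'r::comm_ring_1 set"
  assumes C: "subring_set C" and dom: "\<And>a b. a \<in> C \<Longrightarrow> b \<in> C \<Longrightarrow> a * b = 0 \<Longrightarrow> a = 0 \<or> b = 0"
    and one: "(1::'r) \<noteq> 0"
    and S: "finite S" and T: "finite T" "card S < card T"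
    and m: "\<And>t s. t \<in> T \<Longrightarrow> s \<in> S \<Longrightarrow> m t s \<in> C"
  shows "\<exists>\<alpha>. (\<forall>t\<in>T. \<alpha> t \<in> C) \<and> (\<exists>t\<in>T. \<alpha> t \<noteq> 0) \<and> (\<forall>s\<in>S. (\<Sum>t\<in>T. \<alpha> t * m t s) = 0)"
  using S T m
proof (induction S arbitrary: T m rule: finite_induct)
  case empty
  then have "T \<noteq> {}" by auto
  then show ?case using subring_setD(2)[OF C] one by (intro exI[of _ "\<lambda>_. 1"]) auto
next
  case (insert s0 S)
  note D = subring_setD[OF C]
  show ?case
  proof (cases "\<forall>t\<in>T. m t s0 = 0")
    case True
    have "\<exists>\<alpha>. (\<forall>t\<in>T. \<alpha> t \<in> C) \<and> (\<exists>t\<in>T. \<alpha> t \<noteq> 0) \<and> (\<forall>s\<in>S. (\<Sum>t\<in>T. \<alpha> t * m t s) = 0)"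
      by (rule insert.IH) (use insert.prems insert.hyps in auto)
    then show ?thesis using True by auto
  next
    case False
    then obtain t0 where t0: "t0 \<in> T" "m t0 s0 \<noteq> 0" by blast
    define T' where "T' = T - {t0}"
    have T': "finite T'" "card S < card T'" "T = insert t0 T'" "t0 \<notin> T'"
      using insert.prems insert.hyps t0 by (auto simp: T'_def)
    define m' where "m' = (\<lambda>t s. m t0 s0 * m t s - m t s0 * m t0 s)"
    have "\<exists>\<alpha>. (\<forall>t\<in>T'. \<alpha> t \<in> C) \<and> (\<exists>t\<in>T'. \<alpha> t \<noteq> 0) \<and> (\<forall>s\<in>S. (\<Sum>t\<in>T'. \<alpha> t * m' t s) = 0)"
      by (rule insert.IH) (use insert.prems T' t0 in \<open>auto simp: m'_def intro!: D\<close>)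
    then obtain \<alpha> where a: "\<And>t. t \<in> T' \<Longrightarrow> \<alpha> t \<in> C" "\<exists>t\<in>T'. \<alpha> t \<noteq> 0"
      "\<And>s. s \<in> S \<Longrightarrow> (\<Sum>t\<in>T'. \<alpha> t * m' t s) = 0" by blast
    define \<beta> where "\<beta> = (\<lambda>t. if t = t0 then - (\<Sum>t\<in>T'. \<alpha> t * m t s0) else \<alpha> t * m t0 s0)"
    have "\<beta> t \<in> C" if "t \<in> T" for t
      using that a(1) insert.prems(3) t0 T' unfolding \<beta>_def
      by (auto intro!: D subring_set_sum[OF C])
    moreover have "\<exists>t\<in>T. \<beta> t \<noteq> 0"
    proof -
      obtain t where t: "t \<in> T'" "\<alpha> t \<noteq> 0" using a(2) by blast
      then have "\<alpha> t * m t0 s0 \<noteq> 0" using dom[OF a(1)[OF t(1)], of "m t0 s0"] t0 insert.prems(3) by blast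
      then have "\<beta> t \<noteq> 0" "t \<in> T" using t T' by (auto simp: \<beta>_def)
      then show ?thesis by blast
    qed
    moreover have "(\<Sum>t\<in>T. \<beta> t * m t s) = 0" if "s \<in> insert s0 S" for s
    proof -
      have "(\<Sum>t\<in>T. \<beta> t * m t s) = \<beta> t0 * m t0 s + (\<Sum>t\<in>T'. \<alpha> t * m t0 s0 * m t s)"
        using T' by (simp add: \<beta>_def) (rule sum.cong, auto)
      also have "\<dots> = (\<Sum>t\<in>T'. \<alpha> t * (m t0 s0 * m t s - m t s0 * m t0 s))"
        by (simp add: \<beta>_def sum_distrib_right right_diff_distrib sum_subtractf mult.assoc)
      also have "\<dots> = 0"
        using that a(3) by (cases "s = s0") (auto simp: m'_def mult.commute)
      finally show ?thesis .
    qed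
    ultimately show ?thesis by blast
  qed
qed

section \<open>Restriction of polynomial functions to lines\<close>

abbreviation line :: "('v \<Rightarrow> complex) \<Rightarrow> ('v \<Rightarrow> complex) \<Rightarrow> complex \<Rightarrow> 'v \<Rightarrow> complex" where
  "line \<zeta> d \<tau> \<equiv> (\<lambda>v. \<zeta> v + \<tau> * d v)"

lemma expand_along_direction:
  assumes "f \<in> polyfun V"
  shows "\<exists>p\<in>polys_over (polyfun V). \<forall>\<zeta> \<tau>. f (line \<zeta> d \<tau>) = poly (specialize \<zeta> p) \<tau>"
  using assms
proof (induction rule: polyfun.induct)
  note cl = polys_over_closed[OF subring_polyfun[of V]]
  case (const c)
  show ?case by (intro bexI[of _ "[:\<lambda>_. c:]"] cl polyfun.const) (simp add: specialize_def map_poly_pCons)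
next
  note cl = polys_over_closed[OF subring_polyfun[of V]]
  case (coord v)
  have "[:(\<lambda>x. x v), (\<lambda>_. d v):] \<in> polys_over (polyfun V)"
    using coord by (auto simp: polys_over_def coeff_pCons zero_fun_def intro: polyfun.intros split: nat.split)
  moreover have "specialize \<zeta> [:(\<lambda>x. x v), (\<lambda>_. d v):] = [:\<zeta> v, d v:]" for \<zeta>
    by (rule poly_eqI) (auto simp: coeff_pCons split: nat.split)
  ultimately show ?case by (intro bexI[of _ "[:(\<lambda>x. x v), (\<lambda>_. d v):]"]) auto
next
  note cl = polys_over_closed[OF subring_polyfun[of V]]
  case (add f g)
  then obtain p q where "p \<in> polys_over (polyfun V)" "q \<in> polys_over (polyfun V)"
    "\<forall>\<zeta> \<tau>. f (line \<zeta> d \<tau>) = poly (specialize \<zeta> p) \<tau>" "\<forall>\<zeta> \<tau>. g (line \<zeta> d \<tau>) = poly (specialize \<zeta> q) \<tau>"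
    by blast
  then show ?case by (intro bexI[of _ "p + q"] cl) (auto simp: specialize_add)
next
  note cl = polys_over_closed[OF subring_polyfun[of V]]
  case (mult f g)
  then obtain p q where "p \<in> polys_over (polyfun V)" "q \<in> polys_over (polyfun V)"
    "\<forall>\<zeta> \<tau>. f (line \<zeta> d \<tau>) = poly (specialize \<zeta> p) \<tau>" "\<forall>\<zeta> \<tau>. g (line \<zeta> d \<tau>) = poly (specialize \<zeta> q) \<tau>"
    by blast
  then show ?case by (intro bexI[of _ "p * q"] cl) (auto simp: specialize_mult)
qed

lemma polyfun_on_line:
  assumes "f \<in> polyfun V" shows "\<exists>p::complex poly. \<forall>\<tau>. f (line \<zeta> d \<tau>) = poly p \<tau>"
  using expand_along_direction[OF assms, of d] by blast

text \<open>On the line through a point where \<open>f\<close> is not zero and one where \<open>g\<close> is not zero, both are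
  nonzero polynomials in one variable.\<close>

lemma polyfun_no_zero_divisors:
  assumes "f \<in> polyfun V" "g \<in> polyfun V" "f * g = 0"
  shows "f = 0 \<or> g = 0"
proof (rule ccontr)
  assume "\<not> ?thesis"
  then obtain x y where xy: "f x \<noteq> 0" "g y \<noteq> 0" by (auto simp: fun_eq_iff)
  obtain p q where p: "\<And>\<tau>. f (line x (\<lambda>v. y v - x v) \<tau>) = poly p \<tau>"
    and q: "\<And>\<tau>. g (line x (\<lambda>v. y v - x v) \<tau>) = poly q \<tau>"
    using polyfun_on_line[OF assms(1)] polyfun_on_line[OF assms(2)] by metis
  have "poly p 0 \<noteq> 0" "poly q 1 \<noteq> 0" using xy by (simp_all flip: p q)
  then have "p * q \<noteq> 0" by auto
  moreover have "poly (p * q) \<tau> = 0" for \<tau>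
    using fun_cong[OF assms(3), of "line x (\<lambda>v. y v - x v) \<tau>"] by (simp flip: p q)
  ultimately show False using poly_all_0_iff_0 by blast
qed

text \<open>\<open>homogeneous V k f\<close> records the only property of forms of degree \<open>k\<close> that matters here:
  along every direction \<open>d\<close> they are polynomials of degree \<open>k\<close> with constant leading
  coefficient \<open>f d\<close>.\<close>

definition homogeneous :: "'v set \<Rightarrow> nat \<Rightarrow> (('v \<Rightarrow> complex) \<Rightarrow> complex) \<Rightarrow> bool" where
  "homogeneous V k f \<longleftrightarrow> f \<in> polyfun V \<and> (\<forall>d. \<exists>p\<in>polys_over (polyfun V). degree p \<le> k \<and>
     coeff p k = (\<lambda>_. f d) \<and> (\<forall>\<zeta> \<tau>. f (line \<zeta> d \<tau>) = poly (specialize \<zeta> p) \<tau>))"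

lemma specialize_0: "specialize \<pi> 0 = 0"
  by (rule poly_eqI) simp

lemma homogeneous_0: "homogeneous V k 0"
  unfolding homogeneous_def
proof (intro conjI allI)
  show "0 \<in> polyfun V" by (rule subring_setD(1)[OF subring_polyfun])
  show "\<exists>p\<in>polys_over (polyfun V). degree p \<le> k \<and> coeff p k = (\<lambda>_. 0 d) \<and>
     (\<forall>\<zeta> \<tau>. 0 (line \<zeta> d \<tau>) = poly (specialize \<zeta> p) \<tau>)" for d
    by (rule bexI[OF _ polys_over_closed(1)[OF subring_polyfun]]) (simp add: specialize_0 fun_eq_iff)
qed

lemma homogeneous_add:
  assumes "homogeneous V k f" "homogeneous V k g"
  shows "homogeneous V k (f + g)"
  unfolding homogeneous_def
proof (intro conjI allI)
  note cl = polys_over_closed[OF subring_polyfun[of V]]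
  show "f + g \<in> polyfun V" using assms by (auto simp: homogeneous_def intro: subring_setD[OF subring_polyfun])
  fix d
  obtain p q where "p \<in> polys_over (polyfun V)" "q \<in> polys_over (polyfun V)" "degree p \<le> k" "degree q \<le> k"
    "coeff p k = (\<lambda>_. f d)" "coeff q k = (\<lambda>_. g d)"
    "\<forall>\<zeta> \<tau>. f (line \<zeta> d \<tau>) = poly (specialize \<zeta> p) \<tau>" "\<forall>\<zeta> \<tau>. g (line \<zeta> d \<tau>) = poly (specialize \<zeta> q) \<tau>"
    using assms unfolding homogeneous_def by meson
  then show "\<exists>p\<in>polys_over (polyfun V). degree p \<le> k \<and> coeff p k = (\<lambda>_. (f + g) d) \<and>
     (\<forall>\<zeta> \<tau>. (f + g) (line \<zeta> d \<tau>) = poly (specialize \<zeta> p) \<tau>)"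
    by (intro bexI[of _ "p + q"] cl) (auto simp: specialize_add degree_add_le fun_eq_iff)
qed

lemma homogeneous_sum:
  "(\<And>i. i \<in> A \<Longrightarrow> homogeneous V k (f i)) \<Longrightarrow> homogeneous V k (sum f A)"
  by (induction A rule: infinite_finite_induct) (auto intro: homogeneous_0 homogeneous_add)

lemma homogeneous_mult:
  assumes "homogeneous V k f" "homogeneous V l g"
  shows "homogeneous V (k + l) (f * g)"
  unfolding homogeneous_def
proof (intro conjI allI)
  note cl = polys_over_closed[OF subring_polyfun[of V]]
  show "f * g \<in> polyfun V" using assms by (auto simp: homogeneous_def intro: subring_setD[OF subring_polyfun])
  fix d
  obtain p q where *: "p \<in> polys_over (polyfun V)" "q \<in> polys_over (polyfun V)" "degree p \<le> k" "degree q \<le> l"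
    "coeff p k = (\<lambda>_. f d)" "coeff q l = (\<lambda>_. g d)"
    "\<forall>\<zeta> \<tau>. f (line \<zeta> d \<tau>) = poly (specialize \<zeta> p) \<tau>" "\<forall>\<zeta> \<tau>. g (line \<zeta> d \<tau>) = poly (specialize \<zeta> q) \<tau>"
    using assms unfolding homogeneous_def by meson
  have "coeff (p * q) (k + l) = coeff p k * coeff q l"
  proof -
    have "coeff p i * coeff q (k + l - i) = 0" if "i \<in> {..k + l} - {k}" for i
      using that *(3,4) by (cases "i < k") (auto simp: coeff_eq_0)
    then have "(\<Sum>i\<le>k + l. coeff p i * coeff q (k + l - i)) = (\<Sum>i\<in>{k}. coeff p i * coeff q (k + l - i))"
      by (intro sum.mono_neutral_right) auto
    then show ?thesis by (simp add: coeff_mult)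
  qed
  then show "\<exists>p\<in>polys_over (polyfun V). degree p \<le> k + l \<and> coeff p (k + l) = (\<lambda>_. (f * g) d) \<and>
     (\<forall>\<zeta> \<tau>. (f * g) (line \<zeta> d \<tau>) = poly (specialize \<zeta> p) \<tau>)"
    using * by (intro bexI[of _ "p * q"] cl)
      (auto simp: specialize_mult fun_eq_iff intro: order.trans[OF degree_mult_le])
qed

text \<open>The coefficients of \<open>F\<close> are the homogeneous components of \<open>f\<close>. Collecting them in a
  polynomial makes the decomposition compatible with products.\<close>

lemma homogeneous_components:
  assumes "f \<in> polyfun V"
  shows "\<exists>F. f = poly F 1 \<and> (\<forall>k. homogeneous V k (coeff F k))"
  using assms
proof (induction rule: polyfun.induct)
  case (const c)
  have "homogeneous V 0 (\<lambda>_. c)" unfolding homogeneous_def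
    by (auto intro!: polyfun.const bexI[of _ "[:\<lambda>_. c:]"] polys_over_closed[OF subring_polyfun]
        simp: specialize_def map_poly_pCons)
  then show ?case
    by (intro exI[of _ "[:\<lambda>_. c:]"]) (auto simp: coeff_pCons homogeneous_0 split: nat.split)
next
  case (coord v)
  have "homogeneous V 1 (\<lambda>x. x v)" unfolding homogeneous_def
  proof (intro conjI allI polyfun.coord coord)
    fix d
    have "[:(\<lambda>x. x v), (\<lambda>_. d v):] \<in> polys_over (polyfun V)"
      using coord by (auto simp: polys_over_def coeff_pCons zero_fun_def intro: polyfun.intros split: nat.split)
    moreover have "specialize \<zeta> [:(\<lambda>x. x v), (\<lambda>_. d v):] = [:\<zeta> v, d v:]" for \<zeta>
      by (rule poly_eqI) (auto simp: coeff_pCons split: nat.split)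
    ultimately show "\<exists>p\<in>polys_over (polyfun V). degree p \<le> 1 \<and> coeff p 1 = (\<lambda>_. d v) \<and>
      (\<forall>\<zeta> \<tau>. line \<zeta> d \<tau> v = poly (specialize \<zeta> p) \<tau>)"
      by (intro bexI[of _ "[:(\<lambda>x. x v), (\<lambda>_. d v):]"]) auto
  qed
  then show ?case
    by (intro exI[of _ "monom (\<lambda>x. x v) 1"]) (auto simp: poly_monom homogeneous_0)
next
  case (add f g)
  then obtain F G where *: "f = poly F 1" "g = poly G 1" "\<And>k. homogeneous V k (coeff F k)"
    "\<And>k. homogeneous V k (coeff G k)" by blast
  have "(\<lambda>x. f x + g x) = poly (F + G) 1" by (simp only: poly_add plus_fun_def *(1,2))
  moreover have "homogeneous V k (coeff (F + G) k)" for k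
    unfolding coeff_add by (rule homogeneous_add[OF *(3,4)])
  ultimately show ?case by blast
next
  case (mult f g)
  then obtain F G where *: "f = poly F 1" "g = poly G 1" "\<And>k. homogeneous V k (coeff F k)"
    "\<And>k. homogeneous V k (coeff G k)" by blast
  have "homogeneous V k (coeff (F * G) k)" for k unfolding coeff_mult
  proof (rule homogeneous_sum)
    fix i assume "i \<in> {..k}"
    then show "homogeneous V k (coeff F i * coeff G (k - i))"
      using homogeneous_mult[OF *(3)[of i] *(4)[of "k - i"]] by simp
  qed
  moreover have "(\<lambda>x. f x * g x) = poly (F * G) 1" by (simp only: poly_mult times_fun_def *(1,2))
  ultimately show ?case by blast
qed

text \<open>The function \<open>h\<close> is the top homogeneous component of \<open>f\<close>. Along directions \<open>d\<close> with
  \<open>h d \<noteq> 0\<close>, the restrictions of \<open>f\<close> to lines have degree exactly \<open>m\<close> and the same leading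
  coefficient: this is the linear change of coordinates that makes \<open>f\<close> monic.\<close>

lemma monic_along_direction:
  assumes "f \<in> polyfun V" "f \<noteq> 0"
  shows "\<exists>m. \<exists>h\<in>polyfun V. h \<noteq> 0 \<and> (\<forall>d. \<exists>p\<in>polys_over (polyfun V). degree p \<le> m \<and>
     coeff p m = (\<lambda>_. h d) \<and> (\<forall>\<zeta> \<tau>. f (line \<zeta> d \<tau>) = poly (specialize \<zeta> p) \<tau>))"
proof -
  note cl = polys_over_closed[OF subring_polyfun[of V]]
  obtain F where F: "f = poly F 1" "\<And>k. homogeneous V k (coeff F k)"
    using homogeneous_components[OF assms(1)] by blast
  define m where "m = degree F"
  have "F \<noteq> 0" using assms(2) F(1) by auto
  then have top: "coeff F m \<noteq> 0" by (simp add: m_def)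
  have "\<exists>p\<in>polys_over (polyfun V). degree p \<le> m \<and>
     coeff p m = (\<lambda>_. coeff F m d) \<and> (\<forall>\<zeta> \<tau>. f (line \<zeta> d \<tau>) = poly (specialize \<zeta> p) \<tau>)" for d
  proof -
    have "\<forall>k. \<exists>p. p \<in> polys_over (polyfun V) \<and> degree p \<le> k \<and> coeff p k = (\<lambda>_. coeff F k d) \<and>
       (\<forall>\<zeta> \<tau>. coeff F k (line \<zeta> d \<tau>) = poly (specialize \<zeta> p) \<tau>)"
      using F(2) unfolding homogeneous_def by blast
    from choice[OF this] obtain p where p: "\<And>k. p k \<in> polys_over (polyfun V)" "\<And>k. degree (p k) \<le> k"
      "\<And>k. coeff (p k) k = (\<lambda>_. coeff F k d)"
      "\<And>k \<zeta> \<tau>. coeff F k (line \<zeta> d \<tau>) = poly (specialize \<zeta> (p k)) \<tau>"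
      by blast
    have sp: "specialize \<zeta> (\<Sum>k\<le>m. p k) = (\<Sum>k\<le>m. specialize \<zeta> (p k))" for \<zeta>
      by (rule poly_eqI) (simp add: coeff_sum sum_fun_apply)
    have "(\<Sum>k\<le>m. p k) \<in> polys_over (polyfun V)"
      using p(1) by (auto simp: polys_over_def coeff_sum intro!: subring_set_sum[OF subring_polyfun])
    moreover have "degree (\<Sum>k\<le>m. p k) \<le> m"
      by (intro degree_sum_le order.trans[OF p(2)]) auto
    moreover have "coeff (\<Sum>k\<le>m. p k) m = (\<lambda>_. coeff F m d)"
    proof -
      have "coeff (p k) m = 0" if "k \<in> {..m} - {m}" for k
        using that le_less_trans[OF p(2)[of k], of m] by (intro coeff_eq_0) auto
      then have "(\<Sum>k\<le>m. coeff (p k) m) = (\<Sum>k\<in>{m}. coeff (p k) m)"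
        by (intro sum.mono_neutral_right) auto
      then show ?thesis using p(3) by (simp add: coeff_sum)
    qed
    moreover have "f (line \<zeta> d \<tau>) = poly (specialize \<zeta> (\<Sum>k\<le>m. p k)) \<tau>" for \<zeta> \<tau>
      by (simp add: F(1) poly_altdef[of F] m_def[symmetric] sum_fun_apply sp poly_sum p(4))
    ultimately show ?thesis by blast
  qed
  moreover have "coeff F m \<in> polyfun V" using F(2) by (simp add: homogeneous_def)
  ultimately show ?thesis using top by (intro exI[of _ m] bexI[of _ "coeff F m"] conjI allI)
qed

section \<open>Noether normalization\<close>

text \<open>The preimage, in the ambient ring, of the \<open>C\<close>-module generated by the image of \<open>S\<close> modulo
  \<open>P\<close>. In the application it contains everything, which says that the quotient by \<open>P\<close> is a
  finite module over \<open>C\<close>.\<close>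

definition generated_module :: "'r::comm_ring_1 set \<Rightarrow> 'r set \<Rightarrow> 'r set \<Rightarrow> 'r set" where
  "generated_module C S P = {f. \<exists>c. (\<forall>s\<in>S. c s \<in> C) \<and> f - (\<Sum>s\<in>S. c s * s) \<in> P}"

lemma generated_module_add:
  assumes "subring_set C" "prime_in R P" "f \<in> generated_module C S P" "g \<in> generated_module C S P"
  shows "f + g \<in> generated_module C S P"
proof -
  obtain c d where c: "\<forall>s\<in>S. c s \<in> C" "f - (\<Sum>s\<in>S. c s * s) \<in> P"
    and d: "\<forall>s\<in>S. d s \<in> C" "g - (\<Sum>s\<in>S. d s * s) \<in> P"
    using assms(3,4) by (auto simp: generated_module_def)
  have eq: "(f + g) - (\<Sum>s\<in>S. (c s + d s) * s) = (f - (\<Sum>s\<in>S. c s * s)) + (g - (\<Sum>s\<in>S. d s * s))"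
    by (simp add: distrib_right sum.distrib)
  have "(f + g) - (\<Sum>s\<in>S. (c s + d s) * s) \<in> P"
    unfolding eq by (rule prime_inD(4)[OF assms(2) c(2) d(2)])
  then show ?thesis using c d subring_setD(3)[OF assms(1)]
    unfolding generated_module_def by (intro CollectI exI[of _ "\<lambda>s. c s + d s"]) auto
qed

lemma generated_module_scale:
  assumes "subring_set C" "prime_in R P" "C \<subseteq> R" "a \<in> C" "f \<in> generated_module C S P"
  shows "a * f \<in> generated_module C S P"
proof -
  obtain c where c: "\<forall>s\<in>S. c s \<in> C" "f - (\<Sum>s\<in>S. c s * s) \<in> P"
    using assms(5) by (auto simp: generated_module_def)
  have eq: "a * f - (\<Sum>s\<in>S. (a * c s) * s) = a * (f - (\<Sum>s\<in>S. c s * s))"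
    by (simp add: right_diff_distrib sum_distrib_left mult.assoc)
  have "a * f - (\<Sum>s\<in>S. (a * c s) * s) \<in> P"
    unfolding eq using assms(3,4) by (intro prime_inD(5)[OF assms(2) _ c(2)]) auto
  then show ?thesis using c subring_setD(4)[OF assms(1)] assms(4)
    unfolding generated_module_def by (intro CollectI exI[of _ "\<lambda>s. a * c s"]) auto
qed

lemma generated_module_cong:
  assumes "prime_in R P" "f \<in> generated_module C S P" "g - f \<in> P"
  shows "g \<in> generated_module C S P"
proof -
  obtain c where c: "\<forall>s\<in>S. c s \<in> C" "f - (\<Sum>s\<in>S. c s * s) \<in> P"
    using assms(2) by (auto simp: generated_module_def)
  have eq: "g - (\<Sum>s\<in>S. c s * s) = (g - f) + (f - (\<Sum>s\<in>S. c s * s))" by simp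
  have "g - (\<Sum>s\<in>S. c s * s) \<in> P" unfolding eq by (rule prime_inD(4)[OF assms(1,3) c(2)])
  then show ?thesis using c unfolding generated_module_def by auto
qed

lemma generated_module_base:
  assumes "subring_set C" "prime_in R P" "finite S" "t \<in> S"
  shows "t \<in> generated_module C S P"
proof -
  have "(\<Sum>s\<in>S. (if s = t then 1 else 0) * s) = (\<Sum>s\<in>S. if s = t then s else 0)"
    by (intro sum.cong) auto
  also have "\<dots> = t" using assms(3,4) by simp
  finally show ?thesis using subring_setD(1,2)[OF assms(1)] prime_inD(2)[OF assms(2)]
    unfolding generated_module_def by (auto intro!: exI[of _ "\<lambda>s. if s = t then 1 else 0"])
qed

lemma generated_module_0:
  assumes "subring_set C" "prime_in R P" shows "0 \<in> generated_module C S P"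
  using subring_setD(1)[OF assms(1)] prime_inD(2)[OF assms(2)]
  unfolding generated_module_def by (auto intro!: exI[of _ "\<lambda>_. 0"])

lemma generated_module_sum:
  assumes "subring_set C" "prime_in R P" "\<And>i. i \<in> A \<Longrightarrow> f i \<in> generated_module C S P"
  shows "sum f A \<in> generated_module C S P"
  using assms(3) by (induction A rule: infinite_finite_induct)
    (auto intro: generated_module_0[OF assms(1,2)] generated_module_add[OF assms(1,2)])

text \<open>The ring of functions on the base of the covering map with components \<open>z k\<close>, for \<open>k \<in> I\<close>,
  seen as functions on the covering space.\<close>

definition pullbacks :: "('k \<Rightarrow> ('w \<Rightarrow> complex) \<Rightarrow> complex) \<Rightarrow> 'k set \<Rightarrow> (('w \<Rightarrow> complex) \<Rightarrow> complex) set" where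
  "pullbacks z I = (\<lambda>c w. c (\<lambda>k. z k w)) ` polyfun I"

lemma subring_pullbacks: "subring_set (pullbacks z I)"
  unfolding subring_set_def
proof (intro conjI ballI)
  note D = subring_setD[OF subring_polyfun[of I]]
  show "1 \<in> pullbacks z I" unfolding pullbacks_def by (rule image_eqI[OF _ D(2)]) (simp add: fun_eq_iff)
  fix a b assume "a \<in> pullbacks z I" "b \<in> pullbacks z I"
  then obtain c d where c: "c \<in> polyfun I" "a = (\<lambda>w. c (\<lambda>k. z k w))"
    and d: "d \<in> polyfun I" "b = (\<lambda>w. d (\<lambda>k. z k w))" by (auto simp: pullbacks_def)
  show "a + b \<in> pullbacks z I" unfolding pullbacks_def
    by (rule image_eqI[OF _ D(3)[OF c(1) d(1)]]) (simp add: fun_eq_iff c d)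
  show "a * b \<in> pullbacks z I" unfolding pullbacks_def
    by (rule image_eqI[OF _ D(4)[OF c(1) d(1)]]) (simp add: fun_eq_iff c d)
  show "- a \<in> pullbacks z I" unfolding pullbacks_def
    by (rule image_eqI[OF _ D(5)[OF c(1)]]) (simp add: fun_eq_iff c d)
qed

text \<open>Take \<open>I\<close> as small as possible. If the functions \<open>z k\<close> satisfied a relation \<open>Q\<close> modulo
  \<open>P\<close>, choose a direction \<open>d\<close> at which the top component of \<open>Q\<close> does not vanish. Moving along
  \<open>d\<close> until the coordinate \<open>i0\<close> becomes zero replaces \<open>z\<close> by \<open>z'\<close> with one coordinate less, and
  \<open>Q\<close> turns into a monic equation for the displacement \<open>\<tau>\<close>, so the ring is also finite over the
  smaller one.\<close>

lemma noether_normalization: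
  fixes P :: "(('w::finite \<Rightarrow> complex) \<Rightarrow> complex) set"
  assumes P: "prime_in (polyfun UNIV) P"
  shows "\<exists>I. \<exists>z::'w \<Rightarrow> ('w \<Rightarrow> complex) \<Rightarrow> complex. \<exists>S. (\<forall>k. z k \<in> polyfun UNIV) \<and> finite S \<and> S \<subseteq> polyfun UNIV \<and>
     polyfun UNIV \<subseteq> generated_module (pullbacks z I) S P \<and>
     (\<forall>c\<in>polyfun I. (\<lambda>w. c (\<lambda>k. z k w)) \<in> P \<longrightarrow> c = 0)"
proof -
  let ?R = "polyfun UNIV :: (('w \<Rightarrow> complex) \<Rightarrow> complex) set"
  define fin where "fin = (\<lambda>I z S. (\<forall>k. z k \<in> ?R) \<and> finite S \<and> S \<subseteq> ?R \<and>
     ?R \<subseteq> generated_module (pullbacks (z :: 'w \<Rightarrow> ('w \<Rightarrow> complex) \<Rightarrow> complex) (I::'w set)) S P)"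
  have "fin UNIV (\<lambda>k w. w k) {1}"
  proof -
    have "Q \<in> generated_module (pullbacks (\<lambda>k w. w k) UNIV) {1} P" if "Q \<in> ?R" for Q
      unfolding generated_module_def using that prime_inD(2)[OF P]
      by (auto simp: pullbacks_def intro!: exI[of _ "\<lambda>_. Q"])
    then show ?thesis by (auto simp: fin_def one_fun_def intro: polyfun.intros)
  qed
  then have "\<exists>n I z S. card I = n \<and> fin I z S" by blast
  then obtain n where n: "\<exists>I z S. card I = n \<and> fin I z S"
    and min: "\<And>n'. n' < n \<Longrightarrow> \<not> (\<exists>I z S. card I = n' \<and> fin I z S)"
    using exists_least_iff[of "\<lambda>n. \<exists>I z S. card I = n \<and> fin I z S"] by blast
  then obtain I z S where I: "card I = n" "fin I z S" by blast
  have zR: "z k \<in> ?R" for k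
    using I(2) by (auto simp: fin_def)
  have S: "finite S" "S \<subseteq> ?R" and gen: "?R \<subseteq> generated_module (pullbacks z I) S P"
    using I(2) by (auto simp: fin_def)
  have False if Q: "Q \<in> polyfun I" "(\<lambda>w. Q (\<lambda>k. z k w)) \<in> P" "Q \<noteq> 0" for Q
  proof -
    obtain m h where h: "h \<in> polyfun I" "h \<noteq> 0"
      and hd: "\<And>d. \<exists>p\<in>polys_over (polyfun I). degree p \<le> m \<and>
        coeff p m = (\<lambda>_. h d) \<and> (\<forall>\<zeta> \<tau>. Q (line \<zeta> d \<tau>) = poly (specialize \<zeta> p) \<tau>)"
      using monic_along_direction[OF Q(1,3)] by blast
    \<comment> \<open>The direction of the change of coordinates.\<close>
    obtain d where d: "h d \<noteq> 0" using h(2) by (auto simp: fun_eq_iff)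
    define \<gamma> where "\<gamma> = h d"
    have g0: "\<gamma> \<noteq> 0" using d by (simp add: \<gamma>_def)
    obtain p where p: "p \<in> polys_over (polyfun I)" "degree p \<le> m" "coeff p m = (\<lambda>_. \<gamma>)"
      "\<And>\<zeta> \<tau>. Q (line \<zeta> d \<tau>) = poly (specialize \<zeta> p) \<tau>"
      using hd[of d] unfolding \<gamma>_def by blast
    have dsp: "degree (specialize \<zeta> p) = m" for \<zeta>
      using le_degree[of "specialize \<zeta> p" m] degree_specialize[of \<zeta> p] p(2,3) g0 by simp
    \<comment> \<open>Otherwise \<open>Q\<close> would be constant along \<open>d\<close>, hence a nonzero constant lying in the prime
      ideal.\<close>
    have "\<exists>i0\<in>I. d i0 \<noteq> 0"
    proof (rule ccontr)
      assume "\<not> ?thesis"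
      then have "Q (line 0 d \<tau>) = Q (line 0 d 0)" for \<tau> by (intro polyfun_cong[OF Q(1)]) auto
      then have "poly (specialize 0 p) \<tau> = poly [:Q (line 0 d 0):] \<tau>" for \<tau>
        unfolding p(4)[symmetric] by simp
      then have "specialize 0 p = [:Q (line 0 d 0):]" using poly_eq_poly_eq_iff by blast
      then have m0: "m = 0" using dsp[of 0] by simp
      have "Q \<zeta> = \<gamma>" for \<zeta>
      proof -
        have "Q \<zeta> = poly (specialize \<zeta> p) 0" using p(4)[of \<zeta> 0] by simp
        then show ?thesis using p(3) m0 by (simp add: poly_0_coeff_0)
      qed
      then have "(\<lambda>w. 1 / \<gamma>) * (\<lambda>w. Q (\<lambda>k. z k w)) = 1" using g0 by (simp add: fun_eq_iff)
      then show False using prime_inD(5)[OF P polyfun.const Q(2), of "1 / \<gamma>"] prime_inD(3)[OF P] by simp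
    qed
    then obtain i0 where i0: "i0 \<in> I" "d i0 \<noteq> 0" by blast
    define \<tau> where "\<tau> = (\<lambda>w. z i0 w / d i0)"
    define z' where "z' = (\<lambda>k w. z k w - \<tau> w * d k)"
    define I' where "I' = I - {i0}"
    have \<tau>R: "\<tau> \<in> ?R" unfolding \<tau>_def
      using polyfun.mult[OF zR[of i0] polyfun.const[of "1 / d i0"]] by simp
    have z'R: "z' k \<in> ?R" for k unfolding z'_def
      by (intro polyfun_diff zR polyfun.mult \<tau>R polyfun.const)
    have z'0: "z' i0 = (\<lambda>_. 0)" using i0 by (simp add: z'_def \<tau>_def)
    have zline: "(\<lambda>k. z k w) = line (\<lambda>k. z' k w) d (\<tau> w)" for w by (simp add: z'_def)
    define C where "C = pullbacks z' I'"
    define S' where "S' = (\<lambda>(s, j). s * \<tau> ^ j) ` (S \<times> {..<m})"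
    define M where "M = generated_module C S' P"
    have C: "subring_set C" unfolding C_def by (rule subring_pullbacks)
    have CR: "C \<subseteq> ?R" using polyfun_compose[OF _ z'R] by (auto simp: C_def pullbacks_def)
    have S': "finite S'" using S by (auto simp: S'_def)
    have S'R: "S' \<subseteq> ?R" using S \<tau>R
      by (auto simp: S'_def intro!: subring_setD[OF subring_polyfun] subring_set_power[OF subring_polyfun])
    have coefC: "(\<lambda>w. c (\<lambda>k. z' k w)) \<in> C" if c: "c \<in> polyfun I" for c
    proof -
      define c' where "c' = (\<lambda>\<zeta>. c (\<lambda>k. (if k = i0 then (\<lambda>_. 0) else (\<lambda>\<zeta>. \<zeta> k)) \<zeta>))"
      have "c' \<in> polyfun I'" unfolding c'_def
        by (rule polyfun_compose[OF c]) (auto simp: I'_def intro: polyfun.intros)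
      moreover have "(\<lambda>w. c (\<lambda>k. z' k w)) = (\<lambda>w. c' (\<lambda>k. z' k w))"
        using z'0 by (intro ext) (auto simp: c'_def intro!: arg_cong[of _ _ c])
      ultimately show ?thesis unfolding C_def pullbacks_def by (metis image_eqI)
    qed
    have expand: "(\<lambda>w. c (\<lambda>k. z k w)) = (\<Sum>j\<le>degree r. (\<lambda>w. coeff r j (\<lambda>k. z' k w)) * \<tau> ^ j)"
      if r: "\<And>\<zeta> \<tau>. c (line \<zeta> d \<tau>) = poly (specialize \<zeta> r) \<tau>" for c r
    proof
      fix w
      have "c (\<lambda>k. z k w) = poly (specialize (\<lambda>k. z' k w) r) (\<tau> w)" using zline r by simp
      also have "\<dots> = poly r (\<lambda>_. \<tau> w) (\<lambda>k. z' k w)"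
        using poly_specialize[of "\<lambda>k. z' k w" r "\<lambda>_. \<tau> w"] by simp
      finally show "c (\<lambda>k. z k w) = (\<Sum>j\<le>degree r. (\<lambda>w. coeff r j (\<lambda>k. z' k w)) * \<tau> ^ j) w"
        by (simp add: poly_altdef sum_fun_apply power_fun_apply)
    qed
    have powers: "s * \<tau> ^ j \<in> M" if s: "s \<in> S" for s j
    proof (induction j rule: less_induct)
      case (less j)
      show ?case
      proof (cases "j < m")
        case True
        show ?thesis unfolding M_def
        proof (rule generated_module_base[OF C P S'])
          show "s * \<tau> ^ j \<in> S'" unfolding S'_def
            by (rule image_eqI[of _ _ "(s, j)"]) (use s True in simp_all)
        qed
      next
        case False
        \<comment> \<open>The monic equation for \<open>\<tau>\<close> expresses its \<open>m\<close>-th power by lower ones.\<close>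
        define a where "a = (\<lambda>i. (\<lambda>w. - coeff p i (\<lambda>k. z' k w) / \<gamma>))"
        have aC: "a i \<in> C" for i
          unfolding a_def using coefC[OF polyfun.mult[OF polyfun.const[of "- 1 / \<gamma>"] polys_over_coeff[OF p(1)]], of i] by simp
        define r where "r = (\<Sum>i<m. a i * (s * \<tau> ^ (j - m + i)))"
        have "r \<in> M" unfolding r_def M_def
        proof (intro generated_module_sum[OF C P] generated_module_scale[OF C P CR aC])
          fix i assume "i \<in> {..<m}"
          then have "j - m + i < j" using False by auto
          from less.IH[OF this] show "s * \<tau> ^ (j - m + i) \<in> generated_module C S' P"
            unfolding M_def .
        qed
        moreover have "s * \<tau> ^ j - r \<in> P"
        proof -
          have "s * \<tau> ^ j - r = ((\<lambda>_. 1 / \<gamma>) * s * \<tau> ^ (j - m)) * (\<lambda>w. Q (\<lambda>k. z k w))"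
          proof
            fix w
            let ?\<zeta> = "\<lambda>k. z' k w"
            have dp: "degree p = m" using le_degree[of p m] p(2,3) g0 by (auto simp: fun_eq_iff)
            have "Q (\<lambda>k. z k w) = (\<Sum>j\<le>m. coeff p j ?\<zeta> * \<tau> w ^ j)"
              using fun_cong[OF expand[of Q p], OF p(4)] dp by (simp add: sum_fun_apply power_fun_apply)
            also have "\<dots> = \<gamma> * \<tau> w ^ m + (\<Sum>j<m. coeff p j ?\<zeta> * \<tau> w ^ j)"
              using p(3) by (simp flip: lessThan_Suc_atMost)
            finally have *: "Q (\<lambda>k. z k w) = \<dots>" .
            have "\<tau> w ^ j = \<tau> w ^ (j - m) * \<tau> w ^ m" using False by (simp flip: power_add)
            then show "(s * \<tau> ^ j - r) w = (((\<lambda>_. 1 / \<gamma>) * s * \<tau> ^ (j - m)) * (\<lambda>w. Q (\<lambda>k. z k w))) w"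
              using g0 by (simp add: r_def a_def sum_fun_apply power_fun_apply * power_add field_simps
                  sum_distrib_left sum_negf)
          qed
          also have "\<dots> \<in> P" using S(2) s \<tau>R
            by (intro prime_inD(5)[OF P _ Q(2)] subring_setD[OF subring_polyfun]
                subring_set_power[OF subring_polyfun] polyfun.const) auto
          finally show ?thesis .
        qed
        ultimately show ?thesis unfolding M_def by (rule generated_module_cong[OF P])
      qed
    qed
    have "Q' \<in> M" if Q': "Q' \<in> ?R" for Q'
    proof -
      obtain c where c: "\<And>s. s \<in> S \<Longrightarrow> c s \<in> pullbacks z I" "Q' - (\<Sum>s\<in>S. c s * s) \<in> P"
        using subsetD[OF gen Q'] unfolding generated_module_def by blast
      have "c s * s \<in> M" if s: "s \<in> S" for s
      proof -
        obtain e where e: "e \<in> polyfun I" "c s = (\<lambda>w. e (\<lambda>k. z k w))" using c(1)[OF s] by (auto simp: pullbacks_def)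
        obtain r where r: "r \<in> polys_over (polyfun I)" "\<And>\<zeta> \<tau>. e (line \<zeta> d \<tau>) = poly (specialize \<zeta> r) \<tau>"
          using expand_along_direction[OF e(1), of d] by blast
        have "c s * s = (\<Sum>j\<le>degree r. (\<lambda>w. coeff r j (\<lambda>k. z' k w)) * (s * \<tau> ^ j))"
          unfolding e(2) expand[OF r(2)] unfolding sum_distrib_right by (intro sum.cong refl) (simp add: mult_ac)
        also have "\<dots> \<in> M" unfolding M_def
          by (intro generated_module_sum[OF C P] generated_module_scale[OF C P CR] coefC
              polys_over_coeff[OF r(1)] powers[OF s, unfolded M_def])
        finally show ?thesis .
      qed
      then have "(\<Sum>s\<in>S. c s * s) \<in> M" unfolding M_def by (intro generated_module_sum[OF C P])
      then show ?thesis using c(2) unfolding M_def by (rule generated_module_cong[OF P])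
    qed
    then have "fin I' z' S'" using z'R S' S'R by (auto simp: fin_def M_def C_def)
    moreover have "card I' < n" using I(1) i0 by (auto simp: I'_def card_gt_0_iff intro!: diff_less)
    ultimately show False using min by blast
  qed
  then show ?thesis using zR S gen by blast
qed

section \<open>Complex polynomials in one variable\<close>

lemma split_off_root:
  fixes p :: "complex poly"
  assumes "degree p = Suc n"
  obtains r q where "p = [:- r, 1:] * q" "degree q = n" "lead_coeff q = lead_coeff p"
proof -
  obtain r where "poly p r = 0"
    using fundamental_theorem_of_algebra_alt[of p] assms by fastforce
  then obtain q where q: "p = [:- r, 1:] * q" using poly_eq_0_iff_dvd by (metis dvd_def)
  have "q \<noteq> 0" using q assms by auto
  then have "degree p = Suc (degree q)" unfolding q by (subst degree_mult_eq) auto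
  moreover have "lead_coeff q = lead_coeff p" unfolding q lead_coeff_mult by simp
  ultimately show ?thesis using that q assms by simp
qed

text \<open>Splitting off one root at a time, as in the formulas of Vieta.\<close>

lemma coeff_bound_by_roots:
  fixes p :: "complex poly"
  assumes "\<And>r. poly p r = 0 \<Longrightarrow> cmod r \<le> \<beta>" "\<beta> \<ge> 0" "p \<noteq> 0"
  shows "cmod (coeff p i) \<le> cmod (lead_coeff p) * (1 + \<beta>) ^ degree p"
  using assms
proof (induction "degree p" arbitrary: p i)
  case 0
  then show ?case by (cases i) (auto simp: coeff_eq_0)
next
  case (Suc n)
  from Suc.hyps(2) obtain r q where q: "p = [:- r, 1:] * q" "degree q = n" "lead_coeff q = lead_coeff p"
    using split_off_root by metis
  have roots: "cmod s \<le> \<beta>" if "poly q s = 0" for s using Suc.prems(1)[of s] that q(1) by simp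
  have "q \<noteq> 0" using q(1) Suc.prems(3) by auto
  have IH: "cmod (coeff q j) \<le> cmod (lead_coeff p) * (1 + \<beta>) ^ n" for j
  proof -
    have "cmod (coeff q j) \<le> cmod (lead_coeff q) * (1 + \<beta>) ^ degree q"
      by (rule Suc.hyps(1)) (use q(2) roots \<open>q \<noteq> 0\<close> Suc.prems(2) in auto)
    then show ?thesis by (metis q(2,3))
  qed
  have r: "cmod r \<le> \<beta>" using Suc.prems(1)[of r] q(1) by simp
  have "coeff p i = (case i of 0 \<Rightarrow> 0 | Suc j \<Rightarrow> coeff q j) - r * coeff q i"
    by (simp add: q(1) coeff_pCons split: nat.split)
  then have "cmod (coeff p i) \<le> cmod (case i of 0 \<Rightarrow> 0 | Suc j \<Rightarrow> coeff q j) + cmod r * cmod (coeff q i)"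
    by (metis norm_mult norm_triangle_ineq4)
  also have "\<dots> \<le> cmod (lead_coeff p) * (1 + \<beta>) ^ n + \<beta> * (cmod (lead_coeff p) * (1 + \<beta>) ^ n)"
    using r IH Suc.prems(2) by (intro add_mono mult_mono) (auto split: nat.split)
  also have "\<dots> = cmod (lead_coeff p) * (1 + \<beta>) ^ degree p"
    using Suc.hyps(2)[symmetric] by (simp add: algebra_simps)
  finally show ?case .
qed

text \<open>The quotient of the constant term and the leading coefficient is, up to sign, the product
  of the roots; it cannot be small when all roots are large.\<close>

lemma small_root:
  fixes p :: "complex poly"
  assumes "cmod (coeff p 0) < cmod (lead_coeff p) * \<eta> ^ degree p" "\<eta> > 0"
  shows "\<exists>r. poly p r = 0 \<and> cmod r < \<eta>"
proof (rule ccontr)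
  assume no: "\<not> ?thesis"
  have "cmod (lead_coeff p) * \<eta> ^ degree p \<le> cmod (coeff p 0)"
    if "\<And>r. poly p r = 0 \<Longrightarrow> \<eta> \<le> cmod r" for p :: "complex poly"
    using that
  proof (induction "degree p" arbitrary: p)
    case (Suc n)
    from Suc.hyps(2) obtain r q where q: "p = [:- r, 1:] * q" "degree q = n" "lead_coeff q = lead_coeff p"
      using split_off_root by metis
    have roots: "\<eta> \<le> cmod s" if "poly q s = 0" for s using Suc.prems(1)[of s] that q(1) by simp
    have IH: "cmod (lead_coeff p) * \<eta> ^ n \<le> cmod (coeff q 0)"
    proof -
      have "cmod (lead_coeff q) * \<eta> ^ degree q \<le> cmod (coeff q 0)"
        by (rule Suc.hyps(1)) (use q(2) roots in auto)
      then show ?thesis by (metis q(2,3))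
    qed
    have "\<eta> \<le> cmod r" using Suc.prems[of r] q(1) by simp
    then have "\<eta> * (cmod (lead_coeff p) * \<eta> ^ n) \<le> cmod r * cmod (coeff q 0)"
      using IH assms(2) by (intro mult_mono) auto
    also have "\<dots> = cmod (coeff p 0)" by (simp add: q(1) norm_mult)
    finally show ?case using Suc.hyps(2)[symmetric] by (simp add: mult_ac)
  qed auto
  then show False using no assms by fastforce
qed

lemma eventually_not_in_finite:
  fixes a :: "'a::t1_space" assumes "finite A" shows "\<forall>\<^sub>F x in at a. x \<notin> A"
  using assms by (induction A rule: finite_induct) (auto intro: eventually_conj eventually_neq_at_within)

lemma eventually_poly_nonzero:
  fixes p :: "complex poly" assumes "p \<noteq> 0" shows "\<forall>\<^sub>F x in at a. poly p x \<noteq> 0"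
  using eventually_not_in_finite[OF poly_roots_finite[OF assms], of a] by simp

text \<open>Each root of \<open>c\<close> must be a root of \<open>p\<close>, and after cancelling the common factor the bound
  persists off that root.\<close>

lemma dvd_if_locally_bounded:
  fixes p c :: "complex poly"
  assumes "c \<noteq> 0" "\<And>r. \<exists>K. \<forall>\<^sub>F \<tau> in at r. cmod (poly p \<tau>) \<le> K * cmod (poly c \<tau>)"
  shows "c dvd p"
  using assms
proof (induction "degree c" arbitrary: p c)
  case 0
  then show ?case by (auto intro: unit_imp_dvd simp: is_unit_iff_degree)
next
  case (Suc n)
  from Suc.hyps(2) obtain r c' where c: "c = [:- r, 1:] * c'" "degree c' = n"
    using split_off_root by metis
  obtain K where K: "\<forall>\<^sub>F \<tau> in at r. cmod (poly p \<tau>) \<le> K * cmod (poly c \<tau>)" using Suc.prems(2) by blast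
  have lim: "((\<lambda>\<tau>. cmod (poly p \<tau>)) \<longlongrightarrow> cmod (poly p r)) (at r)"
    "((\<lambda>\<tau>. K * cmod (poly c \<tau>)) \<longlongrightarrow> K * cmod (poly c r)) (at r)"
    by (intro tendsto_intros isContD[OF poly_isCont])+
  have "cmod (poly p r) \<le> K * cmod (poly c r)"
    by (rule tendsto_le[OF _ lim(2,1) K]) simp
  then have "poly p r = 0" by (simp add: c(1))
  then obtain p' where p: "p = [:- r, 1:] * p'" using poly_eq_0_iff_dvd by (metis dvd_def)
  have "c' dvd p'"
  proof (rule Suc.hyps(1))
    show "n = degree c'" using c by simp
    show "c' \<noteq> 0" using Suc.prems(1) c by auto
    fix s
    obtain K where K: "\<forall>\<^sub>F \<tau> in at s. cmod (poly p \<tau>) \<le> K * cmod (poly c \<tau>)" using Suc.prems(2) by blast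
    have "\<forall>\<^sub>F \<tau> in at s. \<tau> \<noteq> r" by (rule eventually_neq_at_within)
    with K have "\<forall>\<^sub>F \<tau> in at s. cmod (poly p' \<tau>) \<le> K * cmod (poly c' \<tau>)"
    proof eventually_elim
      case (elim \<tau>)
      then have "cmod (\<tau> - r) * cmod (poly p' \<tau>) \<le> cmod (\<tau> - r) * (K * cmod (poly c' \<tau>))"
        by (simp add: p c norm_mult[symmetric] algebra_simps)
      then show ?case using elim(2) by simp
    qed
    then show "\<exists>K. \<forall>\<^sub>F \<tau> in at s. cmod (poly p' \<tau>) \<le> K * cmod (poly c' \<tau>)" ..
  qed
  then show ?case unfolding p c(1) by (rule mult_dvd_mono[OF dvd_refl])
qed

text \<open>An analytic form of the fact that polynomial rings are integrally closed: a rational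
  function that stays locally bounded along lines is a polynomial. Along suitable directions
  \<open>c\<close> and \<open>h\<close> have constant leading coefficients. There \<open>f\<close> can be divided by \<open>c\<close> with
  remainder, and boundedness forces the remainder to vanish on every line. Bounds are only
  asked for off the zeros of \<open>h\<close>, since in the application they come from points over a generic
  part of the base.\<close>

lemma polyfun_quotient:
  assumes f: "f \<in> polyfun U" and c: "c \<in> polyfun U" "c \<noteq> 0" and h: "h \<in> polyfun U" "h \<noteq> 0"
    and bound: "\<And>\<zeta> d r. \<exists>K. \<forall>\<^sub>F \<tau> in at r. h (line \<zeta> d \<tau>) \<noteq> 0 \<longrightarrow>
      cmod (f (line \<zeta> d \<tau>)) \<le> K * cmod (c (line \<zeta> d \<tau>))"
  shows "\<exists>p\<in>polyfun U. f = c * p"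
proof -
  obtain m hc where hc: "hc \<in> polyfun U" "hc \<noteq> 0"
    "\<And>d. \<exists>p\<in>polys_over (polyfun U). degree p \<le> m \<and> coeff p m = (\<lambda>_. hc d) \<and>
       (\<forall>\<zeta> \<tau>. c (line \<zeta> d \<tau>) = poly (specialize \<zeta> p) \<tau>)"
    using monic_along_direction[OF c] by blast
  obtain n hh where hh: "hh \<in> polyfun U" "hh \<noteq> 0"
    "\<And>d. \<exists>p\<in>polys_over (polyfun U). degree p \<le> n \<and> coeff p n = (\<lambda>_. hh d) \<and>
       (\<forall>\<zeta> \<tau>. h (line \<zeta> d \<tau>) = poly (specialize \<zeta> p) \<tau>)"
    using monic_along_direction[OF h] by blast
  have "hc * hh \<noteq> 0" using polyfun_no_zero_divisors hc hh by blast
  then obtain d where d: "hc d \<noteq> 0" "hh d \<noteq> 0" by (auto simp: fun_eq_iff)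
  define \<gamma> where "\<gamma> = hc d"
  obtain pc where pc: "pc \<in> polys_over (polyfun U)" "degree pc \<le> m" "coeff pc m = (\<lambda>_. \<gamma>)"
    "\<And>\<zeta> \<tau>. c (line \<zeta> d \<tau>) = poly (specialize \<zeta> pc) \<tau>" using hc(3)[of d] unfolding \<gamma>_def by blast
  obtain ph where ph: "coeff ph n = (\<lambda>_. hh d)"
    "\<And>\<zeta> \<tau>. h (line \<zeta> d \<tau>) = poly (specialize \<zeta> ph) \<tau>" using hh(3)[of d] by blast
  obtain pf where pf: "pf \<in> polys_over (polyfun U)"
    "\<And>\<zeta> \<tau>. f (line \<zeta> d \<tau>) = poly (specialize \<zeta> pf) \<tau>" using expand_along_direction[OF f, of d] by blast
  have g0: "\<gamma> \<noteq> 0" using d by (simp add: \<gamma>_def)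
  have dpc: "degree pc = m" using le_degree[of pc m] pc(2,3) g0 by (auto simp: fun_eq_iff)
  have dsp: "degree (specialize \<zeta> pc) = m" for \<zeta>
    using le_degree[of "specialize \<zeta> pc" m] degree_specialize[of \<zeta> pc] pc(2,3) g0 by simp
  have pc0: "pc \<noteq> 0" using pc(3) g0 by (auto simp: fun_eq_iff)
  obtain l q r where q: "q \<in> polys_over (polyfun U)" and r: "r = 0 \<or> degree r < degree pc"
    and e: "smult (lead_coeff pc ^ l) pf = q * pc + r"
    using pseudo_division[OF subring_polyfun pf(1) pc(1) pc0] by blast
  have e': "smult (\<gamma> ^ l) (specialize \<zeta> pf) = specialize \<zeta> q * specialize \<zeta> pc + specialize \<zeta> r" for \<zeta>
    using arg_cong[OF e, of "specialize \<zeta>"] dpc pc(3)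
    by (simp add: specialize_add specialize_mult specialize_smult power_fun_apply)
  have r0: "specialize \<zeta> r = 0" for \<zeta>
  proof (rule ccontr)
    assume nz: "specialize \<zeta> r \<noteq> 0"
    have "specialize \<zeta> pc dvd specialize \<zeta> pf"
    proof (rule dvd_if_locally_bounded)
      show "specialize \<zeta> pc \<noteq> 0" using pc(3) g0 by (metis coeff_0 coeff_specialize)
      fix t
      have "specialize \<zeta> ph \<noteq> 0" using ph(1) d by (metis coeff_0 coeff_specialize)
      from eventually_poly_nonzero[OF this, of t] have "\<forall>\<^sub>F \<tau> in at t. h (line \<zeta> d \<tau>) \<noteq> 0" by (simp add: ph)
      moreover obtain K where "\<forall>\<^sub>F \<tau> in at t. h (line \<zeta> d \<tau>) \<noteq> 0 \<longrightarrow>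
        cmod (f (line \<zeta> d \<tau>)) \<le> K * cmod (c (line \<zeta> d \<tau>))" using bound by blast
      ultimately have "\<forall>\<^sub>F \<tau> in at t. cmod (f (line \<zeta> d \<tau>)) \<le> K * cmod (c (line \<zeta> d \<tau>))"
        by eventually_elim auto
      then show "\<exists>K. \<forall>\<^sub>F \<tau> in at t. cmod (poly (specialize \<zeta> pf) \<tau>) \<le> K * cmod (poly (specialize \<zeta> pc) \<tau>)"
        unfolding pf(2) pc(4) ..
    qed
    then have "specialize \<zeta> pc dvd specialize \<zeta> q * specialize \<zeta> pc + specialize \<zeta> r"
      unfolding e'[symmetric] by (rule dvd_smult)
    then have "specialize \<zeta> pc dvd specialize \<zeta> r" by (simp add: dvd_add_right_iff)
    from dvd_imp_degree_le[OF this nz] have "m \<le> degree r"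
      using degree_specialize[of \<zeta> r] dsp by simp
    then show False using r dpc nz specialize_0[of \<zeta>] by auto
  qed
  define p where "p = (\<lambda>\<zeta>. (1 / \<gamma> ^ l) * coeff q 0 \<zeta>)"
  have "p \<in> polyfun U" unfolding p_def by (intro polyfun.intros polys_over_coeff[OF q])
  moreover have "f = c * p"
  proof
    fix \<zeta>
    have "\<gamma> ^ l * f \<zeta> = coeff q 0 \<zeta> * c \<zeta>"
      using arg_cong[OF e'[of \<zeta>], of "\<lambda>p. poly p 0"] pf(2)[of \<zeta> 0] pc(4)[of \<zeta> 0]
      by (simp add: r0 poly_0_coeff_0 coeff_mult)
    then show "f \<zeta> = (c * p) \<zeta>" using g0 by (simp add: p_def field_simps)
  qed
  ultimately show ?thesis by blast
qed

section \<open>Existence of prime ideals\<close>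

text \<open>An ideal that is maximal among those containing \<open>P0\<close> and disjoint from the multiplicative
  set \<open>S\<close> is prime: enlarging it by either of two elements outside makes it meet \<open>S\<close>, and the
  product of the two elements of \<open>S\<close> obtained so would otherwise lie in the ideal.\<close>

lemma prime_avoiding_exists:
  fixes R :: "'r::comm_ring_1 set"
  assumes R: "subring_set R" and P0: "P0 \<subseteq> R" "0 \<in> P0" "\<And>a b. a \<in> P0 \<Longrightarrow> b \<in> P0 \<Longrightarrow> a + b \<in> P0"
    "\<And>a b. a \<in> R \<Longrightarrow> b \<in> P0 \<Longrightarrow> a * b \<in> P0"
    and S: "1 \<in> S" "S \<subseteq> R" "\<And>a b. a \<in> S \<Longrightarrow> b \<in> S \<Longrightarrow> a * b \<in> S" "P0 \<inter> S = {}"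
  shows "\<exists>P. prime_in R P \<and> P0 \<subseteq> P \<and> P \<inter> S = {}"
proof -
  note D = subring_setD[OF R]
  define \<I> where "\<I> = {P. P \<subseteq> R \<and> P0 \<subseteq> P \<and> (\<forall>a\<in>P. \<forall>b\<in>P. a + b \<in> P) \<and> (\<forall>a\<in>R. \<forall>b\<in>P. a * b \<in> P) \<and> P \<inter> S = {}}"
  have "P0 \<in> \<I>" using P0 S(4) by (auto simp: \<I>_def)
  then have "\<exists>M\<in>\<I>. \<forall>X\<in>\<I>. M \<subseteq> X \<longrightarrow> X = M"
  proof (intro subset_Zorn_nonempty)
    fix \<C> assume "\<C> \<noteq> {}" and ch: "subset.chain \<I> \<C>"
    then have C: "\<C> \<subseteq> \<I>" "\<And>A B. A \<in> \<C> \<Longrightarrow> B \<in> \<C> \<Longrightarrow> A \<subseteq> B \<or> B \<subseteq> A"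
      by (auto simp: subset.chain_def)
    have "a + b \<in> \<Union>\<C>" if ab: "a \<in> \<Union>\<C>" "b \<in> \<Union>\<C>" for a b
    proof -
      obtain A B where AB: "A \<in> \<C>" "B \<in> \<C>" "a \<in> A" "b \<in> B" using ab by blast
      have "A \<in> \<I>" "B \<in> \<I>" using AB(1,2) C(1) by auto
      then have "x + y \<in> A" if "x \<in> A" "y \<in> A" for x y using that by (simp add: \<I>_def)
      moreover have "x + y \<in> B" if "x \<in> B" "y \<in> B" for x y
        using that \<open>B \<in> \<I>\<close> by (simp add: \<I>_def)
      ultimately have "a + b \<in> A \<or> a + b \<in> B"
        using C(2)[OF AB(1,2)] AB(3,4) by (metis subsetD)
      then show ?thesis using AB(1,2) by blast
    qed
    moreover have "\<Union>\<C> \<subseteq> R" "\<Union>\<C> \<inter> S = {}"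
      using C(1) by (auto simp: \<I>_def)
    moreover have "P0 \<subseteq> \<Union>\<C>"
    proof -
      obtain X where "X \<in> \<C>" using \<open>\<C> \<noteq> {}\<close> by blast
      then have "P0 \<subseteq> X" using C(1) by (auto simp: \<I>_def)
      then show ?thesis using \<open>X \<in> \<C>\<close> by blast
    qed
    moreover have "a * b \<in> \<Union>\<C>" if ab: "a \<in> R" "b \<in> \<Union>\<C>" for a b
    proof -
      obtain B where B: "B \<in> \<C>" "b \<in> B" using ab(2) by blast
      then have "a * b \<in> B" using C(1) ab(1) by (auto simp: \<I>_def)
      then show ?thesis using B(1) by blast
    qed
    ultimately show "\<Union>\<C> \<in> \<I>" unfolding \<I>_def by simp
  qed auto
  then obtain P where P: "P \<in> \<I>" and max: "\<And>X. X \<in> \<I> \<Longrightarrow> P \<subseteq> X \<Longrightarrow> X = P" by blast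
  have P': "P \<subseteq> R" "P0 \<subseteq> P" "\<And>a b. a \<in> P \<Longrightarrow> b \<in> P \<Longrightarrow> a + b \<in> P" "\<And>a b. a \<in> R \<Longrightarrow> b \<in> P \<Longrightarrow> a * b \<in> P"
    "P \<inter> S = {}" using P by (auto simp: \<I>_def)
  have meet: "\<exists>p\<in>P. \<exists>a\<in>R. p + a * f \<in> S" if f: "f \<in> R" "f \<notin> P" for f
  proof (rule ccontr)
    assume no: "\<not> ?thesis"
    define X where "X = {p + a * f | p a. p \<in> P \<and> a \<in> R}"
    have "X \<in> \<I>" unfolding \<I>_def
    proof (intro CollectI conjI ballI)
      show "X \<subseteq> R" using P'(1) f D by (auto simp: X_def)
      show "P0 \<subseteq> X" using P'(2) D(1) by (force simp: X_def)
      show "X \<inter> S = {}" using no by (auto simp: X_def)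
      fix a b assume "b \<in> X"
      then obtain p r where b: "b = p + r * f" "p \<in> P" "r \<in> R" by (auto simp: X_def)
      show "a * b \<in> X" if "a \<in> R"
        unfolding X_def using b that P'(4)[OF that b(2)] D(4)[OF that b(3)]
        by (intro CollectI exI[of _ "a * p"] exI[of _ "a * r"]) (auto simp: algebra_simps)
      show "a + b \<in> X" if aX: "a \<in> X"
      proof -
        obtain p' r' where a: "a = p' + r' * f" "p' \<in> P" "r' \<in> R" using aX by (auto simp: X_def)
        show ?thesis unfolding X_def using a b P'(3)[OF a(2) b(2)] D(3)[OF a(3) b(3)]
          by (intro CollectI exI[of _ "p' + p"] exI[of _ "r' + r"]) (auto simp: algebra_simps)
      qed
    qed
    moreover have "P \<subseteq> X" using D(1) by (force simp: X_def)
    ultimately have "X = P" by (rule max)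
    moreover have "f \<in> X" unfolding X_def using P'(2) P0(2) D(2)
      by (intro CollectI exI[of _ 0] exI[of _ 1]) auto
    ultimately show False using f by simp
  qed
  have "prime_in R P" unfolding prime_in_def
  proof (intro conjI ballI impI)
    show "P \<subseteq> R" "0 \<in> P" "1 \<notin> P" using P' P0(2) S(1) by auto
    show "a + b \<in> P" if "a \<in> P" "b \<in> P" for a b using P'(3)[OF that] .
    show "a * b \<in> P" if "a \<in> R" "b \<in> P" for a b using P'(4)[OF that] .
    fix a b assume ab: "a \<in> R" "b \<in> R" "a * b \<in> P"
    show "a \<in> P \<or> b \<in> P"
    proof (rule ccontr)
      assume "\<not> ?thesis"
      then obtain p r p' r' where *: "p \<in> P" "r \<in> R" "p + r * a \<in> S" "p' \<in> P" "r' \<in> R" "p' + r' * b \<in> S"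
        using meet ab by metis
      have "(p + r * a) * (p' + r' * b) = (p' + r' * b) * p + ((r * a) * p' + (r * r') * (a * b))"
        by (simp add: algebra_simps)
      also have "\<dots> \<in> P"
        by (intro P'(3) P'(4)[OF _ *(1)] P'(4)[OF _ *(4)] P'(4)[OF _ ab(3)] D(4) subsetD[OF S(2)] * ab)
      finally show False using S(3)[OF *(3,6)] P'(5) by blast
    qed
  qed
  then show ?thesis using P'(2,5) by blast
qed

section \<open>Finite coverings\<close>

lemma separating_polyfun:
  fixes y :: "'w::finite \<Rightarrow> complex"
  assumes "finite F" "y \<notin> F"
  shows "\<exists>Q\<in>polyfun UNIV. Q y = 1 \<and> (\<forall>w\<in>F. Q w = 0)"
proof -
  have "\<forall>w\<in>F. \<exists>k. w k \<noteq> y k" using assms(2) by (metis ext)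
  then obtain k where k: "\<And>w. w \<in> F \<Longrightarrow> w (k w) \<noteq> y (k w)" by metis
  define Q where "Q = (\<lambda>x::'w \<Rightarrow> complex. \<Prod>w\<in>F. (x (k w) - w (k w)) * (1 / (y (k w) - w (k w))))"
  have "Q \<in> polyfun UNIV" unfolding Q_def by (intro polyfun_prod polyfun.mult polyfun_diff polyfun.const polyfun.coord UNIV_I)
  moreover have "Q y = 1" unfolding Q_def
  proof (rule prod.neutral, rule ballI)
    fix w assume "w \<in> F"
    then show "(y (k w) - w (k w)) * (1 / (y (k w) - w (k w))) = 1" using k[of w] by simp
  qed
  moreover have "Q w = 0" if "w \<in> F" for w
    unfolding Q_def by (rule prod_zero[OF assms(1)], rule bexI[OF _ that]) simp
  ultimately show ?thesis by blast
qed

abbreviation zero_locus :: "(('w \<Rightarrow> complex) \<Rightarrow> complex) set \<Rightarrow> ('w \<Rightarrow> complex) set" where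
  "zero_locus P \<equiv> {w. \<forall>Q\<in>P. Q w = 0}"

lemma module_representation:
  assumes "f \<in> generated_module (pullbacks z I) S P"
  shows "\<exists>c. (\<forall>s. c s \<in> polyfun I) \<and> f - (\<Sum>s\<in>S. (\<lambda>w. c s (\<lambda>k. z k w)) * s) \<in> P \<and>
    (\<forall>w. w \<in> zero_locus P \<longrightarrow> f w = (\<Sum>s\<in>S. c s (\<lambda>k. z k w) * s w))"
proof -
  obtain c where c: "\<forall>s\<in>S. c s \<in> pullbacks z I" "f - (\<Sum>s\<in>S. c s * s) \<in> P"
    using assms unfolding generated_module_def by blast
  have "\<exists>e. e \<in> polyfun I \<and> (s \<in> S \<longrightarrow> c s = (\<lambda>w. e (\<lambda>k. z k w)))" for s
  proof (cases "s \<in> S")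
    case True
    then obtain e where "e \<in> polyfun I" "c s = (\<lambda>w. e (\<lambda>k. z k w))"
      using bspec[OF c(1) True] by (auto simp: pullbacks_def)
    then show ?thesis by (intro exI[of _ e]) simp
  next
    case False
    then show ?thesis using polyfun.const[of 0 I] by (intro exI[of _ "\<lambda>_. 0"]) simp
  qed
  then have "\<forall>s. \<exists>e. e \<in> polyfun I \<and> (s \<in> S \<longrightarrow> c s = (\<lambda>w. e (\<lambda>k. z k w)))" ..
  from choice[OF this] obtain e where
    e: "\<And>s. e s \<in> polyfun I" "\<And>s. s \<in> S \<Longrightarrow> c s = (\<lambda>w. e s (\<lambda>k. z k w))" by blast
  have eq: "(\<Sum>s\<in>S. c s * s) = (\<Sum>s\<in>S. (\<lambda>w. e s (\<lambda>k. z k w)) * s)"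
    using e(2) by (intro sum.cong) auto
  have 1: "f - (\<Sum>s\<in>S. (\<lambda>w. e s (\<lambda>k. z k w)) * s) \<in> P" using c(2) unfolding eq .
  have 2: "f w = (\<Sum>s\<in>S. e s (\<lambda>k. z k w) * s w)" if "w \<in> zero_locus P" for w
  proof -
    have "(f - (\<Sum>s\<in>S. (\<lambda>w. e s (\<lambda>k. z k w)) * s)) w = 0" using 1 that by blast
    then show ?thesis by (simp add: sum_fun_apply)
  qed
  show ?thesis by (intro exI[of _ e] conjI allI impI e(1) 1 2)
qed

text \<open>On a fibre of the covering every function is a combination, with constant coefficients,
  of the functions in \<open>S\<close>, while the points of a finite set can be separated by functions. So a
  fibre has at most \<open>card S\<close> points.\<close>

lemma finite_fibre:
  fixes P :: "(('w::finite \<Rightarrow> complex) \<Rightarrow> complex) set"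
  assumes S: "finite S" and gen: "polyfun UNIV \<subseteq> generated_module (pullbacks z I) S P"
  shows "finite {w \<in> zero_locus P. \<forall>k\<in>I. z k w = \<zeta> k}" (is "finite ?F")
proof -
  have "card F \<le> card S" if F: "F \<subseteq> ?F" "finite F" for F
  proof (rule ccontr)
    assume "\<not> card F \<le> card S"
    then obtain \<alpha> where \<alpha>: "\<exists>w\<in>F. \<alpha> w \<noteq> 0" "\<And>s. s \<in> S \<Longrightarrow> (\<Sum>w\<in>F. \<alpha> w * s w) = 0"
      using linear_dependence[of "UNIV :: complex set" S F "\<lambda>w s. s w"] S F(2)
      by (auto simp: subring_set_def)
    then obtain w0 where w0: "w0 \<in> F" "\<alpha> w0 \<noteq> 0" by blast
    obtain Q where Q: "Q \<in> polyfun UNIV" "Q w0 = 1" "\<forall>w\<in>F - {w0}. Q w = 0"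
      using separating_polyfun[of "F - {w0}" w0] F(2) by blast
    from module_representation[OF subsetD[OF gen Q(1)]]
    obtain c where c': "(\<forall>s. c s \<in> polyfun I) \<and> Q - (\<Sum>s\<in>S. (\<lambda>w. c s (\<lambda>k. z k w)) * s) \<in> P \<and>
      (\<forall>w. w \<in> zero_locus P \<longrightarrow> Q w = (\<Sum>s\<in>S. c s (\<lambda>k. z k w) * s w))" ..
    note c = c'[THEN conjunct1, rule_format] c'[THEN conjunct2, THEN conjunct2, rule_format]
    have "Q w = (\<Sum>s\<in>S. c s \<zeta> * s w)" if "w \<in> F" for w
    proof -
      have "c s (\<lambda>k. z k w) = c s \<zeta>" for s using that F(1) by (intro polyfun_cong[OF c(1)]) auto
      then show ?thesis using c(2)[of w] that F(1) by auto
    qed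
    then have "(\<Sum>w\<in>F. \<alpha> w * Q w) = (\<Sum>w\<in>F. \<Sum>s\<in>S. c s \<zeta> * (\<alpha> w * s w))"
      by (intro sum.cong) (auto simp: sum_distrib_left mult_ac)
    also have "\<dots> = (\<Sum>s\<in>S. c s \<zeta> * (\<Sum>w\<in>F. \<alpha> w * s w))"
      unfolding sum_distrib_left by (rule sum.swap)
    also have "\<dots> = 0" using \<alpha>(2) by simp
    also have "(\<Sum>w\<in>F. \<alpha> w * Q w) = (\<Sum>w\<in>{w0}. \<alpha> w * Q w)"
      using F(2) w0 Q(3) by (intro sum.mono_neutral_right) auto
    finally show False using w0(2) Q(2) by simp
  qed
  then show ?thesis using finite_if_finite_subsets_card_bdd[of ?F "card S"] by blast
qed

text \<open>Multiplication by \<open>g\<close> is given by a matrix over the base with respect to the module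
  generators \<open>S\<close>. At a point \<open>w\<close> the values of the generators form an eigenvector with
  eigenvalue \<open>g w\<close>, and they are not all zero because \<open>1\<close> is a combination of them.\<close>

lemma eigenvalue_bound:
  fixes P :: "(('w::finite \<Rightarrow> complex) \<Rightarrow> complex) set"
  assumes S: "finite S" "S \<subseteq> polyfun UNIV" and gen: "polyfun UNIV \<subseteq> generated_module (pullbacks z I) S P"
    and g: "g \<in> polyfun UNIV"
  shows "\<exists>M. (\<forall>s t. M s t \<in> polyfun I) \<and>
     (\<forall>w\<in>zero_locus P. cmod (g w) \<le> (\<Sum>s\<in>S. \<Sum>t\<in>S. cmod (M s t (\<lambda>k. z k w))))"
proof -
  have "\<forall>s. \<exists>c. (\<forall>t. c t \<in> polyfun I) \<and>
    (s \<in> S \<longrightarrow> (\<forall>w\<in>zero_locus P. g w * s w = (\<Sum>t\<in>S. c t (\<lambda>k. z k w) * t w)))"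
  proof
    fix s show "\<exists>c. (\<forall>t. c t \<in> polyfun I) \<and>
      (s \<in> S \<longrightarrow> (\<forall>w\<in>zero_locus P. g w * s w = (\<Sum>t\<in>S. c t (\<lambda>k. z k w) * t w)))"
    proof (cases "s \<in> S")
      case True
      have "g * s \<in> generated_module (pullbacks z I) S P"
        using True S(2) by (intro subsetD[OF gen] subring_setD[OF subring_polyfun] g) auto
      from module_representation[OF this]
      obtain c where c': "(\<forall>s. c s \<in> polyfun I) \<and> g * s - (\<Sum>s\<in>S. (\<lambda>w. c s (\<lambda>k. z k w)) * s) \<in> P \<and>
        (\<forall>w. w \<in> zero_locus P \<longrightarrow> (g * s) w = (\<Sum>t\<in>S. c t (\<lambda>k. z k w) * t w))" ..
      note c = c'[THEN conjunct1, rule_format] c'[THEN conjunct2, THEN conjunct2, rule_format]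
      show ?thesis using c by (intro exI[of _ c] conjI impI ballI allI) simp_all
    next
      case False
      then show ?thesis using polyfun.const[of 0 I] by (intro exI[of _ "\<lambda>_ _. 0"]) simp
    qed
  qed
  from choice[OF this] obtain M where M: "\<And>s t. M s t \<in> polyfun I"
    "\<And>s w. s \<in> S \<Longrightarrow> w \<in> zero_locus P \<Longrightarrow> g w * s w = (\<Sum>t\<in>S. M s t (\<lambda>k. z k w) * t w)" by blast
  from module_representation[OF subsetD[OF gen subring_setD(2)[OF subring_polyfun]]]
  obtain e where e': "(\<forall>s. e s \<in> polyfun I) \<and> 1 - (\<Sum>s\<in>S. (\<lambda>w. e s (\<lambda>k. z k w)) * s) \<in> P \<and>
    (\<forall>w. w \<in> zero_locus P \<longrightarrow> 1 w = (\<Sum>s\<in>S. e s (\<lambda>k. z k w) * s w))" ..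
  note e = e'[THEN conjunct2, THEN conjunct2, rule_format]
  have "cmod (g w) \<le> (\<Sum>s\<in>S. \<Sum>t\<in>S. cmod (M s t (\<lambda>k. z k w)))" if w: "w \<in> zero_locus P" for w
  proof -
    have "\<exists>s\<in>S. s w \<noteq> 0"
    proof (rule ccontr)
      assume "\<not> ?thesis"
      then have "(\<Sum>s\<in>S. e s (\<lambda>k. z k w) * s w) = 0" by (intro sum.neutral) simp
      then show False using e[OF w] by simp
    qed
    then have ne: "S \<noteq> {}" by auto
    define m where "m = Max ((\<lambda>s. cmod (s w)) ` S)"
    have "m \<in> (\<lambda>s. cmod (s w)) ` S" unfolding m_def by (rule Max_in) (use ne S(1) in auto)
    then obtain s where s: "s \<in> S" "m = cmod (s w)" by blast
    have le: "cmod (t w) \<le> m" if "t \<in> S" for t using that S(1) by (simp add: m_def)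
    have "m > 0" using \<open>\<exists>s\<in>S. s w \<noteq> 0\<close> le by (metis zero_less_norm_iff less_le_trans)
    have "cmod (g w) * m = cmod (\<Sum>t\<in>S. M s t (\<lambda>k. z k w) * t w)"
      using M(2)[OF s(1) w] s(2) by (metis norm_mult)
    also have "\<dots> \<le> (\<Sum>t\<in>S. cmod (M s t (\<lambda>k. z k w)) * m)"
      by (rule order.trans[OF norm_sum]) (auto simp: norm_mult intro!: sum_mono mult_left_mono le)
    also have "\<dots> = (\<Sum>t\<in>S. cmod (M s t (\<lambda>k. z k w))) * m" by (simp add: sum_distrib_right)
    finally have "cmod (g w) \<le> (\<Sum>t\<in>S. cmod (M s t (\<lambda>k. z k w)))" using \<open>m > 0\<close> by simp
    also have "\<dots> \<le> (\<Sum>s\<in>S. \<Sum>t\<in>S. cmod (M s t (\<lambda>k. z k w)))"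
      using S(1) s(1) by (intro member_le_sum[of s S "\<lambda>s. \<Sum>t\<in>S. cmod (M s t (\<lambda>k. z k w))"]) (auto intro: sum_nonneg)
    finally show ?thesis .
  qed
  then show ?thesis using M(1) by blast
qed

lemma polyfun_tendsto:
  "Q \<in> polyfun V \<Longrightarrow> (\<And>k. k \<in> V \<Longrightarrow> ((\<lambda>n. \<omega> n k) \<longlongrightarrow> w k) F) \<Longrightarrow> ((\<lambda>n. Q (\<omega> n)) \<longlongrightarrow> Q w) F"
  by (induction rule: polyfun.induct) (auto intro: tendsto_intros)

lemma convergent_subsequence_components:
  fixes \<omega> :: "nat \<Rightarrow> 'w::finite \<Rightarrow> complex"
  assumes "\<And>k. Bseq (\<lambda>n. \<omega> n k)"
  shows "\<exists>r w. strict_mono r \<and> (\<forall>k. (\<lambda>n. \<omega> (r n) k) \<longlonglongrightarrow> w k)"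
proof -
  define X where "X = (\<lambda>n. (\<chi> k. \<omega> n k) :: complex ^ 'w)"
  have "\<forall>k. \<exists>K. \<forall>n. cmod (\<omega> n k) \<le> K" using assms unfolding Bseq_def by blast
  then obtain K where K: "\<And>k n. cmod (\<omega> n k) \<le> K k" by metis
  have "norm (X n) \<le> (\<Sum>k\<in>UNIV. K k)" for n
    unfolding norm_vec_def X_def
    by (rule order.trans[OF L2_set_le_sum]) (auto intro: sum_mono K)
  then have "bounded (range X)" by (auto simp: bounded_iff)
  then obtain l r where r: "strict_mono r" "(X \<circ> r) \<longlonglongrightarrow> l"
    using bounded_imp_convergent_subsequence by blast
  have "(\<lambda>n. \<omega> (r n) k) \<longlonglongrightarrow> l $ k" for k
    using tendsto_vec_nth[OF r(2), of k] by (simp add: X_def o_def)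
  then show ?thesis using r(1) by blast
qed

section \<open>Zariski limits of images are Euclidean limits\<close>

lemma prime_in_polyfun_pullback:
  assumes P: "prime_in (polyfun V) P" and f: "\<And>w. w \<in> W \<Longrightarrow> f w \<in> polyfun V"
  shows "prime_in (polyfun W) {Q \<in> polyfun W. (\<lambda>x. Q (\<lambda>w. f w x)) \<in> P}"
proof -
  note D = subring_setD[OF subring_polyfun[of W]]
  have comp: "(\<lambda>x. Q (\<lambda>w. f w x)) \<in> polyfun V" if "Q \<in> polyfun W" for Q
    by (rule polyfun_compose[OF that f])
  show ?thesis
    unfolding prime_in_def
  proof (intro conjI ballI impI CollectI)
    show "0 \<in> polyfun W" "(\<lambda>x. 0 (\<lambda>w. f w x)) \<in> P"
      using D(1) prime_inD(2)[OF P] by (auto simp: zero_fun_def)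
    show "1 \<notin> {Q \<in> polyfun W. (\<lambda>x. Q (\<lambda>w. f w x)) \<in> P}"
      using prime_inD(3)[OF P] by (simp add: one_fun_def)
    fix a b
    show "a + b \<in> polyfun W" "(\<lambda>x. (a + b) (\<lambda>w. f w x)) \<in> P"
      if "a \<in> {Q \<in> polyfun W. (\<lambda>x. Q (\<lambda>w. f w x)) \<in> P}" "b \<in> {Q \<in> polyfun W. (\<lambda>x. Q (\<lambda>w. f w x)) \<in> P}"
      using that D(3)[of a b] prime_inD(4)[OF P, of "\<lambda>x. a (\<lambda>w. f w x)" "\<lambda>x. b (\<lambda>w. f w x)"]
      by (simp_all add: plus_fun_def)
    show "a * b \<in> polyfun W" "(\<lambda>x. (a * b) (\<lambda>w. f w x)) \<in> P"
      if "a \<in> polyfun W" "b \<in> {Q \<in> polyfun W. (\<lambda>x. Q (\<lambda>w. f w x)) \<in> P}"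
      using that D(4)[of a b] prime_inD(5)[OF P comp[OF that(1)], of "\<lambda>x. b (\<lambda>w. f w x)"]
      by (simp_all add: times_fun_def)
    assume ab: "a \<in> polyfun W" "b \<in> polyfun W" "a * b \<in> {Q \<in> polyfun W. (\<lambda>x. Q (\<lambda>w. f w x)) \<in> P}"
    then have "(\<lambda>x. a (\<lambda>w. f w x)) * (\<lambda>x. b (\<lambda>w. f w x)) \<in> P" by (simp add: times_fun_def)
    then show "a \<in> {Q \<in> polyfun W. (\<lambda>x. Q (\<lambda>w. f w x)) \<in> P} \<or> b \<in> {Q \<in> polyfun W. (\<lambda>x. Q (\<lambda>w. f w x)) \<in> P}"
      using prime_inD(7)[OF P comp[OF ab(1)] comp[OF ab(2)]] ab by simp
  qed auto
qed

text \<open>The hypothesis on \<open>y\<close> says that \<open>y\<close> is a zero of the ideal \<open>q\<close> pulled back from \<open>P\<close>, that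
  is, a point of the Zariski closure of the image of the locus of \<open>P\<close>. By Noether normalization
  that closure is finite over an affine space, with coordinates \<open>z\<close>. Let \<open>a\<close> be a function that
  vanishes at \<open>y\<close> and equals \<open>1\<close> at the other points of the finite fibre through \<open>y\<close>, and \<open>\<mu>\<close>
  its minimal relation over the base.

  Over a generic point of the base each root of \<open>\<mu>\<close> is the value of \<open>a\<close> at the image of a zero
  of \<open>P\<close>. As values are bounded in terms of the base point, so are the coefficients of \<open>\<mu>\<close>
  divided by its leading coefficient; hence these quotients are polynomials, and \<open>\<mu>\<close> can be
  taken monic. It annihilates \<open>a\<close>, and \<open>a\<close> vanishes at \<open>y\<close>, so its constant term vanishes at
  the base point of \<open>y\<close>. Over nearby generic base points \<open>\<mu>\<close> therefore has small roots, which
  come from points of the image. These have bounded coordinates, and a limit of them lies in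
  the fibre through \<open>y\<close> and has \<open>a = 0\<close>, so it is \<open>y\<close>.\<close>

lemma limit_of_image_prime:
  fixes \<phi> :: "'w::finite \<Rightarrow> ('i \<Rightarrow> complex) \<Rightarrow> complex" and y :: "'w \<Rightarrow> complex"
  assumes V: "finite V" and \<phi>: "\<And>w. \<phi> w \<in> polyfun V" and P: "prime_in (polyfun V) P"
    and y: "\<And>Q. Q \<in> polyfun UNIV \<Longrightarrow> (\<lambda>x. Q (\<lambda>w. \<phi> w x)) \<in> P \<Longrightarrow> Q y = 0" and \<epsilon>: "\<epsilon> > 0"
  shows "\<exists>x\<in>zero_locus P. \<forall>w. cmod (\<phi> w x - y w) < \<epsilon>"
proof -
  define q where "q = {Q \<in> polyfun UNIV. (\<lambda>x. Q (\<lambda>w. \<phi> w x)) \<in> P}"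
  have q: "prime_in (polyfun UNIV) q" unfolding q_def by (rule prime_in_polyfun_pullback[OF P \<phi>])
  have yq: "y \<in> zero_locus q" using y by (auto simp: q_def)
  obtain I :: "'w set" and z S where nn: "(\<forall>k. z k \<in> polyfun UNIV) \<and> finite S \<and> S \<subseteq> polyfun UNIV \<and>
     polyfun UNIV \<subseteq> generated_module (pullbacks z I) S q \<and>
     (\<forall>c\<in>polyfun I. (\<lambda>w. c (\<lambda>k. z k w)) \<in> q \<longrightarrow> c = 0)"
    using noether_normalization[OF q] by (elim exE) (rule that)
  then have z: "\<And>k. z k \<in> polyfun UNIV" and S: "finite S" "S \<subseteq> polyfun UNIV"
    and gen: "polyfun UNIV \<subseteq> generated_module (pullbacks z I) S q"
    and indep: "\<And>c. c \<in> polyfun I \<Longrightarrow> (\<lambda>w. c (\<lambda>k. z k w)) \<in> q \<Longrightarrow> c = 0"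
    by simp_all
  \<comment> \<open>The fibre through \<open>y\<close>, and a function \<open>a\<close> that singles out \<open>y\<close> in it.\<close>
  define F where "F = {w \<in> zero_locus q. \<forall>k\<in>I. z k w = z k y}"
  have F: "finite F" unfolding F_def by (rule finite_fibre[OF S(1) gen, of "\<lambda>k. z k y"])
  obtain Q0 where Q0: "Q0 \<in> polyfun UNIV" "Q0 y = 1" "\<forall>w\<in>F - {y}. Q0 w = 0"
    using separating_polyfun[of "F - {y}" y] F by blast
  define a where "a = (\<lambda>w. 1 - Q0 w)"
  have a: "a \<in> polyfun UNIV" "a y = 0"
    using Q0 by (auto simp: a_def intro!: polyfun_diff polyfun.const)
  have a_sep: "w = y" if "w \<in> F" "a w = 0" for w
  proof (rule ccontr)
    assume "w \<noteq> y"
    then have "Q0 w = 0" using Q0(3) that(1) by blast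
    then show False using that(2) by (simp add: a_def)
  qed
  \<comment> \<open>The zeros of \<open>PP\<close> form the graph over the locus of \<open>P\<close> of the base coordinates (the
    variables \<open>U\<close>) and of \<open>a\<close> (the variable \<open>b\<close>); the variables \<open>W\<close> are those of the source.
    Extending zeros from \<open>U\<close> by \<open>b\<close> and then by \<open>W\<close> lifts base points and roots of the relation
    to the source.\<close>
  define e where "e = (\<lambda>v. case v of Inl (Some k) \<Rightarrow> (\<lambda>x. z k (\<lambda>w. \<phi> w x)) | Inl None \<Rightarrow> (\<lambda>x. a (\<lambda>w. \<phi> w x))
      | Inr i \<Rightarrow> (\<lambda>x. x i))"
  define U where "U = (\<lambda>k. Inl (Some k) :: 'w option + 'i) ` I"
  define b where "b = (Inl None :: 'w option + 'i)"
  define W where "W = (Inr :: 'i \<Rightarrow> 'w option + 'i) ` V"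
  define V' where "V' = insert b U \<union> W"
  have eV: "e v \<in> polyfun V" if "v \<in> V'" for v
    using that \<phi> by (auto simp: V'_def b_def U_def W_def e_def intro: polyfun.coord
        intro!: polyfun_compose[OF z] polyfun_compose[OF a(1)])
  define PP where "PP = {Q \<in> polyfun V'. (\<lambda>x. Q (\<lambda>v. e v x)) \<in> P}"
  have PP: "prime_in (polyfun V') PP" unfolding PP_def by (rule prime_in_polyfun_pullback[OF P eV])
  have bU: "b \<notin> U" and bUV: "insert b U \<subseteq> V'" and W: "finite W" "insert b U \<union> W \<subseteq> V'" "insert b U \<inter> W = {}"
    using V by (auto simp: b_def U_def W_def V'_def)
  define bb where "bb = (\<lambda>\<pi> :: 'w option + 'i \<Rightarrow> complex. \<pi> b)"
  let ?C = "polyfun U"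
  have C: "subring_set ?C" "?C \<subseteq> polyfun V'" using polyfun_mono[of _ U V'] bUV by (auto intro: subring_polyfun)
  have bbV: "bb \<in> polyfun V'" unfolding bb_def using bUV by (auto intro: polyfun.coord)
  have lift_U: "(\<lambda>\<pi>. c (\<lambda>k. \<pi> (Inl (Some k)))) \<in> ?C" if "c \<in> polyfun I" for c
    by (rule polyfun_compose[OF that]) (auto simp: U_def intro: polyfun.coord)
  have indepU: "f = 0" if f: "f \<in> ?C" "f \<in> PP" for f
  proof -
    define c where "c = (\<lambda>\<zeta>. f (\<lambda>v. (case v of Inl (Some k) \<Rightarrow> (\<lambda>\<zeta>. \<zeta> k) | _ \<Rightarrow> (\<lambda>_. 0)) \<zeta>))"
    have c: "c \<in> polyfun I" unfolding c_def
      by (rule polyfun_compose[OF f(1)]) (auto simp: U_def intro: polyfun.coord)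
    have fc: "f \<pi> = c (\<lambda>k. \<pi> (Inl (Some k)))" for \<pi> unfolding c_def
      by (rule polyfun_cong[OF f(1)]) (auto simp: U_def)
    have "(\<lambda>x. c (\<lambda>k. z k (\<lambda>w. \<phi> w x))) \<in> P" using f(2) fc by (simp add: PP_def e_def)
    moreover have "(\<lambda>w. c (\<lambda>k. z k w)) \<in> polyfun UNIV" by (rule polyfun_compose[OF c z])
    ultimately have "(\<lambda>w. c (\<lambda>k. z k w)) \<in> q" by (simp add: q_def)
    from indep[OF c this] show "f = 0" using fc by (simp add: fun_eq_iff)
  qed
  have vanU: "\<pi> \<in> vanishing PP U" for \<pi> using indepU by (fastforce simp: vanishing_def)
  \<comment> \<open>A relation for \<open>a\<close>: its first \<open>card S + 1\<close> powers are linearly dependent over the base.\<close>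
  have "\<exists>p\<in>polys_over ?C. poly p bb \<in> PP \<and> (\<exists>i. coeff p i \<notin> PP)"
  proof -
    let ?T = "{..card S}"
    have "\<exists>m. (\<forall>s. m s \<in> polyfun I) \<and> a ^ t - (\<Sum>s\<in>S. (\<lambda>w. m s (\<lambda>k. z k w)) * s) \<in> q" for t
      using module_representation[OF subsetD[OF gen subring_set_power[OF subring_polyfun a(1), of t]]] by blast
    then have "\<forall>t. \<exists>m. (\<forall>s. m s \<in> polyfun I) \<and> a ^ t - (\<Sum>s\<in>S. (\<lambda>w. m s (\<lambda>k. z k w)) * s) \<in> q" ..
    from choice[OF this] obtain m where m: "\<And>t s. m t s \<in> polyfun I"
      "\<And>t. a ^ t - (\<Sum>s\<in>S. (\<lambda>w. m t s (\<lambda>k. z k w)) * s) \<in> q" by blast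
    have "\<exists>\<alpha>. (\<forall>t\<in>?T. \<alpha> t \<in> polyfun I) \<and> (\<exists>t\<in>?T. \<alpha> t \<noteq> 0) \<and> (\<forall>s\<in>S. (\<Sum>t\<in>?T. \<alpha> t * m t s) = 0)"
    proof (rule linear_dependence[OF subring_polyfun _ _ S(1)])
      show "f = 0 \<or> g = 0" if "f \<in> polyfun I" "g \<in> polyfun I" "f * g = 0" for f g
        using polyfun_no_zero_divisors that by blast
      show "(1 :: ('w \<Rightarrow> complex) \<Rightarrow> complex) \<noteq> 0" by (simp add: fun_eq_iff)
    qed (use m in auto)
    then obtain \<alpha> t0 where \<alpha>: "\<And>t. t \<le> card S \<Longrightarrow> \<alpha> t \<in> polyfun I" "t0 \<le> card S" "\<alpha> t0 \<noteq> 0"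
      "\<And>s. s \<in> S \<Longrightarrow> (\<Sum>t\<in>?T. \<alpha> t * m t s) = 0" by auto
    define E where "E = (\<lambda>t. (\<lambda>\<pi> :: 'w option + 'i \<Rightarrow> complex. \<alpha> t (\<lambda>k. \<pi> (Inl (Some k)))))"
    define p where "p = (\<Sum>t\<in>?T. monom (E t) t)"
    have cf: "coeff p i = (if i \<le> card S then E i else 0)" for i
      by (simp add: p_def coeff_sum if_distrib cong: if_cong)
    have Ein: "E t \<in> ?C" if "t \<le> card S" for t unfolding E_def by (rule lift_U[OF \<alpha>(1)[OF that]])
    have p: "p \<in> polys_over ?C" using Ein subring_setD(1)[OF C(1)] by (auto simp: polys_over_def cf)
    have pb: "poly p bb = (\<Sum>t\<in>?T. E t * bb ^ t)" by (simp add: p_def poly_sum poly_monom)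
    define A where "A = (\<lambda>t w. \<alpha> t (\<lambda>k. z k w))"
    have A: "A t \<in> polyfun UNIV" if "t \<le> card S" for t
      unfolding A_def by (rule polyfun_compose[OF \<alpha>(1)[OF that] z])
    have "(\<Sum>t\<in>?T. A t * a ^ t) \<in> q"
    proof -
      have "(\<Sum>t\<in>?T. A t * (\<Sum>s\<in>S. (\<lambda>w. m t s (\<lambda>k. z k w)) * s)) = 0"
      proof
        fix w
        have "(\<Sum>t\<in>?T. A t * (\<Sum>s\<in>S. (\<lambda>w. m t s (\<lambda>k. z k w)) * s)) w
            = (\<Sum>t\<in>?T. \<Sum>s\<in>S. \<alpha> t (\<lambda>k. z k w) * m t s (\<lambda>k. z k w) * s w)"
          by (simp add: sum_fun_apply A_def sum_distrib_left mult.assoc)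
        also have "\<dots> = (\<Sum>s\<in>S. (\<Sum>t\<in>?T. \<alpha> t (\<lambda>k. z k w) * m t s (\<lambda>k. z k w)) * s w)"
          unfolding sum_distrib_right by (rule sum.swap)
        also have "\<dots> = 0"
        proof (rule sum.neutral, rule ballI)
          fix s assume "s \<in> S"
          from fun_cong[OF \<alpha>(4)[OF this], of "\<lambda>k. z k w"]
          show "(\<Sum>t\<in>?T. \<alpha> t (\<lambda>k. z k w) * m t s (\<lambda>k. z k w)) * s w = 0"
            by (simp add: sum_fun_apply)
        qed
        finally show "(\<Sum>t\<in>?T. A t * (\<Sum>s\<in>S. (\<lambda>w. m t s (\<lambda>k. z k w)) * s)) w = 0 w" by simp
      qed
      then have "(\<Sum>t\<in>?T. A t * a ^ t) = (\<Sum>t\<in>?T. A t * (a ^ t - (\<Sum>s\<in>S. (\<lambda>w. m t s (\<lambda>k. z k w)) * s)))"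
        by (simp add: right_diff_distrib sum_subtractf)
      also have "\<dots> \<in> q" by (intro prime_in_sum[OF q] prime_inD(5)[OF q] A m(2)) auto
      finally show ?thesis .
    qed
    moreover have "(\<lambda>x. poly p bb (\<lambda>v. e v x)) = (\<lambda>x. (\<Sum>t\<in>?T. A t * a ^ t) (\<lambda>w. \<phi> w x))"
      unfolding pb by (simp add: fun_eq_iff sum_fun_apply power_fun_apply E_def A_def bb_def b_def e_def)
    moreover have "poly p bb \<in> polyfun V'"
      using p C(2) by (intro poly_in_subring[OF subring_polyfun _ bbV]) (auto simp: polys_over_def)
    ultimately have "poly p bb \<in> PP" by (simp add: PP_def q_def)
    moreover have "coeff p t0 \<notin> PP"
    proof
      assume "coeff p t0 \<in> PP"
      then have E0: "E t0 = 0" using indepU Ein \<alpha>(2) by (simp add: cf)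
      have "\<alpha> t0 \<zeta> = 0" for \<zeta>
        using fun_cong[OF E0, of "case_sum (case_option 0 \<zeta>) (\<lambda>_. 0)"] by (simp add: E_def)
      then show False using \<alpha>(3) by (auto simp: fun_eq_iff)
    qed
    ultimately show ?thesis using p by blast
  qed
  then obtain p i where pi: "p \<in> polys_over ?C" "poly p bb \<in> PP" "coeff p i \<notin> PP" by blast
  obtain \<mu> where \<mu>: "min_relation ?C PP bb \<mu>"
    using min_relation_exists[OF subring_polyfun PP C bbV pi] by blast
  have mu: "\<mu> \<in> polys_over ?C" "poly \<mu> bb \<in> PP" "lead_coeff \<mu> \<notin> PP" "degree \<mu> > 0"
    using \<mu> by (auto simp: min_relation_def)
  define k where "k = degree \<mu>"
  define L where "L = lead_coeff \<mu>"
  have LC: "L \<in> ?C" using polys_over_coeff[OF mu(1)] by (simp add: L_def)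
  \<comment> \<open>Over a generic base point every root of the relation comes from a point of the source.\<close>
  obtain u where u: "u \<in> polyfun (insert b U)" "u \<notin> PP"
    "\<And>\<pi>. \<pi> \<in> vanishing PP (insert b U) \<Longrightarrow> u \<pi> \<noteq> 0 \<Longrightarrow>
      \<exists>\<pi>'\<in>vanishing PP (insert b U \<union> W). (\<forall>i\<in>insert b U. \<pi>' i = \<pi> i) \<and> (1 :: _ \<Rightarrow> complex) \<pi>' \<noteq> 0"
    using extend_point_iterated[OF PP W, of 1] subring_setD(2)[OF subring_polyfun] prime_inD(3)[OF PP] by blast
  obtain pu where pu: "pu \<in> polys_over ?C" "u = poly pu bb"
    using polyfun_insert[OF u(1)] unfolding bb_def by blast
  obtain s h where s: "s \<in> polys_over ?C" and h: "h \<in> ?C" "h \<notin> PP" "poly s bb * poly pu bb - h \<in> PP"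
    using multiple_in_coefficients[OF subring_polyfun PP C bbV \<mu> pu(1)] u(2) pu(2) by blast
  have roots_lift: "\<exists>\<xi>\<in>zero_locus P. (\<lambda>w. \<phi> w \<xi>) \<in> zero_locus q \<and> a (\<lambda>w. \<phi> w \<xi>) = \<tau> \<and>
      (\<forall>k\<in>I. z k (\<lambda>w. \<phi> w \<xi>) = \<pi> (Inl (Some k)))"
    if \<pi>: "L \<pi> \<noteq> 0" "h \<pi> \<noteq> 0" "poly (specialize \<pi> \<mu>) \<tau> = 0" for \<pi> \<tau>
  proof -
    have van: "\<pi>(b := \<tau>) \<in> vanishing PP (insert b U)"
      using root_extends_point[OF PP bUV bU \<mu>[unfolded bb_def] vanU _ \<pi>(3)] \<pi>(1) by (simp add: L_def)
    have "u (\<pi>(b := \<tau>)) \<noteq> 0"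
    proof
      assume u0: "u (\<pi>(b := \<tau>)) = 0"
      have CI: "?C \<subseteq> polyfun (insert b U)" using polyfun_mono by blast
      have bI: "bb \<in> polyfun (insert b U)" unfolding bb_def by (auto intro: polyfun.coord)
      have "poly s bb * poly pu bb - h \<in> polyfun (insert b U)"
        by (intro subring_setD[OF subring_polyfun] poly_in_subring[OF subring_polyfun _ bI]
            CI[THEN subsetD] h(1)) (use s pu(1) CI in \<open>auto simp: polys_over_def\<close>)
      then have "(poly s bb * poly pu bb - h) (\<pi>(b := \<tau>)) = 0"
        using van h(3) unfolding vanishing_def by blast
      then have "h (\<pi>(b := \<tau>)) = 0" using u0 pu(2) by simp
      moreover have "h (\<pi>(b := \<tau>)) = h \<pi>" using bU by (intro polyfun_cong[OF h(1)]) auto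
      ultimately show False using \<pi>(2) by simp
    qed
    then obtain \<pi>' where \<pi>': "\<pi>' \<in> vanishing PP V'" "\<And>v. v \<in> insert b U \<Longrightarrow> \<pi>' v = (\<pi>(b := \<tau>)) v"
      using u(3)[OF van] unfolding V'_def by blast
    define \<xi> where "\<xi> = (\<lambda>i. \<pi>' (Inr i))"
    define X where "X = (\<lambda>i (\<pi> :: 'w option + 'i \<Rightarrow> complex). \<pi> (Inr i))"
    have X: "X i \<in> polyfun V'" if "i \<in> V" for i
      using that by (auto simp: X_def V'_def W_def intro: polyfun.coord)
    have vz: "f \<pi>' = 0" if "f \<in> PP" "f \<in> polyfun V'" for f
      using \<pi>'(1) that by (simp add: vanishing_def)
    have zeroP: "f \<xi> = 0" if f: "f \<in> P" for f
    proof -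
      have fV: "f \<in> polyfun V" using f prime_inD(1)[OF P] by blast
      have 1: "(\<lambda>\<pi>. f (\<lambda>i. X i \<pi>)) \<in> polyfun V'" by (rule polyfun_compose[OF fV X])
      then have 2: "(\<lambda>\<pi>. f (\<lambda>i. X i \<pi>)) \<in> PP" using f by (simp add: PP_def X_def e_def)
      from vz[OF 2 1] show ?thesis by (simp add: X_def \<xi>_def)
    qed
    have coordinate: "g (\<lambda>w. \<phi> w \<xi>) = \<pi>' v"
      if g: "g \<in> polyfun UNIV" and v: "v \<in> V'" "e v = (\<lambda>x. g (\<lambda>w. \<phi> w x))" for g v
    proof -
      define f where "f = (\<lambda>\<pi>. g (\<lambda>w. \<phi> w (\<lambda>i. X i \<pi>)) - \<pi> v)"
      have fV: "f \<in> polyfun V'" unfolding f_def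
        by (intro polyfun_diff polyfun.coord v polyfun_compose[OF g] polyfun_compose[OF \<phi> X])
      then have "f \<in> PP" using v(2) prime_inD(2)[OF P] by (simp add: PP_def f_def X_def e_def zero_fun_def)
      from vz[OF this fV] have "f \<pi>' = 0" .
      then show ?thesis by (simp add: f_def X_def \<xi>_def)
    qed
    have "(\<lambda>w. \<phi> w \<xi>) \<in> zero_locus q" using zeroP by (auto simp: q_def)
    moreover have "a (\<lambda>w. \<phi> w \<xi>) = \<tau>"
      using coordinate[OF a(1), of b] \<pi>'(2)[of b] bUV by (simp add: e_def b_def)
    moreover have "z k (\<lambda>w. \<phi> w \<xi>) = \<pi> (Inl (Some k))" if "k \<in> I" for k
    proof -
      have "Inl (Some k) \<in> U" using that by (simp add: U_def)
      then show ?thesis using coordinate[OF z[of k], of "Inl (Some k)"] \<pi>'(2)[of "Inl (Some k)"] bUV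
        by (auto simp: e_def b_def)
    qed
    ultimately show ?thesis using zeroP by blast
  qed
  have specdeg: "degree (specialize \<pi> \<mu>) = k" if "L \<pi> \<noteq> 0" for \<pi>
    using le_degree[of "specialize \<pi> \<mu>" k] degree_specialize[of \<pi> \<mu>] that by (simp add: k_def L_def)
  \<comment> \<open>On the image closure, values of functions are bounded by continuous functions of the base
    point.\<close>
  define dominates where "dominates = (\<lambda>\<beta> g.
      (\<forall>w\<in>zero_locus q. \<forall>\<pi>. (\<forall>k\<in>I. z k w = \<pi> (Inl (Some k))) \<longrightarrow> cmod (g w) \<le> \<beta> \<pi>) \<and>
      (\<forall>\<pi> :: 'w option + 'i \<Rightarrow> complex. \<beta> \<pi> \<ge> (0::real)) \<and> (\<forall>\<zeta> d r. isCont (\<lambda>\<tau>. \<beta> (line \<zeta> d \<tau>)) r))"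
  have dominatesD: "cmod (g w) \<le> \<beta> \<pi>" if "dominates \<beta> g" "w \<in> zero_locus q" "\<forall>k\<in>I. z k w = \<pi> (Inl (Some k))" for \<beta> g w \<pi>
    using that by (simp add: dominates_def)
  have dominatesD': "\<beta> \<pi> \<ge> 0" "isCont (\<lambda>\<tau>. \<beta> (line \<zeta> d \<tau>)) r" if "dominates \<beta> g" for \<beta> g \<pi> \<zeta> d r
    using that by (simp_all add: dominates_def)
  have bounded: "\<exists>\<beta>. dominates \<beta> g" if g: "g \<in> polyfun UNIV" for g
  proof -
    obtain M where M: "\<And>s t. M s t \<in> polyfun I"
      "\<And>w. w \<in> zero_locus q \<Longrightarrow> cmod (g w) \<le> (\<Sum>s\<in>S. \<Sum>t\<in>S. cmod (M s t (\<lambda>k. z k w)))"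
      using eigenvalue_bound[OF S gen g] by blast
    define \<beta> where "\<beta> = (\<lambda>\<pi> :: 'w option + 'i \<Rightarrow> complex. \<Sum>s\<in>S. \<Sum>t\<in>S. cmod (M s t (\<lambda>k. \<pi> (Inl (Some k)))))"
    have "cmod (g w) \<le> \<beta> \<pi>" if "w \<in> zero_locus q" "\<forall>k\<in>I. z k w = \<pi> (Inl (Some k))" for w \<pi>
    proof -
      have "M s t (\<lambda>k. z k w) = M s t (\<lambda>k. \<pi> (Inl (Some k)))" for s t
        using that(2) by (intro polyfun_cong[OF M(1)]) auto
      then show ?thesis using M(2)[OF that(1)] by (simp add: \<beta>_def)
    qed
    moreover have "\<beta> \<pi> \<ge> 0" for \<pi> by (simp add: \<beta>_def sum_nonneg)
    moreover have "isCont (\<lambda>\<tau>. \<beta> (line \<zeta> d \<tau>)) r" for \<zeta> d r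
    proof -
      have "isCont (\<lambda>\<tau>. M s t (\<lambda>k. \<zeta> (Inl (Some k)) + \<tau> * d (Inl (Some k)))) r" for s t
        unfolding isCont_def by (rule polyfun_tendsto[OF M(1)]) (intro tendsto_intros)
      then show ?thesis unfolding \<beta>_def by (intro continuous_intros)
    qed
    ultimately show ?thesis unfolding dominates_def by (intro exI[of _ \<beta>]) simp
  qed
  \<comment> \<open>The quotients by the leading coefficient \<open>L\<close> are bounded along lines, because the roots
    are values of \<open>a\<close>; so they are polynomials.\<close>
  have L0: "L \<noteq> 0" "h \<noteq> 0" using mu(3) h(2) prime_inD(2)[OF PP] by (auto simp: L_def)
  have Lh: "L * h \<in> ?C" "L * h \<noteq> 0" using polyfun_no_zero_divisors LC h(1) L0 by (auto intro: subring_setD(4)[OF C(1)])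
  have "\<exists>p\<in>?C. coeff \<mu> i = L * p" for i
  proof (rule polyfun_quotient[OF polys_over_coeff[OF mu(1)] LC L0(1) Lh])
    fix \<zeta> d r
    obtain \<beta> where \<beta>0: "dominates \<beta> a" using bounded[OF a(1)] by blast
    note \<beta> = dominatesD[OF \<beta>0] dominatesD'[OF \<beta>0]
    define K where "K = (1 + (\<beta> (line \<zeta> d r) + 1)) ^ k"
    have "\<forall>\<^sub>F \<tau> in at r. \<beta> (line \<zeta> d \<tau>) < \<beta> (line \<zeta> d r) + 1"
      by (rule order_tendstoD(2)[OF isContD[OF \<beta>(3)]]) simp
    then have "\<forall>\<^sub>F \<tau> in at r. (L * h) (line \<zeta> d \<tau>) \<noteq> 0 \<longrightarrow>
        cmod (coeff \<mu> i (line \<zeta> d \<tau>)) \<le> K * cmod (L (line \<zeta> d \<tau>))"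
    proof eventually_elim
      case (elim \<tau>)
      show ?case
      proof
        let ?\<pi> = "line \<zeta> d \<tau>"
        assume "(L * h) ?\<pi> \<noteq> 0"
        then have nz: "L ?\<pi> \<noteq> 0" "h ?\<pi> \<noteq> 0" by auto
        have bd: "cmod t \<le> \<beta> ?\<pi>" if tr: "poly (specialize ?\<pi> \<mu>) t = 0" for t
        proof -
          obtain \<xi> where "(\<lambda>w. \<phi> w \<xi>) \<in> zero_locus q" "a (\<lambda>w. \<phi> w \<xi>) = t"
            "\<forall>k\<in>I. z k (\<lambda>w. \<phi> w \<xi>) = ?\<pi> (Inl (Some k))"
            using roots_lift[OF nz tr] by blast
          then show ?thesis using \<beta>(1)[of "\<lambda>w. \<phi> w \<xi>" ?\<pi>] by simp
        qed
        have "cmod (coeff (specialize ?\<pi> \<mu>) i) \<le>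
            cmod (lead_coeff (specialize ?\<pi> \<mu>)) * (1 + \<beta> ?\<pi>) ^ degree (specialize ?\<pi> \<mu>)"
        proof (rule coeff_bound_by_roots[OF bd \<beta>(2)])
          show "specialize ?\<pi> \<mu> \<noteq> 0" using specdeg[OF nz(1)] mu(4) by (auto simp: k_def)
        qed
        also have "\<dots> = cmod (L ?\<pi>) * (1 + \<beta> ?\<pi>) ^ k" unfolding specdeg[OF nz(1)] by (simp add: L_def k_def)
        also have "\<dots> \<le> cmod (L ?\<pi>) * K" unfolding K_def
          using elim \<beta>(2)[of ?\<pi>] by (intro mult_left_mono power_mono) auto
        finally show "cmod (coeff \<mu> i ?\<pi>) \<le> K * cmod (L ?\<pi>)" by (simp add: mult.commute)
      qed
    qed
    then show "\<exists>K. \<forall>\<^sub>F \<tau> in at r. (L * h) (line \<zeta> d \<tau>) \<noteq> 0 \<longrightarrow>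
        cmod (coeff \<mu> i (line \<zeta> d \<tau>)) \<le> K * cmod (L (line \<zeta> d \<tau>))" ..
  qed
  then have "\<forall>i. \<exists>p. p \<in> ?C \<and> coeff \<mu> i = L * p" by blast
  from choice[OF this] obtain c where c: "\<And>i. c i \<in> ?C" "\<And>i. coeff \<mu> i = L * c i" by blast
  define N where "N = (\<Sum>i\<le>k. c i * bb ^ i)"
  have NV: "N \<in> polyfun V'" unfolding N_def using c(1) C(2)
    by (intro subring_set_sum[OF subring_polyfun] subring_setD(4)[OF subring_polyfun]
        subring_set_power[OF subring_polyfun bbV]) auto
  have "L * N = poly \<mu> bb" by (simp add: N_def poly_altdef c(2) k_def sum_distrib_left mult.assoc)
  then have "N \<in> PP" using prime_inD(7)[OF PP _ NV, of L] mu(2,3) LC C(2) by (auto simp: L_def)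
  define \<pi>0 where "\<pi>0 = (\<lambda>v::'w option + 'i. case v of Inl (Some k) \<Rightarrow> z k y | _ \<Rightarrow> 0)"
  have c0: "c 0 \<pi>0 = 0"
  proof -
    define C' where "C' = (\<lambda>i w. c i (\<lambda>v. (case v of Inl (Some k) \<Rightarrow> z k | _ \<Rightarrow> (\<lambda>_. 0)) w))"
    have C'1: "C' i \<in> polyfun UNIV" for i unfolding C'_def
      by (rule polyfun_compose[OF c(1)]) (auto simp: U_def intro: z)
    define Q where "Q = (\<Sum>i\<le>k. C' i * a ^ i)"
    have Qin: "Q \<in> polyfun UNIV" unfolding Q_def using C'1
      by (intro subring_set_sum[OF subring_polyfun] subring_setD(4)[OF subring_polyfun]
        subring_set_power[OF subring_polyfun a(1)])
    have "c i (\<lambda>v. e v x) = C' i (\<lambda>w. \<phi> w x)" for i x unfolding C'_def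
      by (rule polyfun_cong[OF c(1)]) (auto simp: U_def e_def)
    then have "(\<lambda>x. N (\<lambda>v. e v x)) = (\<lambda>x. Q (\<lambda>w. \<phi> w x))"
      by (simp add: N_def Q_def sum_fun_apply power_fun_apply bb_def b_def e_def)
    then have "(\<lambda>x. Q (\<lambda>w. \<phi> w x)) \<in> P" using \<open>N \<in> PP\<close> by (simp add: PP_def)
    from y[OF Qin this] have "(\<Sum>i\<le>k. C' i y * a y ^ i) = 0" by (simp add: Q_def sum_fun_apply power_fun_apply)
    then have "C' 0 y = 0" using a(2) by (simp add: power_0_left if_distrib cong: if_cong)
    moreover have "C' 0 y = c 0 \<pi>0" unfolding C'_def \<pi>0_def
      by (rule polyfun_cong[OF c(1)]) (auto simp: U_def)
    ultimately show ?thesis by simp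
  qed
  \<comment> \<open>As the constant term of the monic relation vanishes at the base point \<open>\<pi>0\<close> of \<open>y\<close>, the
    relation has small roots over base points close to it. The base points used lie on the line
    from \<open>\<pi>0\<close> to a point \<open>x0\<close> outside the exceptional set \<open>L * h = 0\<close>, hence are not
    exceptional when close to \<open>\<pi>0\<close>.\<close>
  obtain x0 where x0: "(L * h) x0 \<noteq> 0" using Lh(2) by (auto simp: fun_eq_iff)
  define d where "d = (\<lambda>v. x0 v - \<pi>0 v)"
  have close: "\<exists>\<tau> \<xi>. cmod \<tau> < \<eta> \<and> \<xi> \<in> zero_locus P \<and> (\<lambda>w. \<phi> w \<xi>) \<in> zero_locus q \<and>
      cmod (a (\<lambda>w. \<phi> w \<xi>)) < \<eta> \<and> (\<forall>k\<in>I. z k (\<lambda>w. \<phi> w \<xi>) = line \<pi>0 d \<tau> (Inl (Some k)))"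
    if \<eta>: "\<eta> > 0" for \<eta>
  proof -
    obtain g where g: "\<And>\<tau>. (L * h) (line \<pi>0 d \<tau>) = poly g \<tau>"
      using polyfun_on_line[OF Lh(1)] by blast
    have "poly g 1 \<noteq> 0" using x0 by (simp add: g[symmetric] d_def)
    then have "g \<noteq> 0" by auto
    from eventually_poly_nonzero[OF this, of 0]
    have e1: "\<forall>\<^sub>F \<tau> in at 0. (L * h) (line \<pi>0 d \<tau>) \<noteq> 0" by (simp only: g)
    have "((\<lambda>\<tau>. c 0 (line \<pi>0 d \<tau>)) \<longlongrightarrow> c 0 (line \<pi>0 d 0)) (at 0)"
      by (rule polyfun_tendsto[OF c(1)]) (intro tendsto_intros)
    then have "((\<lambda>\<tau>. cmod (c 0 (line \<pi>0 d \<tau>))) \<longlongrightarrow> 0) (at 0)"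
      using c0 by (simp add: tendsto_norm_zero)
    then have e2: "\<forall>\<^sub>F \<tau> in at 0. cmod (c 0 (line \<pi>0 d \<tau>)) < \<eta> ^ k"
      by (rule order_tendstoD(2)) (use \<eta> in simp)
    have "((\<lambda>\<tau>::complex. cmod \<tau>) \<longlongrightarrow> 0) (at 0)" using tendsto_norm_zero[OF tendsto_ident_at] by blast
    then have e3: "\<forall>\<^sub>F \<tau>::complex in at 0. cmod \<tau> < \<eta>" by (rule order_tendstoD(2)) (use \<eta> in simp)
    have "\<exists>\<tau>. (L * h) (line \<pi>0 d \<tau>) \<noteq> 0 \<and> cmod (c 0 (line \<pi>0 d \<tau>)) < \<eta> ^ k \<and> cmod \<tau> < \<eta>"
      using eventually_happens'[OF _ eventually_conj[OF e1 eventually_conj[OF e2 e3]]] by simp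
    then obtain \<tau> where \<tau>: "(L * h) (line \<pi>0 d \<tau>) \<noteq> 0" "cmod (c 0 (line \<pi>0 d \<tau>)) < \<eta> ^ k" "cmod \<tau> < \<eta>" by blast
    let ?\<pi> = "line \<pi>0 d \<tau>"
    have nz: "L ?\<pi> \<noteq> 0" "h ?\<pi> \<noteq> 0" using \<tau>(1) by auto
    have "cmod (coeff (specialize ?\<pi> \<mu>) 0) < cmod (lead_coeff (specialize ?\<pi> \<mu>)) * \<eta> ^ degree (specialize ?\<pi> \<mu>)"
      unfolding specdeg[OF nz(1)] using \<tau>(2) nz(1) c(2)[of 0] by (simp add: L_def k_def norm_mult)
    from small_root[OF this \<eta>] obtain r where r: "poly (specialize ?\<pi> \<mu>) r = 0" "cmod r < \<eta>" by blast
    from roots_lift[OF nz r(1)] r(2) \<tau>(3) show ?thesis by blast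
  qed
  have "\<forall>n. \<exists>\<tau> \<xi>. cmod \<tau> < inverse (real (Suc n)) \<and> \<xi> \<in> zero_locus P \<and> (\<lambda>w. \<phi> w \<xi>) \<in> zero_locus q \<and>
      cmod (a (\<lambda>w. \<phi> w \<xi>)) < inverse (real (Suc n)) \<and> (\<forall>k\<in>I. z k (\<lambda>w. \<phi> w \<xi>) = line \<pi>0 d \<tau> (Inl (Some k)))"
    by (rule allI, rule close) simp
  from choice[OF this] obtain \<tau> where "\<forall>n. \<exists>\<xi>. cmod (\<tau> n) < inverse (real (Suc n)) \<and> \<xi> \<in> zero_locus P \<and> (\<lambda>w. \<phi> w \<xi>) \<in> zero_locus q \<and>
      cmod (a (\<lambda>w. \<phi> w \<xi>)) < inverse (real (Suc n)) \<and> (\<forall>k\<in>I. z k (\<lambda>w. \<phi> w \<xi>) = line \<pi>0 d (\<tau> n) (Inl (Some k)))" ..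
  from choice[OF this] obtain \<xi> where seq: "\<And>n. cmod (\<tau> n) < inverse (real (Suc n))" "\<And>n. \<xi> n \<in> zero_locus P"
    "\<And>n. (\<lambda>w. \<phi> w (\<xi> n)) \<in> zero_locus q" "\<And>n. cmod (a (\<lambda>w. \<phi> w (\<xi> n))) < inverse (real (Suc n))"
    "\<And>n k. k \<in> I \<Longrightarrow> z k (\<lambda>w. \<phi> w (\<xi> n)) = line \<pi>0 d (\<tau> n) (Inl (Some k))" by blast
  define \<omega> where "\<omega> = (\<lambda>n w. \<phi> w (\<xi> n))"
  have \<tau>0: "\<tau> \<longlonglongrightarrow> 0"
    by (rule Lim_null_comparison[OF _ LIMSEQ_inverse_real_of_nat]) (intro always_eventually allI less_imp_le seq(1))
  have a0: "(\<lambda>n. a (\<omega> n)) \<longlonglongrightarrow> 0"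
    by (rule Lim_null_comparison[OF _ LIMSEQ_inverse_real_of_nat]) (unfold \<omega>_def, intro always_eventually allI less_imp_le seq(4))
  have "Bseq (\<lambda>n. \<omega> n w)" for w
  proof -
    have "(\<lambda>x. x w) \<in> polyfun UNIV" by (auto intro: polyfun.coord)
    from bounded[OF this] obtain \<beta> where \<beta>0: "dominates \<beta> (\<lambda>x. x w)" by blast
    note \<beta> = dominatesD[OF \<beta>0] dominatesD'(2)[OF \<beta>0]
    have "(\<lambda>n. \<beta> (line \<pi>0 d (\<tau> n))) \<longlonglongrightarrow> \<beta> (line \<pi>0 d 0)"
      by (rule isCont_tendsto_compose[OF \<beta>(2) \<tau>0])
    then have B: "Bseq (\<lambda>n. \<beta> (line \<pi>0 d (\<tau> n)))" by (intro convergent_imp_Bseq convergentI)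
    show ?thesis
    proof (rule Bseq_eventually_mono[OF _ B], rule always_eventually, rule allI)
      fix n
      have "cmod (\<omega> n w) \<le> \<beta> (line \<pi>0 d (\<tau> n))"
        by (rule \<beta>(1)) (use seq(3,5) in \<open>auto simp: \<omega>_def\<close>)
      then show "norm (\<omega> n w) \<le> norm (\<beta> (line \<pi>0 d (\<tau> n)))" by simp
    qed
  qed
  then obtain r w where r: "strict_mono r" "\<And>k. (\<lambda>n. \<omega> (r n) k) \<longlonglongrightarrow> w k"
    using convergent_subsequence_components by blast
  have lim: "(\<lambda>n. Q (\<omega> (r n))) \<longlonglongrightarrow> Q w" if "Q \<in> polyfun UNIV" for Q
    by (rule polyfun_tendsto[OF that, where \<omega> = "\<lambda>n. \<omega> (r n)"]) (rule r(2))
  \<comment> \<open>The limit of the subsequence lies in the fibre through \<open>y\<close>.\<close>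
  have "Q w = 0" if "Q \<in> q" for Q
  proof -
    have "Q (\<omega> (r n)) = 0" for n using seq(3)[of "r n"] that by (auto simp: \<omega>_def)
    then show ?thesis using lim[of Q] that LIMSEQ_unique[OF _ tendsto_const[of 0]] by (auto simp: q_def)
  qed
  moreover have "z k w = z k y" if "k \<in> I" for k
  proof -
    have "(\<lambda>n. line \<pi>0 d (\<tau> (r n)) (Inl (Some k))) \<longlonglongrightarrow> \<pi>0 (Inl (Some k)) + 0 * d (Inl (Some k))"
      using LIMSEQ_subseq_LIMSEQ[OF \<tau>0 r(1)] by (intro tendsto_intros) (simp add: o_def)
    then have "(\<lambda>n. z k (\<omega> (r n))) \<longlonglongrightarrow> z k y"
      using seq(5)[OF that] by (simp add: \<omega>_def \<pi>0_def)
    then show ?thesis using LIMSEQ_unique[OF lim[OF z]] by blast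
  qed
  ultimately have "w \<in> F" by (auto simp: F_def)
  moreover have "a w = 0"
    using LIMSEQ_unique[OF lim[OF a(1)]] LIMSEQ_subseq_LIMSEQ[OF a0 r(1)] by (simp add: o_def)
  ultimately have "w = y" by (rule a_sep)
  have "\<forall>\<^sub>F n in sequentially. \<forall>k. dist (\<omega> (r n) k) (y k) < \<epsilon>"
    using r(2) \<epsilon> unfolding \<open>w = y\<close> by (intro eventually_all_finite tendstoD)
  from eventually_happens'[OF sequentially_bot this]
  obtain n where "\<forall>k. dist (\<omega> (r n) k) (y k) < \<epsilon>" ..
  then show ?thesis using seq(2)[of "r n"] by (auto simp: \<omega>_def dist_norm)
qed

text \<open>Functions \<open>Q \<circ> \<phi>\<close> with \<open>Q y \<noteq> 0\<close> form a multiplicative set that contains no function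
  vanishing on the locus of \<open>J\<close>. A prime ideal that separates the two plays the part of an
  irreducible component of that locus whose image has \<open>y\<close> in its closure.\<close>

theorem zariski_limit_is_limit:
  fixes \<phi> :: "'w::finite \<Rightarrow> ('i \<Rightarrow> complex) \<Rightarrow> complex" and y :: "'w \<Rightarrow> complex"
  assumes V: "finite V" and \<phi>: "\<And>w. \<phi> w \<in> polyfun V" and J: "J \<subseteq> polyfun V"
    and y: "\<And>Q. Q \<in> polyfun UNIV \<Longrightarrow> (\<And>x. x \<in> zero_locus J \<Longrightarrow> Q (\<lambda>w. \<phi> w x) = 0) \<Longrightarrow> Q y = 0"
    and \<epsilon>: "\<epsilon> > 0"
  shows "\<exists>x\<in>zero_locus J. \<forall>w. cmod (\<phi> w x - y w) < \<epsilon>"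
proof -
  note D = subring_setD[OF subring_polyfun]
  let ?P0 = "{f \<in> polyfun V. \<forall>x\<in>zero_locus J. f x = 0}"
  let ?S = "{\<lambda>x. Q (\<lambda>w. \<phi> w x) | Q. Q \<in> polyfun UNIV \<and> Q y \<noteq> 0}"
  have "\<exists>P. prime_in (polyfun V) P \<and> ?P0 \<subseteq> P \<and> P \<inter> ?S = {}"
  proof (rule prime_avoiding_exists[OF subring_polyfun])
    show "1 \<in> ?S" by (intro CollectI exI[of _ "\<lambda>_. 1"]) (auto simp: one_fun_def intro: polyfun.const)
    show "?S \<subseteq> polyfun V" using \<phi> by (auto intro: polyfun_compose)
    show "?P0 \<inter> ?S = {}" using y by blast
    show "a * b \<in> ?S" if ab: "a \<in> ?S" "b \<in> ?S" for a b
    proof -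
      obtain Q Q' where "Q \<in> polyfun UNIV" "Q y \<noteq> 0" "a = (\<lambda>x. Q (\<lambda>w. \<phi> w x))"
        "Q' \<in> polyfun UNIV" "Q' y \<noteq> 0" "b = (\<lambda>x. Q' (\<lambda>w. \<phi> w x))" using ab by blast
      then show ?thesis
        by (intro CollectI exI[of _ "\<lambda>x. Q x * Q' x"]) (auto simp: times_fun_def intro: polyfun.mult)
    qed
  qed (auto intro: D)
  then obtain P where P: "prime_in (polyfun V) P" "?P0 \<subseteq> P" "P \<inter> ?S = {}" by blast
  have "Q y = 0" if "Q \<in> polyfun UNIV" "(\<lambda>x. Q (\<lambda>w. \<phi> w x)) \<in> P" for Q
    using that P(3) by blast
  then have "\<exists>x\<in>zero_locus P. \<forall>w. cmod (\<phi> w x - y w) < \<epsilon>"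
    by (rule limit_of_image_prime[OF V \<phi> P(1) _ \<epsilon>])
  then obtain x where x: "x \<in> zero_locus P" "\<forall>w. cmod (\<phi> w x - y w) < \<epsilon>" by blast
  have "J \<subseteq> P" using J P(2) by auto
  then show ?thesis using x by blast
qed

section \<open>Matrix algebra\<close>

text \<open>Scaling by complex numbers; \<open>*\<^sub>R\<close> on matrices is scaling by reals only.\<close>

definition smul :: "complex \<Rightarrow> 'n::finite cmat \<Rightarrow> 'n cmat" where
  "smul c A = (\<chi> i j. c * A $ i $ j)"

lemma smul_nth [simp]: "smul c A $ i $ j = c * A $ i $ j"
  by (simp add: smul_def)

lemma mat_eqI: "(\<And>i j. A $ i $ j = B $ i $ j) \<Longrightarrow> A = (B :: 'a ^ 'm ^ 'k)"
  by (simp add: vec_eq_iff)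

lemma mmul_nth: "(A ** B) $ i $ j = (\<Sum>k\<in>UNIV. A $ i $ k * B $ k $ j)"
  by (simp add: matrix_matrix_mult_def)

lemma mmul_simps:
  fixes A B C :: "'n::finite cmat"
  shows "(A + B) ** C = A ** C + B ** C" "(A - B) ** C = A ** C - B ** C"
    "A ** (B - C) = A ** B - A ** C" "A ** (B + C) = A ** B + A ** C"
    "(- A) ** C = - (A ** C)" "A ** (- C) = - (A ** C)" "0 ** C = 0" "A ** 0 = 0"
    "smul c A ** B = smul c (A ** B)" "A ** smul c B = smul c (A ** B)"
  by (auto intro!: mat_eqI simp: mmul_nth sum.distrib sum_subtractf sum_negf algebra_simps sum_distrib_left)

lemma mmul_sum:
  fixes A :: "'n::finite cmat"
  shows "(\<Sum>i\<in>I. f i) ** A = (\<Sum>i\<in>I. f i ** A)" "A ** (\<Sum>i\<in>I. f i) = (\<Sum>i\<in>I. A ** f i)"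
  by (induction I rule: infinite_finite_induct) (auto simp: mmul_simps)

lemma smul_simps:
  "smul c (A + B) = smul c A + smul c B" "smul c (A - B) = smul c A - smul c B"
  "smul c (smul d A) = smul (c * d) A" "smul (c + d) A = smul c A + smul d A"
  "smul (c - d) A = smul c A - smul d A" "smul 1 A = A" "smul 0 A = 0" "smul c 0 = 0"
  "smul c (- A) = - smul c A" "smul (- c) A = - smul c A"
  by (auto intro!: mat_eqI simp: algebra_simps)

lemma smul_sum: "smul c (\<Sum>i\<in>I. f i) = (\<Sum>i\<in>I. smul c (f i))"
  by (induction I rule: infinite_finite_induct) (auto simp: smul_simps)

lemma scaleR_smul: "r *\<^sub>R A = smul (of_real r) A"
proof (rule mat_eqI)
  show "(r *\<^sub>R A) $ i $ j = smul (of_real r) A $ i $ j" for i j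
    unfolding vector_scaleR_component smul_nth by (rule scaleR_conv_of_real)
qed

lemma smul_vec: "smul c A *v v = c *s (A *v v)"
  by (simp add: vec_eq_iff matrix_vector_mult_def sum_distrib_left mult.assoc)

lemma minv:
  fixes A :: "'n::finite cmat"
  assumes "invertible A"
  shows "A ** matrix_inv A = mat 1" "matrix_inv A ** A = mat 1"
  using someI_ex[OF assms[unfolded invertible_def]] by (auto simp: matrix_inv_def)

lemma minvI:
  fixes A B :: "'n::finite cmat"
  assumes "A ** B = mat 1"
  shows "invertible A" "matrix_inv A = B"
proof -
  have BA: "B ** A = mat 1" using assms matrix_left_right_inverse by blast
  then show inv: "invertible A" using assms by (auto simp: invertible_def)
  have "matrix_inv A = matrix_inv A ** (A ** B)" by (simp add: assms)
  also have "\<dots> = B" by (simp add: matrix_mul_assoc minv[OF inv])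
  finally show "matrix_inv A = B" .
qed

text \<open>The type-class power of matrices is taken entry by entry, hence this one.\<close>

definition mpow :: "'n::finite cmat \<Rightarrow> nat \<Rightarrow> 'n cmat" where
  "mpow A k = (((**) A) ^^ k) (mat 1)"

lemma mpow_0 [simp]: "mpow A 0 = mat 1" and mpow_Suc: "mpow A (Suc k) = A ** mpow A k"
  by (simp_all add: mpow_def)

lemma funpow_mmul: "(((**) A) ^^ k) X = mpow A k ** X"
  by (induction k) (auto simp: mpow_Suc matrix_mul_assoc)

lemma mpow_commute: "A ** X = X ** A \<Longrightarrow> mpow A k ** X = X ** mpow A k"
  by (induction k) (auto simp: mpow_Suc matrix_mul_assoc[symmetric], metis matrix_mul_assoc)

lemma mpow_Suc2: "mpow A (Suc k) = mpow A k ** A"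
  using mpow_commute[of A A k] by (simp add: mpow_Suc)

lemma nilpotent_mat_mpow: "nilpotent_mat N \<longleftrightarrow> (\<exists>k. mpow N k = 0)"
  by (simp add: nilpotent_mat_def mpow_def)

section \<open>Polynomials of a matrix\<close>

definition pmat :: "complex poly \<Rightarrow> 'n::finite cmat \<Rightarrow> 'n cmat" where
  "pmat p u = (\<Sum>i\<le>degree p. smul (coeff p i) (mpow u i))"

lemma pmat_cutoff: "degree p \<le> n \<Longrightarrow> pmat p u = (\<Sum>i\<le>n. smul (coeff p i) (mpow u i))"
  unfolding pmat_def by (intro sum.mono_neutral_left) (auto simp: coeff_eq_0 smul_simps)

lemma pmat_add: "pmat (p + q) u = pmat p u + pmat q u"
proof -
  define n where "n = max (degree p) (degree q)"
  have "degree (p + q) \<le> n" by (simp add: n_def degree_add_le_max)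
  then show ?thesis using pmat_cutoff[of p n u] pmat_cutoff[of q n u] pmat_cutoff[of "p + q" n u]
    by (simp add: n_def sum.distrib smul_simps)
qed

lemma pmat_smult: "pmat (smult c p) u = smul c (pmat p u)"
  using pmat_cutoff[of "smult c p" "degree p" u] by (simp add: degree_smult_le pmat_def smul_sum smul_simps)

lemma pmat_pCons: "pmat (pCons a p) u = smul a (mat 1) + u ** pmat p u"
proof -
  have "pmat (pCons a p) u = (\<Sum>i\<le>Suc (degree p). smul (coeff (pCons a p) i) (mpow u i))"
    by (rule pmat_cutoff) (simp add: degree_pCons_le)
  also have "\<dots> = smul a (mat 1) + (\<Sum>i\<le>degree p. smul (coeff p i) (mpow u (Suc i)))"
    by (subst sum.atMost_Suc_shift) simp
  also have "\<dots> = smul a (mat 1) + u ** pmat p u"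
    by (simp add: pmat_def mmul_sum mmul_simps mpow_Suc)
  finally show ?thesis .
qed

lemma pmat_0 [simp]: "pmat 0 u = 0" by (simp add: pmat_def smul_simps)

lemma pmat_1 [simp]: "pmat 1 u = mat 1" by (simp add: pmat_def smul_simps)

lemma pmat_mult: "pmat (p * q) u = pmat p u ** pmat q u"
  by (induction p) (auto simp: pmat_add pmat_smult pmat_pCons mmul_simps matrix_mul_assoc smul_simps)

lemma pmat_sum: "pmat (\<Sum>i\<in>I. f i) u = (\<Sum>i\<in>I. pmat (f i) u)"
  by (induction I rule: infinite_finite_induct) (auto simp: pmat_add)

lemma pmat_commute: "u ** X = X ** u \<Longrightarrow> pmat p u ** X = X ** pmat p u"
  by (simp add: pmat_def mmul_sum mmul_simps mpow_commute)

lemma pmat_linear_power: "pmat ([:- z, 1:] ^ k) u = mpow (u - smul z (mat 1)) k"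
proof (induction k)
  case (Suc k)
  have "pmat [:- z, 1:] u = u - smul z (mat 1)"
    by (simp add: pmat_pCons mmul_simps smul_simps)
  then show ?case unfolding power_Suc pmat_mult mpow_Suc Suc by simp
qed simp

section \<open>Spectral projections\<close>

definition comaximal :: "'a::comm_ring_1 \<Rightarrow> 'a \<Rightarrow> bool" where
  "comaximal f g \<longleftrightarrow> (\<exists>s t. s * f + t * g = 1)"

lemma comaximal_sym: "comaximal f g \<Longrightarrow> comaximal g f"
  unfolding comaximal_def by (metis add.commute)

lemma comaximal_mult:
  assumes "comaximal f g" "comaximal f h" shows "comaximal f (g * h)"
proof -
  obtain s t s' t' where *: "s * f + t * g = 1" "s' * f + t' * h = 1"
    using assms unfolding comaximal_def by blast
  have "1 = (s * f + t * g) * (s' * f + t' * h)" by (simp add: *)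
  also have "\<dots> = (s * s' * f + s * t' * h + t * g * s') * f + (t * t') * (g * h)"
    by (simp add: algebra_simps)
  finally show ?thesis unfolding comaximal_def by metis
qed

lemma comaximal_1: "comaximal f 1"
  unfolding comaximal_def by (rule exI[of _ 0], rule exI[of _ 1]) simp

lemma comaximal_power: "comaximal f g \<Longrightarrow> comaximal f (g ^ k)"
  by (induction k) (auto intro: comaximal_1 comaximal_mult)

lemma comaximal_prod: "(\<And>i. i \<in> I \<Longrightarrow> comaximal f (g i)) \<Longrightarrow> comaximal f (\<Prod>i\<in>I. g i)"
  by (induction I rule: infinite_finite_induct) (auto intro: comaximal_1 comaximal_mult)

lemma comaximal_linear:
  fixes a b :: complex assumes "a \<noteq> b" shows "comaximal [:- a, 1:] [:- b, 1:]"
proof -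
  define c where "c = 1 / (b - a)"
  have "c * (b - a) = 1" using assms by (simp add: c_def)
  then have "[:c:] * [:- a, 1:] + [:- c:] * [:- b, 1:] = 1" by (simp add: one_pCons algebra_simps)
  then show ?thesis unfolding comaximal_def by blast
qed

lemma partition_of_unity:
  fixes f :: "'b \<Rightarrow> 'a::comm_ring_1"
  assumes "finite I" "I \<noteq> {}" "\<And>i j. i \<in> I \<Longrightarrow> j \<in> I \<Longrightarrow> i \<noteq> j \<Longrightarrow> comaximal (f i) (f j)"
  shows "\<exists>q. (\<Sum>i\<in>I. q i * (\<Prod>j\<in>I - {i}. f j)) = 1"
  using assms
proof (induction I rule: finite_ne_induct)
  case (singleton x)
  then show ?case by (intro exI[of _ "\<lambda>_. 1"]) simp
next
  case (insert a I)
  obtain q where q: "(\<Sum>i\<in>I. q i * (\<Prod>j\<in>I - {i}. f j)) = 1" using insert by blast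
  have "comaximal (f a) (\<Prod>i\<in>I. f i)"
    by (rule comaximal_prod) (use insert in auto)
  then obtain s t where st: "s * f a + t * (\<Prod>i\<in>I. f i) = 1" unfolding comaximal_def by blast
  define q' where "q' = (\<lambda>i. if i = a then t else s * q i)"
  have "(\<Sum>i\<in>I. q' i * (\<Prod>j\<in>insert a I - {i}. f j)) = (\<Sum>i\<in>I. s * f a * (q i * (\<Prod>j\<in>I - {i}. f j)))"
  proof (rule sum.cong[OF refl])
    fix i assume i: "i \<in> I"
    then have "insert a I - {i} = insert a (I - {i})" using insert by auto
    then show "q' i * (\<Prod>j\<in>insert a I - {i}. f j) = s * f a * (q i * (\<Prod>j\<in>I - {i}. f j))"
      using i insert by (auto simp: q'_def mult_ac)
  qed
  also have "\<dots> = s * f a" by (simp add: q flip: sum_distrib_left)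
  finally have 1: "(\<Sum>i\<in>I. q' i * (\<Prod>j\<in>insert a I - {i}. f j)) = s * f a" .
  have 2: "insert a I - {a} = I" using insert by auto
  have "(\<Sum>i\<in>insert a I. q' i * (\<Prod>j\<in>insert a I - {i}. f j))
      = q' a * (\<Prod>j\<in>insert a I - {a}. f j) + (\<Sum>i\<in>I. q' i * (\<Prod>j\<in>insert a I - {i}. f j))"
    by (rule sum.insert) (use insert in auto)
  also have "\<dots> = 1" unfolding 1 2 using st by (simp add: q'_def add.commute)
  finally show ?case by blast
qed

text \<open>The powers of \<open>u\<close> are vectors in a space of finite dimension.\<close>

lemma annihilating_polynomial:
  fixes u :: "'n::finite cmat"
  shows "\<exists>p. p \<noteq> 0 \<and> pmat p u = 0"
proof -
  let ?S = "UNIV :: ('n \<times> 'n) set"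
  obtain \<alpha> where \<alpha>: "\<exists>t\<in>{..card ?S}. \<alpha> t \<noteq> 0"
    "\<And>s. (\<Sum>t\<in>{..card ?S}. \<alpha> t * (mpow u t $ fst s $ snd s)) = 0"
    using linear_dependence[of "UNIV :: complex set" ?S "{..card ?S}" "\<lambda>t s. mpow u t $ fst s $ snd s"]
    by (auto simp: subring_set_def)
  define p where "p = (\<Sum>t\<le>card ?S. monom (\<alpha> t) t)"
  have cf: "coeff p i = (if i \<le> card ?S then \<alpha> i else 0)" for i
    by (simp add: p_def coeff_sum if_distrib cong: if_cong)
  have "degree p \<le> card ?S" by (rule degree_le) (simp add: cf)
  from pmat_cutoff[OF this] have "pmat p u = (\<Sum>i\<le>card ?S. smul (\<alpha> i) (mpow u i))"
    by (simp add: cf)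
  also have "\<dots> = 0"
  proof (rule mat_eqI)
    fix i j
    show "(\<Sum>i\<le>card ?S. smul (\<alpha> i) (mpow u i)) $ i $ j = 0 $ i $ j"
      using \<alpha>(2)[of "(i, j)"] by (simp add: sum_component)
  qed
  finally have "pmat p u = 0" .
  moreover have "p \<noteq> 0" using \<alpha>(1) cf by (metis atMost_iff coeff_0)
  ultimately show ?thesis by blast
qed

text \<open>The product of the pairwise comaximal powers of linear factors of an annihilating
  polynomial kills \<open>u\<close>. A partition of unity for the complementary products, evaluated at \<open>u\<close>,
  gives the projections onto the generalized eigenspaces. Being polynomials in \<open>u\<close>, they
  commute with whatever commutes with \<open>u\<close>.\<close>

lemma spectral_projections:
  fixes u :: "'n::finite cmat"
  obtains \<Lambda> :: "complex set" and E :: "complex \<Rightarrow> 'n cmat" and m where "finite \<Lambda>" "(\<Sum>z\<in>\<Lambda>. E z) = mat 1"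
    "\<And>z. z \<in> \<Lambda> \<Longrightarrow> mpow (u - smul z (mat 1)) m ** E z = 0"
    "\<And>z w. z \<in> \<Lambda> \<Longrightarrow> w \<in> \<Lambda> \<Longrightarrow> z \<noteq> w \<Longrightarrow> E z ** E w = 0"
    "\<And>z X. u ** X = X ** u \<Longrightarrow> E z ** X = X ** E z"
proof -
  obtain p where p: "p \<noteq> 0" "pmat p u = 0" using annihilating_polynomial by blast
  define \<Lambda> where "\<Lambda> = {z. poly p z = 0}"
  define f where "f = (\<lambda>z. [:- z, 1:] ^ Polynomial.order z p)"
  define F where "F = (\<Prod>z\<in>\<Lambda>. f z)"
  have fin: "finite \<Lambda>" using p(1) by (simp add: \<Lambda>_def poly_roots_finite)
  have "p = smult (lead_coeff p) F" unfolding F_def f_def \<Lambda>_def by (rule complex_poly_decompose[symmetric])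
  then have "smul (lead_coeff p) (pmat F u) = 0" using p(2) by (metis pmat_smult)
  then have "smul (1 / lead_coeff p) (smul (lead_coeff p) (pmat F u)) = 0" by (simp add: smul_simps)
  then have F0: "pmat F u = 0" using p(1) by (simp add: smul_simps)
  have multF: "pmat (h * F) u = 0" for h using F0 by (simp add: pmat_mult mmul_simps)
  show thesis
  proof (cases "\<Lambda> = {}")
    case True
    then have "(mat 1 :: 'n cmat) = 0" using F0 by (simp add: F_def)
    show thesis
      by (rule that[of "{}" "\<lambda>_. 0" 0]) (use \<open>mat 1 = 0\<close> in \<open>auto simp: mmul_simps\<close>)
  next
    case False
    have "comaximal (f z) (f w)" if "z \<noteq> w" for z w
      unfolding f_def using comaximal_linear[OF that]
      by (intro comaximal_power comaximal_sym[OF comaximal_power[OF comaximal_sym]])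
    then obtain q where q: "(\<Sum>z\<in>\<Lambda>. q z * (\<Prod>w\<in>\<Lambda> - {z}. f w)) = 1"
      using partition_of_unity[OF fin False, of f] by blast
    define g where "g = (\<lambda>z. \<Prod>w\<in>\<Lambda> - {z}. f w)"
    define E where "E = (\<lambda>z. pmat (q z * g z) u)"
    have fg: "f z * g z = F" if "z \<in> \<Lambda>" for z
      using that fin by (simp add: F_def g_def prod.remove[of \<Lambda> z])
    define m where "m = Max ((\<lambda>z. Polynomial.order z p) ` \<Lambda>)"
    show thesis
    proof (rule that[of \<Lambda> E m])
      show "finite \<Lambda>" by fact
      show "(\<Sum>z\<in>\<Lambda>. E z) = mat 1"
        using q by (simp add: E_def g_def flip: pmat_sum)
      fix z assume z: "z \<in> \<Lambda>"
      have "Polynomial.order z p \<le> m" using z fin by (simp add: m_def)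
      then have "m = (m - Polynomial.order z p) + Polynomial.order z p" by simp
      then have "[:- z, 1:] ^ m = [:- z, 1:] ^ (m - Polynomial.order z p) * f z"
        unfolding f_def by (metis power_add)
      then have "[:- z, 1:] ^ m * (q z * g z) = ([:- z, 1:] ^ (m - Polynomial.order z p) * q z) * (f z * g z)"
        by (simp add: mult_ac)
      then have "pmat ([:- z, 1:] ^ m * (q z * g z)) u = 0" by (simp only: fg[OF z] multF)
      then show "mpow (u - smul z (mat 1)) m ** E z = 0"
        by (simp only: pmat_mult[of "[:- z, 1:] ^ m"] pmat_linear_power E_def)
      fix w assume w: "w \<in> \<Lambda>" "z \<noteq> w"
      have "g z = f w * (\<Prod>v\<in>\<Lambda> - {z} - {w}. f v)"
        unfolding g_def using w fin by (intro prod.remove) auto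
      then have "(q z * g z) * (q w * g w) = (q z * q w * (\<Prod>v\<in>\<Lambda> - {z} - {w}. f v)) * (f w * g w)"
        by (simp add: mult_ac)
      then have "pmat ((q z * g z) * (q w * g w)) u = 0" by (simp only: fg[OF w(1)] multF)
      then show "E z ** E w = 0" unfolding E_def by (simp only: pmat_mult[of "q z * g z"])
    next
      fix z X assume "u ** X = X ** u"
      then show "E z ** X = X ** E z" unfolding E_def by (rule pmat_commute)
    qed
  qed
qed

section \<open>Semisimple matrices\<close>

definition diagonal :: "'n::finite cmat \<Rightarrow> bool" where
  "diagonal D \<longleftrightarrow> (\<forall>i j. i \<noteq> j \<longrightarrow> D $ i $ j = 0)"

lemma semisimple_iff: "semisimple_mat S \<longleftrightarrow> (\<exists>P :: 'n cmat. invertible P \<and> diagonal (matrix_inv P ** S ** P))"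
  for S :: "'n::finite cmat"
  by (simp add: semisimple_mat_def diagonal_def)

lemma diagonal_mmul:
  assumes "diagonal D"
  shows "(D ** Y) $ i $ j = D $ i $ i * Y $ i $ j" "(Y ** D) $ i $ j = Y $ i $ j * D $ j $ j"
proof -
  have "(\<Sum>k\<in>UNIV. D $ i $ k * Y $ k $ j) = (\<Sum>k\<in>{i}. D $ i $ k * Y $ k $ j)"
    by (rule sum.mono_neutral_right) (use assms in \<open>auto simp: diagonal_def\<close>)
  then show "(D ** Y) $ i $ j = D $ i $ i * Y $ i $ j" by (simp add: mmul_nth)
  have "(\<Sum>k\<in>UNIV. Y $ i $ k * D $ k $ j) = (\<Sum>k\<in>{j}. Y $ i $ k * D $ k $ j)"
    by (rule sum.mono_neutral_right) (use assms in \<open>auto simp: diagonal_def\<close>)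
  then show "(Y ** D) $ i $ j = Y $ i $ j * D $ j $ j" by (simp add: mmul_nth)
qed

lemma semisimple_if_eigenvectors_span:
  fixes S :: "'n::finite cmat"
  assumes span: "vec.span {v. \<exists>z. S *v v = z *s v} = UNIV"
  shows "semisimple_mat S"
proof -
  let ?E = "{v. \<exists>z. S *v v = z *s v}"
  obtain B where B: "B \<subseteq> ?E" "vec.independent B" "?E \<subseteq> vec.span B"
    using vec.maximal_independent_subset[of ?E] by blast
  have sB: "vec.span B = UNIV"
    using span vec.span_mono[OF B(3)] by (auto simp: vec.span_span)
  then have cB: "card B = CARD('n)"
    using vec.dim_eq_card_independent[OF B(2)] vec_dim_card[where 'a = complex and 'n = 'n] vec.dim_span[of B] by simp
  have "finite B" using cB by (metis card.infinite finite_UNIV_card_ge_0 finite less_irrefl)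
  then obtain f where f: "bij_betw f (UNIV :: 'n set) B"
    using cB by (metis finite_same_card_bij finite)
  define P where "P = (\<chi> i j. f j $ i)"
  have col: "column j P = f j" for j by (simp add: column_def P_def vec_eq_iff)
  have "columns P = B" using f by (auto simp: columns_def col bij_betw_def)
  then obtain Q where "P ** Q = mat 1" using matrix_right_invertible_span_columns[of P] sB by auto
  note inv = minvI(1)[OF this]
  have "\<exists>z. S *v f j = z *s f j" for j
  proof -
    have "f j \<in> B" using bij_betw_apply[OF f] by simp
    then show ?thesis using B(1) by blast
  qed
  then have "\<forall>j. \<exists>z. S *v f j = z *s f j" ..
  from choice[OF this] obtain z where z: "\<And>j. S *v f j = z j *s f j" by blast
  define D where "D = (\<chi> i j. if i = j then z j else 0)"
  have D: "diagonal D" by (simp add: diagonal_def D_def)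
  have "S ** P = P ** D"
  proof (rule mat_eqI)
    fix i j
    have "(S ** P) $ i $ j = (S *v f j) $ i" by (simp add: mmul_nth matrix_vector_mult_def P_def)
    also have "\<dots> = P $ i $ j * D $ j $ j" by (simp add: z P_def D_def)
    finally show "(S ** P) $ i $ j = (P ** D) $ i $ j" by (simp add: diagonal_mmul(2)[OF D])
  qed
  then have "matrix_inv P ** S ** P = D"
    by (simp add: matrix_mul_assoc[symmetric]) (simp add: matrix_mul_assoc minv[OF inv])
  then show ?thesis using inv D by (auto simp: semisimple_iff)
qed

lemma commutator_conjugate:
  fixes P :: "'n::finite cmat"
  assumes "invertible P"
  shows "matrix_inv P ** (A ** B) ** P = (matrix_inv P ** A ** P) ** (matrix_inv P ** B ** P)"
proof -
  have "(matrix_inv P ** A ** P) ** (matrix_inv P ** B ** P) = matrix_inv P ** A ** (P ** matrix_inv P) ** B ** P"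
    by (simp add: matrix_mul_assoc)
  then show ?thesis by (simp add: minv[OF assms] matrix_mul_assoc)
qed

text \<open>For left multiplication by \<open>S - z\<close> and for the commutator with \<open>S\<close> alike, semisimplicity
  means that the kernel does not grow with the powers: in a diagonalizing basis both operators
  multiply each matrix entry by a number.\<close>

lemma semisimple_kernel:
  fixes S :: "'n::finite cmat"
  assumes S: "semisimple_mat S"
  shows "mpow (S - smul z (mat 1)) k ** W = 0 \<Longrightarrow> S ** W = smul z W"
    and "((\<lambda>X. S ** X - X ** S) ^^ k) X = 0 \<Longrightarrow> S ** X = X ** S"
proof -
  obtain P :: "'n cmat" where P: "invertible P" "diagonal (matrix_inv P ** S ** P)" using S by (auto simp: semisimple_iff)
  define D where "D = matrix_inv P ** S ** P"
  have D: "diagonal D" using P(2) by (simp add: D_def)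
  define cj where "cj = (\<lambda>X. matrix_inv P ** X ** P)"
  have cj0: "X = 0" if "cj X = 0" for X
  proof -
    have "X = P ** cj X ** matrix_inv P"
      unfolding cj_def by (simp add: matrix_mul_assoc minv[OF P(1)])
        (simp add: matrix_mul_assoc[symmetric] minv[OF P(1)])
    then show ?thesis using that by (simp add: mmul_simps)
  qed
  have cj_simps: "cj (A ** B) = cj A ** cj B" "cj (A - B) = cj A - cj B" "cj (smul c A) = smul c (cj A)"
    "cj S = D" "cj 0 = 0" "cj (mat 1) = mat 1" for A B c
    unfolding cj_def D_def using commutator_conjugate[OF P(1)]
    by (simp_all add: mmul_simps minv[OF P(1)])
  {
    assume W: "mpow (S - smul z (mat 1)) k ** W = 0"
    have "cj (mpow (S - smul z (mat 1)) k ** W) $ i $ j = (D $ i $ i - z) ^ k * cj W $ i $ j" for i j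
    proof (induction k)
      case (Suc k)
      then show ?case
        by (simp add: mpow_Suc matrix_mul_assoc[symmetric] cj_simps mmul_simps diagonal_mmul[OF D] algebra_simps)
    qed (simp add: cj_simps)
    then have "(D $ i $ i - z) ^ k * cj W $ i $ j = 0" for i j using W by (simp add: cj_simps)
    then have "cj (S ** W - smul z W) = 0"
      by (intro mat_eqI) (auto simp: cj_simps diagonal_mmul[OF D] left_diff_distrib[symmetric])
    from cj0[OF this] show "S ** W = smul z W" by simp
  }
  {
    assume X: "((\<lambda>X. S ** X - X ** S) ^^ k) X = 0"
    have "cj (((\<lambda>X. S ** X - X ** S) ^^ k) X) $ i $ j = (D $ i $ i - D $ j $ j) ^ k * cj X $ i $ j" for i j
      by (induction k) (simp_all add: cj_simps diagonal_mmul[OF D] algebra_simps)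
    then have *: "(D $ i $ i - D $ j $ j) ^ k * cj X $ i $ j = 0" for i j using X by (simp add: cj_simps)
    have "cj (S ** X - X ** S) $ i $ j = (D $ i $ i - D $ j $ j) * cj X $ i $ j" for i j
      by (simp add: cj_simps diagonal_mmul[OF D] algebra_simps)
    moreover have "(D $ i $ i - D $ j $ j) * cj X $ i $ j = 0" for i j using *[of i j] by auto
    ultimately have "cj (S ** X - X ** S) = 0" by (intro mat_eqI) simp
    from cj0[OF this] show "S ** X = X ** S" by simp
  }
qed

text \<open>The products of the spectral projections of the two matrices have images consisting of
  joint eigenvectors.\<close>

lemma semisimple_add:
  fixes S T :: "'n::finite cmat"
  assumes S: "semisimple_mat S" and T: "semisimple_mat T" and ST: "S ** T = T ** S"
  shows "semisimple_mat (S + T)"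
proof -
  obtain \<Lambda> E m where E: "finite \<Lambda>" "(\<Sum>z\<in>\<Lambda>. E z) = mat 1"
    "\<And>z. z \<in> \<Lambda> \<Longrightarrow> mpow (S - smul z (mat 1)) m ** E z = 0"
    "\<And>z X. S ** X = X ** S \<Longrightarrow> E z ** X = X ** E z"
    using spectral_projections[of S] by metis
  obtain \<Lambda>' E' m' where E': "finite \<Lambda>'" "(\<Sum>z\<in>\<Lambda>'. E' z) = mat 1"
    "\<And>z. z \<in> \<Lambda>' \<Longrightarrow> mpow (T - smul z (mat 1)) m' ** E' z = 0"
    using spectral_projections[of T] by metis
  have SE: "S ** E z = smul z (E z)" if "z \<in> \<Lambda>" for z
    using semisimple_kernel(1)[OF S E(3)[OF that]] .
  have TE: "T ** E' w = smul w (E' w)" if "w \<in> \<Lambda>'" for w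
    using semisimple_kernel(1)[OF T E'(3)[OF that]] .
  let ?V = "{v. \<exists>z. (S + T) *v v = z *s v}"
  have ev: "(E z ** E' w) *v v \<in> ?V" if zw: "z \<in> \<Lambda>" "w \<in> \<Lambda>'" for z w v
  proof -
    have "S ** (E z ** E' w) = smul z (E z ** E' w)"
      using SE[OF zw(1)] by (simp add: matrix_mul_assoc mmul_simps)
    moreover have "T ** (E z ** E' w) = E z ** (T ** E' w)"
      using E(4)[OF ST, of z] by (simp add: matrix_mul_assoc)
    ultimately have "(S + T) ** (E z ** E' w) = smul (z + w) (E z ** E' w)"
      using TE[OF zw(2)] by (simp add: mmul_simps smul_simps)
    then have "(S + T) *v ((E z ** E' w) *v v) = (z + w) *s ((E z ** E' w) *v v)"
      by (simp add: matrix_vector_mul_assoc smul_vec)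
    then show ?thesis by blast
  qed
  have "v \<in> vec.span ?V" for v
  proof -
    have "mat 1 = (\<Sum>z\<in>\<Lambda>. \<Sum>w\<in>\<Lambda>'. E z ** E' w)"
      unfolding mmul_sum[symmetric] E'(2) matrix_mul_rid E(2) ..
    then have "v = (\<Sum>z\<in>\<Lambda>. \<Sum>w\<in>\<Lambda>'. E z ** E' w) *v v" by (metis matrix_vector_mul_lid)
    also have "\<dots> = (\<Sum>z\<in>\<Lambda>. (\<Sum>w\<in>\<Lambda>'. E z ** E' w) *v v)"
      by (induction \<Lambda> rule: infinite_finite_induct) (auto simp: matrix_vector_mult_add_rdistrib)
    also have "\<dots> = (\<Sum>z\<in>\<Lambda>. \<Sum>w\<in>\<Lambda>'. (E z ** E' w) *v v)"
    proof (rule sum.cong[OF refl])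
      show "(\<Sum>w\<in>\<Lambda>'. E z ** E' w) *v v = (\<Sum>w\<in>\<Lambda>'. (E z ** E' w) *v v)" for z
        by (induction \<Lambda>' rule: infinite_finite_induct) (auto simp: matrix_vector_mult_add_rdistrib)
    qed
    finally have eq: "v = \<dots>" .
    show ?thesis by (subst eq) (intro vec.span_sum vec.span_base ev)
  qed
  then show ?thesis by (intro semisimple_if_eigenvectors_span) blast
qed

lemma semisimple_smul: "semisimple_mat S \<Longrightarrow> semisimple_mat (smul c S)"
  unfolding semisimple_iff by (auto simp: mmul_simps diagonal_def)

lemma semisimple_minus: "semisimple_mat S \<Longrightarrow> semisimple_mat (- S)"
  using semisimple_smul[of S "-1"] by (simp add: smul_simps)

lemma semisimple_diff:
  "semisimple_mat S \<Longrightarrow> semisimple_mat T \<Longrightarrow> S ** T = T ** S \<Longrightarrow> semisimple_mat (S - T)"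
  using semisimple_add[of S "- T"] semisimple_minus[of T] by (simp add: mmul_simps)

section \<open>The Jordan decomposition\<close>

text \<open>This avoids the binomial expansion: each application of \<open>A - B\<close> lowers one of the two
  exponents.\<close>

lemma funpow_commuting_diff:
  fixes A B :: "'a::ab_group_add \<Rightarrow> 'a"
  assumes A: "\<And>x y. A (x - y) = A x - A y" and B: "\<And>x y. B (x - y) = B x - B y"
    and AB: "\<And>x. A (B x) = B (A x)"
    and "(A ^^ a) x = 0" "(B ^^ b) x = 0"
  shows "((\<lambda>x. A x - B x) ^^ (a + b)) x = 0"
  using assms(4,5)
proof (induction "a + b" arbitrary: a b x)
  case 0
  then show ?case by simp
next
  case (Suc n)
  let ?D = "\<lambda>x. A x - B x"
  have D: "(?D ^^ k) (u - v) = (?D ^^ k) u - (?D ^^ k) v" for k u v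
    by (induction k) (auto simp: A B)
  have D0: "(?D ^^ k) 0 = 0" for k using D[of k 0 0] by simp
  have A0: "A 0 = 0" and B0: "B 0 = 0" using A[of 0 0] B[of 0 0] by auto
  have cA: "(B ^^ k) (A u) = A ((B ^^ k) u)" for k u by (induction k) (auto simp: AB)
  have cB: "(A ^^ k) (B u) = B ((A ^^ k) u)" for k u by (induction k) (auto simp: AB)
  show ?case
  proof (cases "a = 0 \<or> b = 0")
    case True
    then have "x = 0" using Suc.prems by auto
    then show ?thesis using D0 by simp
  next
    case False
    then obtain a' b' where ab: "a = Suc a'" "b = Suc b'" by (metis not0_implies_Suc)
    have n1: "n = a' + b" and n2: "n = a + b'" using Suc.hyps(2) ab by simp_all
    have 1: "(?D ^^ n) (A x) = 0" unfolding n1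
    proof (rule Suc.hyps(1)[OF n1])
      show "(A ^^ a') (A x) = 0" using Suc.prems(1) ab by (simp add: funpow_swap1)
      show "(B ^^ b) (A x) = 0" using Suc.prems(2) by (simp only: cA A0)
    qed
    have 2: "(?D ^^ n) (B x) = 0" unfolding n2
    proof (rule Suc.hyps(1)[OF n2])
      show "(B ^^ b') (B x) = 0" using Suc.prems(2) ab by (simp add: funpow_swap1)
      show "(A ^^ a) (B x) = 0" using Suc.prems(1) by (simp only: cB B0)
    qed
    have "(?D ^^ n) (A x - B x) = 0" unfolding D 1 2 by simp
    then show ?thesis by (simp only: Suc.hyps(2)[symmetric] funpow_Suc_right o_apply)
  qed
qed

abbreviation ad :: "'n::finite cmat \<Rightarrow> 'n cmat \<Rightarrow> 'n cmat" where
  "ad u \<equiv> (\<lambda>X. u ** X - X ** u)"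

lemma linear_ad: "linear (ad (u :: 'n::finite cmat))"
  by (rule linearI) (auto simp: mmul_simps scaleR_smul smul_simps)

lemma bounded_linear_ad: "bounded_linear (ad (u :: 'n::finite cmat))"
  using linear_ad linear_conv_bounded_linear by blast

lemma ad_nilpotent:
  fixes N :: "'n::finite cmat"
  assumes "mpow N k = 0" shows "(ad N ^^ (k + k)) X = 0"
proof (rule funpow_commuting_diff)
  show "(((**) N) ^^ k) X = 0" using assms by (simp add: funpow_mmul mmul_simps)
  have "((\<lambda>X. X ** N) ^^ j) X = X ** mpow N j" for j
    by (induction j) (auto simp: mpow_Suc2 matrix_mul_assoc)
  then show "((\<lambda>X. X ** N) ^^ k) X = 0" using assms by (simp add: mmul_simps)
qed (auto simp: mmul_simps matrix_mul_assoc)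

text \<open>The operator \<open>ad s\<close> is the difference of the commuting operators \<open>ad u\<close> and \<open>ad n\<close>. The
  second is nilpotent and the first is nilpotent on \<open>X\<close>, so a power of \<open>ad s\<close> kills \<open>X\<close>, and
  then already \<open>ad s\<close> does.\<close>

lemma jordan_ad:
  assumes J: "jordan_decomposition u s n" and X: "(ad u ^^ N) X = 0"
  shows "s ** X = X ** s"
proof -
  have J': "u = s + n" "semisimple_mat s" "nilpotent_mat n" "s ** n = n ** s"
    using J by (auto simp: jordan_decomposition_def)
  obtain k where "mpow n k = 0" using J'(3) by (auto simp: nilpotent_mat_mpow)
  from ad_nilpotent[OF this] have n0: "(ad n ^^ (k + k)) X = 0" .
  have comm: "ad u (ad n Y) = ad n (ad u Y)" for Y
  proof -
    have "u ** n = n ** u" by (simp add: J' mmul_simps)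
    then show ?thesis by (simp add: mmul_simps matrix_mul_assoc algebra_simps)
      (simp add: matrix_mul_assoc[symmetric])
  qed
  have D: "((\<lambda>Y. ad u Y - ad n Y) ^^ (N + (k + k))) X = 0"
    by (rule funpow_commuting_diff[OF _ _ comm X n0]) (simp_all add: mmul_simps)
  have eq: "(\<lambda>Y. ad u Y - ad n Y) = ad s" by (rule ext) (simp add: J' mmul_simps)
  show ?thesis by (rule semisimple_kernel(2)[OF J'(2) D[unfolded eq]])
qed

lemma jordan_commute:
  assumes J: "jordan_decomposition u s n" and X: "u ** X = X ** u"
  shows "s ** X = X ** s" "n ** X = X ** n"
proof -
  show s: "s ** X = X ** s" by (rule jordan_ad[OF J, of 1]) (simp add: X)
  have "n = u - s" using J by (simp add: jordan_decomposition_def)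
  then show "n ** X = X ** n" using X s by (simp add: mmul_simps)
qed

text \<open>The difference of the semisimple parts is semisimple and, as the difference of the
  nilpotent parts up to sign, also nilpotent.\<close>

lemma jordan_unique:
  fixes u :: "'n::finite cmat"
  assumes J: "jordan_decomposition u s n" and J': "jordan_decomposition u s' n'"
  shows "s = s'" "n = n'"
proof -
  have D: "u = s + n" "semisimple_mat s" "nilpotent_mat n" "s ** n = n ** s"
    using J by (auto simp: jordan_decomposition_def)
  have D': "u = s' + n'" "semisimple_mat s'" "nilpotent_mat n'" "s' ** n' = n' ** s'"
    using J' by (auto simp: jordan_decomposition_def)
  have us: "u ** s' = s' ** u" unfolding D'(1) by (simp add: mmul_simps D'(4))
  have un: "u ** n' = n' ** u" unfolding D'(1) by (simp add: mmul_simps D'(4))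
  have ss: "semisimple_mat (s - s')" by (rule semisimple_diff[OF D(2) D'(2) jordan_commute(1)[OF J us]])
  obtain k k' where k: "mpow n k = 0" "mpow n' k' = 0" using D(3) D'(3) by (auto simp: nilpotent_mat_mpow)
  have nn: "((\<lambda>X. n' ** X - n ** X) ^^ (k' + k)) (mat 1) = 0"
    by (rule funpow_commuting_diff)
      (use k jordan_commute(2)[OF J un] in \<open>simp_all add: mmul_simps matrix_mul_assoc funpow_mmul\<close>)
  have eq: "n' - n = s - s'" using D(1) D'(1) by (simp add: algebra_simps)
  have "(\<lambda>X :: 'n cmat. n' ** X - n ** X) = (**) (s - s')" by (rule ext) (simp only: eq[symmetric] mmul_simps)
  then have "mpow (s - s') (k' + k) = 0" using nn by (simp add: mpow_def)
  then have "(s - s') ** mat 1 = smul 0 (mat 1)"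
    by (intro semisimple_kernel(1)[OF ss, of 0 "k' + k"]) (simp add: smul_simps)
  then show "s = s'" by (simp add: smul_simps)
  then show "n = n'" using eq by simp
qed

text \<open>The semisimple part multiplies the image of the spectral projection \<open>E z\<close> by \<open>z\<close>.\<close>

lemma jordan_exists:
  fixes u :: "'n::finite cmat"
  shows "\<exists>s n. jordan_decomposition u s n"
proof -
  obtain \<Lambda> E m where fin: "finite \<Lambda>" and E1: "(\<Sum>z\<in>\<Lambda>. E z) = mat 1"
    and Em: "\<And>z. z \<in> \<Lambda> \<Longrightarrow> mpow (u - smul z (mat 1)) m ** E z = 0"
    and EE: "\<And>z w. z \<in> \<Lambda> \<Longrightarrow> w \<in> \<Lambda> \<Longrightarrow> z \<noteq> w \<Longrightarrow> E z ** E w = 0"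
    and EX: "\<And>z X. u ** X = X ** u \<Longrightarrow> E z ** X = X ** E z"
    by (rule spectral_projections[of u]) blast
  define s where "s = (\<Sum>z\<in>\<Lambda>. smul z (E z))"
  define n where "n = u - s"
  have idem: "E z ** E z = E z" if z: "z \<in> \<Lambda>" for z
  proof -
    have "E z = (\<Sum>w\<in>\<Lambda>. E w) ** E z" by (simp add: E1)
    also have "\<dots> = (\<Sum>w\<in>{z}. E w ** E z)" unfolding mmul_sum
      by (rule sum.mono_neutral_right) (use z fin EE in auto)
    finally show ?thesis by simp
  qed
  have sE: "s ** E z = smul z (E z)" if z: "z \<in> \<Lambda>" for z
  proof -
    have "s ** E z = (\<Sum>w\<in>\<Lambda>. smul w (E w ** E z))" by (simp add: s_def mmul_sum mmul_simps)
    also have "\<dots> = (\<Sum>w\<in>{z}. smul w (E w ** E z))"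
      by (rule sum.mono_neutral_right) (use z fin EE in \<open>auto simp: smul_simps\<close>)
    finally show ?thesis using idem[OF z] by simp
  qed
  have sX: "s ** X = X ** s" if "u ** X = X ** u" for X
    using EX[OF that] by (simp add: s_def mmul_sum mmul_simps)
  have su: "u ** s = s ** u" using sX[of u] by simp
  have sn: "s ** n = n ** s" by (simp add: n_def mmul_simps su)
  have "semisimple_mat s"
  proof (rule semisimple_if_eigenvectors_span)
    have "v \<in> vec.span {v. \<exists>z. s *v v = z *s v}" for v
    proof -
      have "v = (\<Sum>z\<in>\<Lambda>. E z) *v v" by (simp add: E1)
      also have "\<dots> = (\<Sum>z\<in>\<Lambda>. E z *v v)"
        by (induction \<Lambda> rule: infinite_finite_induct) (auto simp: matrix_vector_mult_add_rdistrib)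
      finally have eq: "v = \<dots>" .
      have "s *v (E z *v v) = z *s (E z *v v)" if "z \<in> \<Lambda>" for z
        using sE[OF that] by (simp add: matrix_vector_mul_assoc smul_vec)
      then show ?thesis by (subst eq) (intro vec.span_sum vec.span_base, blast)
    qed
    then show "vec.span {v. \<exists>z. s *v v = z *s v} = UNIV" by blast
  qed
  moreover have "nilpotent_mat n"
  proof -
    have nE: "mpow n k ** E z = mpow (u - smul z (mat 1)) k ** E z" if z: "z \<in> \<Lambda>" for k z
    proof (induction k)
      case (Suc k)
      let ?w = "u - smul z (mat 1)"
      have un: "u ** n = n ** u" by (simp add: n_def mmul_simps su)
      have wn: "?w ** n = n ** ?w" by (simp add: mmul_simps un)
      have nEz: "n ** E z = ?w ** E z" by (simp add: n_def mmul_simps sE[OF z])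
      have "mpow n (Suc k) ** E z = n ** (mpow ?w k ** E z)"
        using Suc by (simp add: mpow_Suc matrix_mul_assoc[symmetric])
      also have "\<dots> = mpow ?w k ** (n ** E z)"
        using mpow_commute[OF wn, of k] by (simp add: matrix_mul_assoc)
      also have "\<dots> = mpow ?w (Suc k) ** E z" by (simp add: nEz mpow_Suc2 matrix_mul_assoc)
      finally show ?case .
    qed simp
    have "mpow n m = (\<Sum>z\<in>\<Lambda>. mpow n m ** E z)" by (simp add: E1 flip: mmul_sum)
    also have "\<dots> = 0" by (rule sum.neutral) (simp add: nE Em)
    finally show ?thesis by (auto simp: nilpotent_mat_mpow)
  qed
  ultimately have "jordan_decomposition u s n" using sn by (simp add: jordan_decomposition_def n_def)
  then show ?thesis by blast
qed

section \<open>The matrix exponential\<close>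

text \<open>A complex time parameter makes polynomial functions along one-parameter groups entire
  functions.\<close>

definition mexp :: "'n::finite cmat \<Rightarrow> complex \<Rightarrow> 'n cmat" where
  "mexp X t = (\<chi> i j. \<Sum>k. (mpow X k $ i $ j / fact k) * t ^ k)"

definition entry_sum :: "'n::finite cmat \<Rightarrow> real" where
  "entry_sum X = (\<Sum>i\<in>UNIV. \<Sum>j\<in>UNIV. cmod (X $ i $ j))"

lemma entry_sum_nonneg: "entry_sum X \<ge> 0"
  by (simp add: entry_sum_def sum_nonneg)

lemma mpow_entry_bound:
  fixes X :: "'n::finite cmat"
  shows "cmod (mpow X k $ i $ j) \<le> entry_sum X ^ k"
proof (induction k arbitrary: i j)
  case 0
  then show ?case by (simp add: mat_def)
next
  case (Suc k)
  have "cmod (mpow X (Suc k) $ i $ j) \<le> (\<Sum>l\<in>UNIV. cmod (X $ i $ l) * cmod (mpow X k $ l $ j))"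
    unfolding mpow_Suc mmul_nth by (rule order.trans[OF norm_sum]) (simp add: norm_mult)
  also have "\<dots> \<le> (\<Sum>l\<in>UNIV. cmod (X $ i $ l) * entry_sum X ^ k)"
    by (intro sum_mono mult_left_mono Suc) auto
  also have "\<dots> = (\<Sum>l\<in>UNIV. cmod (X $ i $ l)) * entry_sum X ^ k" by (simp add: sum_distrib_right)
  also have "\<dots> \<le> entry_sum X * entry_sum X ^ k"
  proof (rule mult_right_mono)
    show "(\<Sum>l\<in>UNIV. cmod (X $ i $ l)) \<le> entry_sum X" unfolding entry_sum_def
      by (rule member_le_sum[of i UNIV "\<lambda>i. \<Sum>j\<in>UNIV. cmod (X $ i $ j)"]) (auto intro: sum_nonneg)
  qed (simp add: entry_sum_nonneg)
  finally show ?case by simp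
qed

lemma mexp_term_bound:
  "norm ((mpow X k $ i $ j / fact k) * t ^ k) \<le> (entry_sum X * cmod t) ^ k /\<^sub>R fact k"
proof -
  have "norm ((mpow X k $ i $ j / fact k) * t ^ k) = cmod (mpow X k $ i $ j) * cmod t ^ k / fact k"
    by (simp add: norm_mult norm_divide norm_power)
  also have "\<dots> \<le> entry_sum X ^ k * cmod t ^ k / fact k"
    by (intro divide_right_mono mult_right_mono mpow_entry_bound) auto
  finally show ?thesis by (simp add: power_mult_distrib divide_inverse mult.commute)
qed

lemma mexp_summable:
  fixes X :: "'n::finite cmat"
  shows "summable (\<lambda>k. (mpow X k $ i $ j / fact k) * t ^ k)"
  by (rule summable_comparison_test'[OF summable_exp_generic mexp_term_bound])

definition entrywise_deriv :: "(complex \<Rightarrow> 'n::finite cmat) \<Rightarrow> 'n cmat \<Rightarrow> complex \<Rightarrow> bool" where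
  "entrywise_deriv Y Y' t \<longleftrightarrow> (\<forall>i j. ((\<lambda>t. Y t $ i $ j) has_field_derivative Y' $ i $ j) (at t))"

lemma mexp_deriv: "entrywise_deriv (mexp X) (X ** mexp X t) t"
  unfolding entrywise_deriv_def
proof (intro allI)
  fix i j
  let ?c = "\<lambda>i j k. mpow X k $ i $ j / fact k"
  have "((\<lambda>t. \<Sum>k. ?c i j k * t ^ k) has_field_derivative (\<Sum>k. diffs (?c i j) k * t ^ k)) (at t)"
    by (rule termdiffs_strong_converges_everywhere) (rule mexp_summable)
  moreover have "(\<Sum>k. diffs (?c i j) k * t ^ k) = (X ** mexp X t) $ i $ j"
  proof -
    have "diffs (?c i j) k * t ^ k = (\<Sum>l\<in>UNIV. X $ i $ l * (?c l j k * t ^ k))" for k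
    proof -
      have "diffs (?c i j) k = mpow X (Suc k) $ i $ j / fact k"
        by (simp add: diffs_def fact_Suc divide_simps del: of_nat_Suc)
      then show ?thesis unfolding mpow_Suc mmul_nth sum_divide_distrib
        by (simp only: sum_distrib_right) (intro sum.cong refl, simp)
    qed
    then have "(\<Sum>k. diffs (?c i j) k * t ^ k) = (\<Sum>k. \<Sum>l\<in>UNIV. X $ i $ l * (?c l j k * t ^ k))" by simp
    also have "\<dots> = (\<Sum>l\<in>UNIV. \<Sum>k. X $ i $ l * (?c l j k * t ^ k))"
      by (rule suminf_sum) (intro summable_mult mexp_summable)
    also have "\<dots> = (\<Sum>l\<in>UNIV. X $ i $ l * (\<Sum>k. ?c l j k * t ^ k))"
      by (intro sum.cong refl suminf_mult mexp_summable)
    finally show ?thesis by (simp add: mmul_nth mexp_def)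
  qed
  ultimately show "((\<lambda>t. mexp X t $ i $ j) has_field_derivative (X ** mexp X t) $ i $ j) (at t)"
    by (simp add: mexp_def)
qed

lemma mexp_0 [simp]: "mexp X 0 = mat 1"
proof (rule mat_eqI)
  fix i j
  have "(\<Sum>k. (mpow X k $ i $ j / fact k) * 0 ^ k) = mpow X 0 $ i $ j / fact 0"
    using suminf_finite[of "{0}" "\<lambda>k. (mpow X k $ i $ j / fact k) * 0 ^ k"] by simp
  then show "mexp X 0 $ i $ j = mat 1 $ i $ j" by (simp add: mexp_def)
qed

lemma mexp_commute:
  assumes "X ** Z = Z ** X" shows "mexp X t ** Z = Z ** mexp X t"
proof (rule mat_eqI)
  fix i j
  let ?c = "\<lambda>i j k. mpow X k $ i $ j / fact k * t ^ k"
  have "(mexp X t ** Z) $ i $ j = (\<Sum>l\<in>UNIV. (\<Sum>k. ?c i l k * Z $ l $ j))"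
    by (simp only: mmul_nth mexp_def vec_lambda_beta suminf_mult2[OF mexp_summable])
  also have "\<dots> = (\<Sum>k. \<Sum>l\<in>UNIV. ?c i l k * Z $ l $ j)"
    by (rule suminf_sum[symmetric]) (intro summable_mult2 mexp_summable)
  also have "\<dots> = (\<Sum>k. \<Sum>l\<in>UNIV. Z $ i $ l * ?c l j k)"
  proof (rule suminf_cong)
    fix k
    have "(mpow X k ** Z) $ i $ j = (Z ** mpow X k) $ i $ j" using mpow_commute[OF assms] by simp
    then have 1: "(\<Sum>l\<in>UNIV. mpow X k $ i $ l * Z $ l $ j) = (\<Sum>l\<in>UNIV. Z $ i $ l * mpow X k $ l $ j)"
      by (simp add: mmul_nth)
    have "(\<Sum>l\<in>UNIV. ?c i l k * Z $ l $ j) = (t ^ k / fact k) * (\<Sum>l\<in>UNIV. mpow X k $ i $ l * Z $ l $ j)"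
      unfolding sum_distrib_left by (intro sum.cong refl) simp
    also have "\<dots> = (\<Sum>l\<in>UNIV. Z $ i $ l * ?c l j k)"
      unfolding 1 sum_distrib_left by (intro sum.cong refl) simp
    finally show "(\<Sum>l\<in>UNIV. ?c i l k * Z $ l $ j) = (\<Sum>l\<in>UNIV. Z $ i $ l * ?c l j k)" .
  qed
  also have "\<dots> = (\<Sum>l\<in>UNIV. (\<Sum>k. Z $ i $ l * ?c l j k))"
    by (rule suminf_sum) (intro summable_mult mexp_summable)
  also have "\<dots> = (Z ** mexp X t) $ i $ j"
    by (simp only: mmul_nth mexp_def vec_lambda_beta suminf_mult[OF mexp_summable])
  finally show "(mexp X t ** Z) $ i $ j = (Z ** mexp X t) $ i $ j" .
qed

lemma entrywise_deriv_mult: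
  assumes "entrywise_deriv A A' t" "entrywise_deriv B B' t"
  shows "entrywise_deriv (\<lambda>t. A t ** B t) (A' ** B t + A t ** B') t"
  unfolding entrywise_deriv_def
proof (intro allI)
  fix i j
  have "((\<lambda>t. \<Sum>k\<in>UNIV. A t $ i $ k * B t $ k $ j) has_field_derivative
     (\<Sum>k\<in>UNIV. A' $ i $ k * B t $ k $ j + B' $ k $ j * A t $ i $ k)) (at t)"
    by (intro DERIV_sum DERIV_mult) (use assms in \<open>auto simp: entrywise_deriv_def\<close>)
  then show "((\<lambda>t. (A t ** B t) $ i $ j) has_field_derivative (A' ** B t + A t ** B') $ i $ j) (at t)"
    by (simp add: mmul_nth sum.distrib mult.commute)
qed

lemma entrywise_deriv_zero:
  assumes "\<And>t. entrywise_deriv Y 0 t" shows "Y t = Y 0"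
proof (rule mat_eqI)
  fix i j
  have "\<exists>c. \<forall>t\<in>UNIV. Y t $ i $ j = c"
    by (rule has_field_derivative_zero_constant) (use assms in \<open>auto simp: entrywise_deriv_def\<close>)
  then show "Y t $ i $ j = Y 0 $ i $ j" by auto
qed

lemma mexp_minus_deriv: "entrywise_deriv (\<lambda>t. mexp X (- t)) (- (X ** mexp X (- t))) t"
  unfolding entrywise_deriv_def
proof (intro allI)
  fix i j
  have "((\<lambda>t. mexp X t $ i $ j) has_field_derivative (X ** mexp X (- t)) $ i $ j) (at (- t))"
    using mexp_deriv[of X "- t"] by (simp add: entrywise_deriv_def)
  from DERIV_chain2[where f = "\<lambda>t. mexp X t $ i $ j" and g = uminus, OF this DERIV_minus[OF DERIV_ident]]
  show "((\<lambda>t. mexp X (- t) $ i $ j) has_field_derivative (- (X ** mexp X (- t))) $ i $ j) (at t)"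
    by simp
qed

lemma mexp_inverse: "mexp X t ** mexp X (- t) = mat 1"
proof -
  have "entrywise_deriv (\<lambda>t. mexp X t ** mexp X (- t)) 0 t" for t
    using entrywise_deriv_mult[OF mexp_deriv[of X t] mexp_minus_deriv[of X t]]
      mexp_commute[of X X t] by (simp add: mmul_simps matrix_mul_assoc)
  from entrywise_deriv_zero[OF this] show ?thesis by simp
qed

lemma mexp_invertible: "invertible (mexp X t)" "matrix_inv (mexp X t) = mexp X (- t)"
  using minvI[OF mexp_inverse] by auto

lemma bounded_bilinear_mmul: "bounded_bilinear ((**) :: 'n::finite cmat \<Rightarrow> 'n cmat \<Rightarrow> 'n cmat)"
  unfolding bilinear_conv_bounded_bilinear[symmetric] bilinear_def
  by (auto intro!: linearI simp: mmul_simps scaleR_smul)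

lemma has_vector_derivative_entries:
  fixes Y :: "real \<Rightarrow> 'n::finite cmat"
  assumes "\<And>i j. ((\<lambda>s. Y s $ i $ j) has_vector_derivative Y' $ i $ j) (at s)"
  shows "(Y has_vector_derivative Y') (at s)"
proof -
  have "((\<lambda>s. Y s \<bullet> b) has_derivative (\<lambda>h. (h *\<^sub>R Y') \<bullet> b)) (at s)" if bB: "b \<in> Basis" for b
  proof -
    obtain i j c where b: "b = axis i (axis j c)" using bB unfolding Basis_vec_def by blast
    have "((\<lambda>s. Y s $ i $ j) has_derivative (\<lambda>h. h *\<^sub>R Y' $ i $ j)) (at s)"
      using assms[of i j] by (simp add: has_vector_derivative_def)
    from has_derivative_inner_left[OF this, of c] show ?thesis by (simp add: b inner_axis)
  qed
  then show ?thesis unfolding has_vector_derivative_def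
    by (subst has_derivative_componentwise_within) auto
qed

lemma mexp_vector_derivative:
  "((\<lambda>s. mexp X (of_real s)) has_vector_derivative X ** mexp X (of_real s)) (at s)"
  by (rule has_vector_derivative_entries, rule has_vector_derivative_real_field)
    (use mexp_deriv[of X "of_real s"] in \<open>simp add: entrywise_deriv_def\<close>)

lemma continuous_mexp_real: "continuous_on UNIV (\<lambda>s. mexp X (of_real s))"
  by (intro continuous_at_imp_continuous_on ballI has_vector_derivative_continuous[OF mexp_vector_derivative])

text \<open>The product of \<open>Y s\<close> with the exponential of \<open>- s X\<close> has derivative zero.\<close>

lemma mexp_ode_unique:
  fixes Y :: "real \<Rightarrow> 'n::finite cmat"
  assumes "\<And>s. (Y has_vector_derivative Y s ** X) (at s)"
  shows "Y s = Y 0 ** mexp X (of_real s)"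
proof -
  have m: "((\<lambda>s. mexp X (- of_real s)) has_vector_derivative - (X ** mexp X (- of_real s))) (at s)" for s
    by (rule has_vector_derivative_entries, rule has_vector_derivative_real_field[where f = "\<lambda>t. mexp X (- t) $ i $ j" for i j])
      (use mexp_minus_deriv[of X "of_real s"] in \<open>simp add: entrywise_deriv_def\<close>)
  have "((\<lambda>s. Y s ** mexp X (- of_real s)) has_vector_derivative 0) (at s)" for s
    using bounded_bilinear.has_vector_derivative[OF bounded_bilinear_mmul assms m, of s]
    by (simp add: mmul_simps matrix_mul_assoc)
  then have "\<exists>c. \<forall>s\<in>UNIV. Y s ** mexp X (- of_real s) = c"
    by (intro has_derivative_zero_constant) (auto simp: has_vector_derivative_def)
  then have "Y s ** mexp X (- of_real s) = Y 0 ** mexp X (- of_real 0)" by (metis UNIV_I)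
  then have "Y s ** mexp X (- of_real s) = Y 0" by simp
  then have "Y s ** (mexp X (- of_real s) ** mexp X (of_real s)) = Y 0 ** mexp X (of_real s)"
    by (simp add: matrix_mul_assoc)
  then show ?thesis using mexp_inverse[of X "- of_real s"] by simp
qed

lemma mexp_smul: "mexp (smul c X) t = mexp X (c * t)"
proof -
  have "mpow (smul c X) k = smul (c ^ k) (mpow X k)" for k
    by (induction k) (auto simp: mpow_Suc mmul_simps smul_simps mult.commute)
  then show ?thesis by (simp add: mexp_def power_mult_distrib mult_ac)
qed

section \<open>Algebraic groups and their Lie algebras\<close>

lemma group_GL: "group (GL :: 'n::finite cmat monoid)"
proof (rule groupI)
  fix x y z :: "'n cmat"
  assume "x \<in> carrier GL" "y \<in> carrier GL"
  then show "x \<otimes>\<^bsub>GL\<^esub> y \<in> carrier GL" by (simp add: GL_def invertible_mult)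
next
  fix x :: "'n cmat" assume "x \<in> carrier GL"
  then have x: "invertible x" by (simp add: GL_def)
  have "matrix_inv x \<in> carrier GL" using minvI(1)[OF minv(2)[OF x]] by (simp add: GL_def)
  then show "\<exists>y\<in>carrier GL. y \<otimes>\<^bsub>GL\<^esub> x = \<one>\<^bsub>GL\<^esub>" using minv[OF x] by (auto simp: GL_def)
next
  show "\<one>\<^bsub>GL\<^esub> \<in> carrier (GL :: 'n cmat monoid)" using minvI(1)[of "mat 1" "mat 1"] by (simp add: GL_def)
qed (simp_all add: GL_def matrix_mul_assoc)

lemma algebraic_groupD:
  fixes G :: "'n::finite cmat set"
  assumes "algebraic_group G"
  shows "mat 1 \<in> G" "a \<in> G \<Longrightarrow> b \<in> G \<Longrightarrow> a ** b \<in> G" "a \<in> G \<Longrightarrow> matrix_inv a \<in> G" "a \<in> G \<Longrightarrow> invertible a"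
    "\<exists>S\<subseteq>poly_fun. G = {A. invertible A \<and> (\<forall>f\<in>S. f A = 0)}"
proof -
  have sub: "subgroup G GL" and cl: "closedin (subtopology zariski (carrier GL)) G"
    using assms by (auto simp: algebraic_group_def)
  show "mat 1 \<in> G" using subgroup.one_closed[OF sub] by (simp add: GL_def)
  show "a ** b \<in> G" if "a \<in> G" "b \<in> G" using subgroup.m_closed[OF sub that] by (simp add: GL_def)
  show inv: "invertible a" if "a \<in> G" for a using subgroup.subset[OF sub] that by (auto simp: GL_def)
  show "matrix_inv a \<in> G" if a: "a \<in> G"
  proof -
    have ia: "a \<in> carrier GL" "matrix_inv a \<in> carrier GL"
      using inv[OF a] minvI(1)[OF minv(2)[OF inv[OF a]]] by (auto simp: GL_def)
    have "inv\<^bsub>GL\<^esub> a = matrix_inv a"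
      by (rule group.inv_equality[OF group_GL _ ia]) (use minv[OF inv[OF a]] in \<open>simp add: GL_def\<close>)
    then show ?thesis using subgroup.m_inv_closed[OF sub a] by simp
  qed
  obtain C where C: "closedin zariski C" "G = C \<inter> carrier GL" using cl unfolding closedin_subtopology by blast
  obtain S where "S \<subseteq> poly_fun" "C = {A. \<forall>f\<in>S. f A = 0}" using C(1) unfolding closedin_zariski by blast
  then show "\<exists>S\<subseteq>poly_fun. G = {A. invertible A \<and> (\<forall>f\<in>S. f A = 0)}"
    using C(2) by (intro exI[of _ S]) (auto simp: GL_def)
qed

lemma poly_fun_compose:
  fixes F :: "'m::finite cmat \<Rightarrow> 'n::finite cmat"
  assumes "f \<in> poly_fun" "\<And>i j. (\<lambda>A. F A $ i $ j) \<in> poly_fun"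
  shows "(\<lambda>A. f (F A)) \<in> poly_fun"
  using assms(1) by (induction rule: poly_fun.induct) (auto intro: poly_fun.intros assms(2))

lemma poly_fun_conjugation: "f \<in> poly_fun \<Longrightarrow> (\<lambda>A. f (C ** A ** D)) \<in> poly_fun"
  by (erule poly_fun_compose) (auto simp: mmul_nth intro!: poly_fun_sum poly_fun.intros)

lemma poly_fun_derivative_complex_linear:
  assumes "f \<in> poly_fun"
  shows "frechet_derivative f (at A) (smul c X) = c * frechet_derivative f (at A) X"
proof -
  have "\<exists>D. (f has_derivative D) (at A) \<and> (\<forall>c X. D (smul c X) = c * D X)"
    using assms
  proof (induction rule: poly_fun.induct)
    case (const c)
    show ?case by (rule exI[of _ "\<lambda>_. 0"]) simp
  next
    case (coord i j)
    have "bounded_linear (\<lambda>A::'a cmat. A $ i $ j)"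
      using bounded_linear_compose[OF bounded_linear_vec_nth bounded_linear_vec_nth] by blast
    then show ?case
      by (intro exI[of _ "\<lambda>X. X $ i $ j"]) (simp add: bounded_linear_imp_has_derivative)
  next
    case (add f g)
    then obtain D E where "(f has_derivative D) (at A)" "\<forall>c X. D (smul c X) = c * D X"
      "(g has_derivative E) (at A)" "\<forall>c X. E (smul c X) = c * E X" by blast
    then show ?case
      by (intro exI[of _ "\<lambda>X. D X + E X"] conjI has_derivative_add) (auto simp: algebra_simps)
  next
    case (mult f g)
    then obtain D E where "(f has_derivative D) (at A)" "\<forall>c X. D (smul c X) = c * D X"
      "(g has_derivative E) (at A)" "\<forall>c X. E (smul c X) = c * E X" by blast
    then show ?case
      by (intro exI[of _ "\<lambda>X. f A * E X + D X * g A"] conjI has_derivative_mult) (auto simp: algebra_simps)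
  qed
  then obtain D where D: "(f has_derivative D) (at A)" "\<forall>c X. D (smul c X) = c * D X" by blast
  from frechet_derivative_at[OF D(1)] D(2) show ?thesis by metis
qed

lemma poly_fun_has_derivative:
  "f \<in> poly_fun \<Longrightarrow> (f has_derivative frechet_derivative f (at A)) (at A)"
  using poly_fun_differentiable frechet_derivative_works by blast

lemma poly_fun_derivative_linear:
  "f \<in> poly_fun \<Longrightarrow> linear (frechet_derivative f (at A))"
  using has_derivative_linear[OF poly_fun_has_derivative] .

lemma lie_algebra_subspace:
  "subspace (lie_algebra G)" "X \<in> lie_algebra G \<Longrightarrow> smul c X \<in> lie_algebra G"
proof -
  show "subspace (lie_algebra G)" unfolding subspace_def lie_algebra_def
    by (auto simp: linear_0[OF poly_fun_derivative_linear] linear_add[OF poly_fun_derivative_linear]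
      linear_cmul[OF poly_fun_derivative_linear])
  show "smul c X \<in> lie_algebra G" if "X \<in> lie_algebra G"
    using that by (simp add: lie_algebra_def poly_fun_derivative_complex_linear)
qed

lemma lie_algebraD:
  "X \<in> lie_algebra G \<Longrightarrow> f \<in> poly_fun \<Longrightarrow> (\<And>A. A \<in> G \<Longrightarrow> f A = 0) \<Longrightarrow>
     frechet_derivative f (at (mat 1)) X = 0"
  by (simp add: lie_algebra_def)

lemma adjoint_lie_algebra:
  fixes G :: "'n::finite cmat set"
  assumes G: "algebraic_group G" and g: "g \<in> G" and X: "X \<in> lie_algebra G"
  shows "adjoint g X \<in> lie_algebra G"
  unfolding lie_algebra_def
proof (intro CollectI ballI impI)
  fix f :: "'n cmat \<Rightarrow> complex" assume f: "f \<in> poly_fun" "\<forall>A\<in>G. f A = 0"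
  let ?c = "\<lambda>A. g ** A ** matrix_inv g"
  note D = algebraic_groupD[OF G]
  have c1: "?c (mat 1) = mat 1" using minv[OF D(4)[OF g]] by simp
  have fc: "(\<lambda>A. f (?c A)) \<in> poly_fun" by (rule poly_fun_conjugation[OF f(1)])
  have 0: "frechet_derivative (\<lambda>A. f (?c A)) (at (mat 1)) X = 0"
    by (rule lie_algebraD[OF X fc]) (use f(2) D(2,3) g in auto)
  have "bounded_linear ?c"
    using bounded_linear_compose[OF bounded_bilinear.bounded_linear_left[OF bounded_bilinear_mmul]
      bounded_bilinear.bounded_linear_right[OF bounded_bilinear_mmul]] .
  then have "(?c has_derivative ?c) (at (mat 1))" by (rule bounded_linear_imp_has_derivative)
  from has_derivative_compose[OF this, of f "frechet_derivative f (at (mat 1))"]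
  have "((\<lambda>A. f (?c A)) has_derivative (\<lambda>A. frechet_derivative f (at (mat 1)) (?c A))) (at (mat 1))"
    using poly_fun_has_derivative[OF f(1), of "mat 1"] c1 by simp
  from frechet_derivative_at[OF this] 0
  show "frechet_derivative f (at (mat 1)) (adjoint g X) = 0" by (metis adjoint_def)
qed

text \<open>Right translation along the one-parameter group of \<open>X\<close> differentiates polynomial
  functions to polynomial functions; \<open>f'\<close> is the image of \<open>f\<close> under the left-invariant
  derivation given by \<open>X\<close>.\<close>

lemma invariant_derivation:
  fixes X :: "'n::finite cmat"
  assumes "f \<in> poly_fun"
  shows "\<exists>f'\<in>poly_fun. (\<forall>A. f' A = frechet_derivative f (at A) (A ** X)) \<and>
    (\<forall>t. ((\<lambda>t. f (mexp X t)) has_field_derivative f' (mexp X t)) (at t))"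
  using assms
proof (induction rule: poly_fun.induct)
  case (const c)
  show ?case by (rule bexI[of _ "\<lambda>_. 0"]) (auto intro: poly_fun.const)
next
  case (coord i j)
  have "bounded_linear (\<lambda>A::'n cmat. A $ i $ j)"
    using bounded_linear_compose[OF bounded_linear_vec_nth bounded_linear_vec_nth] by blast
  then have "((\<lambda>A::'n cmat. A $ i $ j) has_derivative (\<lambda>A. A $ i $ j)) (at A)" for A
    by (rule bounded_linear_imp_has_derivative)
  then have "frechet_derivative (\<lambda>A::'n cmat. A $ i $ j) (at A) = (\<lambda>A. A $ i $ j)" for A
    using frechet_derivative_at by metis
  moreover have "(\<lambda>A. (A ** X) $ i $ j) \<in> poly_fun"
    by (auto simp: mmul_nth intro!: poly_fun_sum poly_fun.intros)
  moreover have "((\<lambda>t. mexp X t $ i $ j) has_field_derivative (mexp X t ** X) $ i $ j) (at t)" for t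
    using mexp_deriv[of X t] mexp_commute[of X X t] by (simp add: entrywise_deriv_def)
  ultimately show ?case by (intro bexI[of _ "\<lambda>A. (A ** X) $ i $ j"]) auto
next
  case (add f g)
  then obtain f' g' where *: "f' \<in> poly_fun" "g' \<in> poly_fun"
    "\<And>A. f' A = frechet_derivative f (at A) (A ** X)" "\<And>A. g' A = frechet_derivative g (at A) (A ** X)"
    "\<And>t. ((\<lambda>t. f (mexp X t)) has_field_derivative f' (mexp X t)) (at t)"
    "\<And>t. ((\<lambda>t. g (mexp X t)) has_field_derivative g' (mexp X t)) (at t)" by blast
  have "frechet_derivative (\<lambda>A. f A + g A) (at A) (A ** X) = f' A + g' A" for A
  proof -
    have "frechet_derivative (\<lambda>A. f A + g A) (at A) (A ** X)
        = frechet_derivative f (at A) (A ** X) + frechet_derivative g (at A) (A ** X)"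
      using fun_cong[OF frechet_derivative_at[OF has_derivative_add[OF poly_fun_has_derivative[OF add(1)]
        poly_fun_has_derivative[OF add(2)], of A]], of "A ** X"] by simp
    then show ?thesis by (simp only: *(3,4))
  qed
  then show ?case using *(1,2,5,6)
    by (intro bexI[of _ "\<lambda>A. f' A + g' A"] conjI allI) (auto intro: poly_fun.add DERIV_add)
next
  case (mult f g)
  then obtain f' g' where *: "f' \<in> poly_fun" "g' \<in> poly_fun"
    "\<And>A. f' A = frechet_derivative f (at A) (A ** X)" "\<And>A. g' A = frechet_derivative g (at A) (A ** X)"
    "\<And>t. ((\<lambda>t. f (mexp X t)) has_field_derivative f' (mexp X t)) (at t)"
    "\<And>t. ((\<lambda>t. g (mexp X t)) has_field_derivative g' (mexp X t)) (at t)" by blast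
  have "frechet_derivative (\<lambda>A. f A * g A) (at A) (A ** X) = f' A * g A + g' A * f A" for A
  proof -
    have "frechet_derivative (\<lambda>A. f A * g A) (at A) (A ** X)
        = f A * frechet_derivative g (at A) (A ** X) + frechet_derivative f (at A) (A ** X) * g A"
      using fun_cong[OF frechet_derivative_at[OF has_derivative_mult[OF poly_fun_has_derivative[OF mult(1)]
        poly_fun_has_derivative[OF mult(2)], of A]], of "A ** X"] by simp
    then show ?thesis by (simp add: *(3,4))
  qed
  then show ?case using *(1,2,5,6) mult(1,2)
    by (intro bexI[of _ "\<lambda>A. f' A * g A + g' A * f A"] conjI allI)
      (auto intro: poly_fun.intros DERIV_mult)
qed

text \<open>The polynomial functions vanishing on the group are stable under the left-invariant
  derivation given by \<open>X\<close>. So if \<open>f\<close> is one of them, all derivatives of the entire function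
  \<open>f(exp(t X))\<close> vanish at \<open>t = 0\<close>.\<close>

lemma mexp_in_group:
  fixes G :: "'n::finite cmat set"
  assumes G: "algebraic_group G" and X: "X \<in> lie_algebra G"
  shows "mexp X t \<in> G"
proof -
  note D = algebraic_groupD[OF G]
  define van where "van = {f \<in> poly_fun. \<forall>A\<in>G. f A = 0}"
  have step: "\<exists>f'\<in>van. \<forall>t. ((\<lambda>t. f (mexp X t)) has_field_derivative f' (mexp X t)) (at t)" if f: "f \<in> van" for f
  proof -
    have fp: "f \<in> poly_fun" "\<And>A. A \<in> G \<Longrightarrow> f A = 0" using f by (auto simp: van_def)
    obtain f' where f': "f' \<in> poly_fun" "\<And>A. f' A = frechet_derivative f (at A) (A ** X)"
      "\<And>t. ((\<lambda>t. f (mexp X t)) has_field_derivative f' (mexp X t)) (at t)"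
      using invariant_derivation[OF fp(1), of X] by blast
    have "f' A = 0" if A: "A \<in> G" for A
    proof -
      have AB: "(\<lambda>B. f (A ** B)) \<in> poly_fun" using poly_fun_conjugation[OF fp(1), of A "mat 1"] by simp
      have "frechet_derivative (\<lambda>B. f (A ** B)) (at (mat 1)) X = 0"
        by (rule lie_algebraD[OF X AB]) (rule fp(2)[OF D(2)[OF A]])
      moreover have "((\<lambda>B. A ** B) has_derivative (\<lambda>B. A ** B)) (at (mat 1))"
        by (rule bounded_linear_imp_has_derivative[OF bounded_bilinear.bounded_linear_right[OF bounded_bilinear_mmul]])
      from has_derivative_compose[OF this, of f "frechet_derivative f (at A)"]
      have "((\<lambda>B. f (A ** B)) has_derivative (\<lambda>B. frechet_derivative f (at A) (A ** B))) (at (mat 1))"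
        using poly_fun_has_derivative[OF fp(1), of A] by simp
      from frechet_derivative_at[OF this]
      have "frechet_derivative (\<lambda>B. f (A ** B)) (at (mat 1)) X = frechet_derivative f (at A) (A ** X)" by metis
      ultimately show ?thesis by (simp add: f'(2))
    qed
    then show ?thesis using f' by (auto simp: van_def)
  qed
  have vanish: "f (mexp X t) = 0" if f: "f \<in> van" for f
  proof -
    have "\<exists>h\<in>van. (deriv ^^ n) (\<lambda>t. f (mexp X t)) = (\<lambda>t. h (mexp X t))" for n
    proof (induction n)
      case (Suc n)
      then obtain h where h: "h \<in> van" "(deriv ^^ n) (\<lambda>t. f (mexp X t)) = (\<lambda>t. h (mexp X t))" by blast
      obtain h' where h': "h' \<in> van" "\<And>t. ((\<lambda>t. h (mexp X t)) has_field_derivative h' (mexp X t)) (at t)"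
        using step[OF h(1)] by blast
      have "deriv (\<lambda>t. h (mexp X t)) = (\<lambda>t. h' (mexp X t))" using DERIV_imp_deriv[OF h'(2)] by blast
      then show ?case using h(2) h'(1) by auto
    qed (use f in auto)
    then have "(deriv ^^ n) (\<lambda>t. f (mexp X t)) 0 = 0" for n
      using D(1) by (metis (mono_tags, lifting) mem_Collect_eq mexp_0 van_def)
    moreover have "(\<lambda>t. f (mexp X t)) holomorphic_on UNIV"
      using step[OF f] by (auto simp: holomorphic_on_def field_differentiable_def)
    ultimately show ?thesis
      by (intro holomorphic_fun_eq_0_on_connected[of "\<lambda>t. f (mexp X t)" UNIV 0 t]) (auto simp: connected_UNIV)
  qed
  obtain S where S: "S \<subseteq> poly_fun" "G = {A. invertible A \<and> (\<forall>f\<in>S. f A = 0)}" using D(5) by blast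
  then have "S \<subseteq> van" by (auto simp: van_def)
  then show ?thesis using vanish mexp_invertible(1)[of X t] S(2) by auto
qed

section \<open>Symmetric pairs\<close>

lemma symmetric_pairD:
  assumes "reductive_symmetric_pair G \<theta>"
  shows "algebraic_group G" "\<exists>F. regular_extension G \<theta> F" "\<And>g. g \<in> G \<Longrightarrow> \<theta> g \<in> G"
    "\<And>g h. g \<in> G \<Longrightarrow> h \<in> G \<Longrightarrow> \<theta> (g ** h) = \<theta> g ** \<theta> h"
  using assms by (auto simp: reductive_symmetric_pair_def reductive_group_def hom_def GL_def)

text \<open>A regular extension \<open>F\<close> of \<open>\<theta>\<close> is fixed, because \<open>\<theta>\<close> can only be differentiated through
  such an extension.\<close>

locale symmetric_pair =
  fixes G :: "'n::finite cmat set" and \<theta> :: "'n cmat \<Rightarrow> 'n cmat" and F :: "'n cmat \<Rightarrow> 'n cmat"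
  assumes G: "algebraic_group G" and F: "regular_extension G \<theta> F"
    and \<theta>_closed: "\<And>g. g \<in> G \<Longrightarrow> \<theta> g \<in> G"
    and \<theta>_mult: "\<And>g h. g \<in> G \<Longrightarrow> h \<in> G \<Longrightarrow> \<theta> (g ** h) = \<theta> g ** \<theta> h"
begin

lemmas group = algebraic_groupD[OF G]

definition dF :: "'n cmat \<Rightarrow> 'n cmat" where "dF = frechet_derivative F (at (mat 1))"

definition eigenspace :: "real \<Rightarrow> 'n cmat set" where
  "eigenspace a = {X \<in> lie_algebra G. dF X = a *\<^sub>R X}"

abbreviation (input) "\<pp> \<equiv> anisotropic_space G \<theta>"

abbreviation (input) "K \<equiv> symmetric_subgroup G \<theta>"

lemma F_derivative: "(F has_derivative dF) (at (mat 1))"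
proof -
  have "invertible (mat 1 :: 'n cmat)" by (rule minvI(1)[of _ "mat 1"]) simp
  then have "F differentiable at (mat 1)"
    using F by (intro regular_map_differentiable) (auto simp: regular_extension_def)
  then show ?thesis unfolding dF_def by (simp add: frechet_derivative_works)
qed

lemma F_eq: "g \<in> G \<Longrightarrow> F g = \<theta> g"
  using F by (simp add: regular_extension_def)

lemma linear_dF: "linear dF" using has_derivative_linear[OF F_derivative] .

lemma anisotropic_eq: "\<pp> = eigenspace (-1)"
  using differential_eq[OF G F] by (auto simp: anisotropic_space_def eigenspace_def dF_def)

lemma dF_complex_linear: "dF (smul c X) = smul c (dF X)"
proof (rule mat_eqI)
  fix i j
  have inv1: "invertible (mat 1 :: 'n cmat)" by (rule minvI(1)[of _ "mat 1"]) simp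
  obtain f k where f: "f \<in> poly_fun" "\<And>A. invertible A \<Longrightarrow> F A $ i $ j = f A / det A ^ k"
    using F unfolding regular_extension_def regular_map_def by metis
  have dk: "(\<lambda>A. det A ^ k) \<in> poly_fun" by (rule poly_fun_power[OF poly_fun_det])
  let ?Df = "frechet_derivative f (at (mat 1))" and ?Dd = "frechet_derivative (\<lambda>A. det A ^ k) (at (mat 1))"
  have 1: "((\<lambda>A. F A $ i $ j) has_derivative (\<lambda>X. dF X $ i $ j)) (at (mat 1))"
    using F_derivative by (intro bounded_linear.has_derivative[OF bounded_linear_vec_nth])
  have "((\<lambda>A. F A $ i $ j * det A ^ k) has_derivative
      (\<lambda>X. F (mat 1) $ i $ j * ?Dd X + dF X $ i $ j * det (mat 1) ^ k)) (at (mat 1))"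
    using has_derivative_mult[OF 1 poly_fun_has_derivative[OF dk, of "mat 1"]] by simp
  then have "(f has_derivative (\<lambda>X. F (mat 1) $ i $ j * ?Dd X + dF X $ i $ j * det (mat 1) ^ k)) (at (mat 1))"
    by (rule has_derivative_transform_within_open[OF _ open_invertible])
      (use inv1 f in \<open>auto simp: invertible_det_nz\<close>)
  from frechet_derivative_at[OF this] have "?Df = (\<lambda>X. F (mat 1) $ i $ j * ?Dd X + dF X $ i $ j)" by simp
  then have eq: "dF X $ i $ j = ?Df X - F (mat 1) $ i $ j * ?Dd X" for X by simp
  show "dF (smul c X) $ i $ j = smul c (dF X) $ i $ j"
    unfolding smul_nth eq poly_fun_derivative_complex_linear[OF f(1)] poly_fun_derivative_complex_linear[OF dk]
    by (simp add: algebra_simps)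
qed

lemma eigenspace_subspace: "subspace (eigenspace a)" "X \<in> eigenspace a \<Longrightarrow> smul c X \<in> eigenspace a"
proof -
  show "subspace (eigenspace a)"
    using lie_algebra_subspace(1)[of G] unfolding subspace_def eigenspace_def
    by (auto simp: linear_0[OF linear_dF] linear_add[OF linear_dF] linear_cmul[OF linear_dF] algebra_simps)
  show "smul c X \<in> eigenspace a" if "X \<in> eigenspace a"
    using that lie_algebra_subspace(2)[of X G c]
    by (auto simp: eigenspace_def dF_complex_linear scaleR_smul smul_simps mult.commute)
qed

lemma derivative_along_curve:
  assumes "(\<gamma> has_vector_derivative X) (at 0)" "\<gamma> (0::real) = mat 1"
    "((\<lambda>s. F (\<gamma> s)) has_vector_derivative Y) (at 0)"
  shows "dF X = Y"
proof -
  have "((\<lambda>s. F (\<gamma> s)) has_vector_derivative dF X) (at 0)"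
    using has_derivative_compose[OF assms(1)[unfolded has_vector_derivative_def], of F dF] F_derivative
      linear_cmul[OF linear_dF] assms(2) by (simp add: has_vector_derivative_def)
  then show ?thesis using vector_derivative_unique_at assms(3) by blast
qed

lemma \<theta>_one: "\<theta> (mat 1) = mat 1"
proof -
  have "\<theta> (mat 1) ** \<theta> (mat 1) = \<theta> (mat 1)" using \<theta>_mult[OF group(1) group(1)] by simp
  moreover have inv: "invertible (\<theta> (mat 1))" by (intro group(4) \<theta>_closed group(1))
  ultimately have "matrix_inv (\<theta> (mat 1)) ** (\<theta> (mat 1) ** \<theta> (mat 1)) = matrix_inv (\<theta> (mat 1)) ** \<theta> (mat 1)" by simp
  then show ?thesis by (simp add: matrix_mul_assoc minv[OF inv])
qed

lemma \<theta>_inv: "g \<in> G \<Longrightarrow> \<theta> (matrix_inv g) = matrix_inv (\<theta> g)"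
  using \<theta>_mult[OF _ group(3)] minv(1)[OF group(4)] \<theta>_one minvI(2) by metis

text \<open>Both sides are one-parameter groups with the same derivative at zero.\<close>

lemma \<theta>_mexp:
  assumes X: "X \<in> eigenspace a"
  shows "\<theta> (mexp X (of_real s)) = mexp X (of_real (a * s))"
proof -
  have XG: "X \<in> lie_algebra G" "dF X = a *\<^sub>R X" using X by (auto simp: eigenspace_def)
  have mG: "mexp X t \<in> G" for t by (rule mexp_in_group[OF G XG(1)])
  define \<psi> where "\<psi> = (\<lambda>s. \<theta> (mexp X (of_real s)))"
  have add: "mexp X (of_real (s + h)) = mexp X (of_real s) ** mexp X (of_real h)" for s h
  proof -
    have "((\<lambda>h. mexp X (of_real (s + h))) has_vector_derivative mexp X (of_real (s + h)) ** X) (at h)" for h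
    proof -
      have "((\<lambda>h. s + h) has_vector_derivative 1) (at h)"
        by (auto intro!: derivative_eq_intros)
      from vector_diff_chain_at[OF this mexp_vector_derivative[of X "s + h"]]
      show ?thesis by (simp add: o_def mexp_commute)
    qed
    from mexp_ode_unique[OF this, of h] show ?thesis by simp
  qed
  have \<psi>_add: "\<psi> (s + h) = \<psi> s ** \<psi> h" for s h
    unfolding \<psi>_def add by (rule \<theta>_mult[OF mG mG])
  have \<psi>0: "(\<psi> has_vector_derivative a *\<^sub>R X) (at 0)"
  proof -
    have "((\<lambda>s. mexp X (of_real s)) has_vector_derivative X) (at 0)"
      using mexp_vector_derivative[of X 0] by simp
    then have "((\<lambda>s. F (mexp X (of_real s))) has_vector_derivative dF X) (at 0)"
      using has_derivative_compose[of "\<lambda>s. mexp X (of_real s)" "\<lambda>h. h *\<^sub>R X" 0 UNIV F dF] F_derivative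
        linear_cmul[OF linear_dF] by (simp add: has_vector_derivative_def)
    then show ?thesis using F_eq mG XG(2) by (simp add: \<psi>_def)
  qed
  have "(\<psi> has_vector_derivative \<psi> s ** (a *\<^sub>R X)) (at s)" for s
  proof -
    have "((\<lambda>t. t - s) has_vector_derivative 1) (at s)" by (auto intro!: derivative_eq_intros)
    from vector_diff_chain_at[OF this, of \<psi> "a *\<^sub>R X"] \<psi>0
    have "((\<lambda>t. \<psi> (t - s)) has_vector_derivative a *\<^sub>R X) (at s)" by (simp add: o_def)
    from bounded_linear.has_vector_derivative[OF bounded_bilinear.bounded_linear_right[OF bounded_bilinear_mmul, of "\<psi> s"] this]
    have "((\<lambda>t. \<psi> s ** \<psi> (t - s)) has_vector_derivative \<psi> s ** (a *\<^sub>R X)) (at s)" .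
    then show ?thesis by (simp flip: \<psi>_add)
  qed
  from mexp_ode_unique[OF this, of s] have "\<psi> s = \<psi> 0 ** mexp X (of_real (a * s))"
    by (simp add: scaleR_smul mexp_smul)
  moreover have "\<psi> 0 = mat 1" by (simp add: \<psi>_def \<theta>_one)
  ultimately show ?thesis by (simp add: \<psi>_def)
qed

text \<open>Differentiate \<open>\<theta>\<close> along the conjugate by \<open>g\<close> of the one-parameter group of \<open>Y\<close>.\<close>

lemma adjoint_eigenspace:
  assumes g: "g \<in> G" and Y: "Y \<in> eigenspace b"
  shows "dF (adjoint g Y) = b *\<^sub>R adjoint (\<theta> g) Y"
proof -
  have YG: "Y \<in> lie_algebra G" using Y by (simp add: eigenspace_def)
  have mG: "mexp Y t \<in> G" for t by (rule mexp_in_group[OF G YG])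
  have inv: "matrix_inv g \<in> G" by (rule group(3)[OF g])
  have bl: "bounded_linear (\<lambda>A. h ** A ** h')" for h h' :: "'n cmat"
    using bounded_linear_compose[OF bounded_bilinear.bounded_linear_left[OF bounded_bilinear_mmul]
      bounded_bilinear.bounded_linear_right[OF bounded_bilinear_mmul]] .
  have Y0: "((\<lambda>s. mexp Y (of_real (c * s))) has_vector_derivative c *\<^sub>R Y) (at 0)" for c
    using mexp_vector_derivative[of "c *\<^sub>R Y" 0] by (simp add: scaleR_smul mexp_smul)
  let ?\<gamma> = "\<lambda>s. g ** mexp Y (of_real s) ** matrix_inv g"
  have 1: "(?\<gamma> has_vector_derivative adjoint g Y) (at 0)"
    using bounded_linear.has_vector_derivative[OF bl Y0[of 1]] by (simp add: adjoint_def)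
  have "F (?\<gamma> s) = \<theta> g ** mexp Y (of_real (b * s)) ** matrix_inv (\<theta> g)" for s
    using F_eq \<theta>_mult group(2) g inv mG \<theta>_mexp[OF Y] \<theta>_inv by simp
  moreover have "((\<lambda>s. \<theta> g ** mexp Y (of_real (b * s)) ** matrix_inv (\<theta> g)) has_vector_derivative
      \<theta> g ** (b *\<^sub>R Y) ** matrix_inv (\<theta> g)) (at 0)"
    by (rule bounded_linear.has_vector_derivative[OF bl Y0])
  ultimately have 2: "((\<lambda>s. F (?\<gamma> s)) has_vector_derivative b *\<^sub>R adjoint (\<theta> g) Y) (at 0)"
    by (simp add: adjoint_def scaleR_smul mmul_simps)
  show ?thesis by (rule derivative_along_curve[OF 1 _ 2]) (use minv[OF group(4)[OF g]] in simp)
qed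

lemma ad_curve:
  "((\<lambda>s. adjoint (mexp X (of_real s)) Y) has_vector_derivative X ** Y - Y ** X) (at 0)"
proof -
  have 1: "((\<lambda>s. mexp X (of_real s) ** Y) has_vector_derivative X ** Y) (at 0)"
    using bounded_linear.has_vector_derivative[OF bounded_bilinear.bounded_linear_left[OF bounded_bilinear_mmul]
      mexp_vector_derivative[of X 0]] by simp
  have 2: "((\<lambda>s. mexp X (of_real (- s))) has_vector_derivative - X) (at 0)"
    using mexp_vector_derivative[of "- X" 0] mexp_smul[of "-1" X] by (simp add: smul_simps)
  have "((\<lambda>s. mexp X (of_real s) ** Y ** mexp X (of_real (- s))) has_vector_derivative
      X ** Y + Y ** (- X)) (at 0)"
    using bounded_bilinear.has_vector_derivative[OF bounded_bilinear_mmul 1 2] by (simp add: add.commute)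
  then show ?thesis by (simp add: adjoint_def mexp_invertible mmul_simps)
qed

lemma derivative_in_subspace:
  fixes \<gamma> :: "real \<Rightarrow> 'n cmat"
  assumes "subspace V" "\<And>s. \<gamma> s \<in> V" "(\<gamma> has_vector_derivative X) (at 0)"
  shows "X \<in> V"
proof -
  have "X \<bullet> w = 0" if w: "w \<in> orthogonal_comp V" for w
  proof -
    have "\<gamma> s \<bullet> w = 0" for s using w assms(2)[of s] by (auto simp: orthogonal_comp_def orthogonal_def)
    moreover have "((\<lambda>s. \<gamma> s \<bullet> w) has_vector_derivative X \<bullet> w) (at 0)"
      by (rule bounded_linear.has_vector_derivative[OF bounded_linear_inner_left assms(3)])
    ultimately have "((\<lambda>s::real. 0::real) has_vector_derivative X \<bullet> w) (at 0)" by simp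
    then show ?thesis using vector_derivative_unique_at has_vector_derivative_const by metis
  qed
  then have "X \<in> orthogonal_comp (orthogonal_comp V)"
    by (auto simp: orthogonal_comp_def[of "orthogonal_comp V"] orthogonal_def inner_commute)
  then show ?thesis using orthogonal_comp_self[OF assms(1)] by simp
qed

text \<open>The bracket is the derivative of the adjoint action along the one-parameter group of \<open>X\<close>.\<close>

lemma bracket_eigenspace:
  assumes X: "X \<in> eigenspace a" and Y: "Y \<in> eigenspace b"
  shows "X ** Y - Y ** X \<in> eigenspace (a * b)"
proof -
  have XG: "X \<in> lie_algebra G" and YG: "Y \<in> lie_algebra G" using X Y by (auto simp: eigenspace_def)
  have mG: "mexp X t \<in> G" for t by (rule mexp_in_group[OF G XG])
  have "X ** Y - Y ** X \<in> lie_algebra G"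
    by (rule derivative_in_subspace[OF lie_algebra_subspace(1) adjoint_lie_algebra[OF G mG YG] ad_curve])
  moreover have "dF (X ** Y - Y ** X) = (a * b) *\<^sub>R (X ** Y - Y ** X)"
  proof -
    have "((\<lambda>s. dF (adjoint (mexp X (of_real s)) Y)) has_vector_derivative dF (X ** Y - Y ** X)) (at 0)"
      by (rule bounded_linear.has_vector_derivative[OF _ ad_curve])
        (use linear_dF linear_conv_bounded_linear in blast)
    moreover have "dF (adjoint (mexp X (of_real s)) Y) = b *\<^sub>R adjoint (mexp X (of_real (a * s))) Y" for s
      using adjoint_eigenspace[OF mG Y] \<theta>_mexp[OF X] by simp
    moreover have "((\<lambda>s. b *\<^sub>R adjoint (mexp X (of_real (a * s))) Y) has_vector_derivative
        b *\<^sub>R (a *\<^sub>R (X ** Y - Y ** X))) (at 0)"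
    proof (rule bounded_linear.has_vector_derivative[OF bounded_linear_scaleR_right])
      have "a *\<^sub>R (X ** Y - Y ** X) = (a *\<^sub>R X) ** Y - Y ** (a *\<^sub>R X)"
        by (simp add: scaleR_smul mmul_simps smul_simps)
      then show "((\<lambda>s. adjoint (mexp X (of_real (a * s))) Y) has_vector_derivative a *\<^sub>R (X ** Y - Y ** X)) (at 0)"
        using ad_curve[of "a *\<^sub>R X" Y] by (simp add: scaleR_smul mexp_smul)
    qed
    ultimately show ?thesis using vector_derivative_unique_at by fastforce
  qed
  ultimately show ?thesis by (simp add: eigenspace_def)
qed

end

section \<open>The Zariski topology on matrices\<close>

lemma in_zariski_closure:
  "y \<in> zariski closure_of D \<longleftrightarrow> (\<forall>f\<in>poly_fun. (\<forall>A\<in>D. f A = 0) \<longrightarrow> f y = 0)"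
proof (intro iffI ballI impI)
  fix f assume y: "y \<in> zariski closure_of D" and f: "f \<in> poly_fun" "\<forall>A\<in>D. f A = 0"
  have "closedin zariski {A. \<forall>g\<in>{f}. g A = 0}" unfolding closedin_zariski using f(1) by blast
  from closure_of_minimal[OF _ this, of D] y f(2) show "f y = 0" by auto
next
  assume *: "\<forall>f\<in>poly_fun. (\<forall>A\<in>D. f A = 0) \<longrightarrow> f y = 0"
  obtain S where S: "S \<subseteq> poly_fun" "zariski closure_of D = {A. \<forall>f\<in>S. f A = 0}"
    using closedin_closure_of[of zariski D] unfolding closedin_zariski by blast
  have "D \<subseteq> zariski closure_of D" by (rule closure_of_subset) simp
  then have "f A = 0" if "f \<in> S" "A \<in> D" for f A using S(2) that by auto
  then have "f y = 0" if "f \<in> S" for f using * S(1) that by blast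
  then show "y \<in> zariski closure_of D" unfolding S(2) by blast
qed

lemma continuous_map_zariski:
  fixes F :: "'m::finite cmat \<Rightarrow> 'n::finite cmat"
  assumes "\<And>i j. (\<lambda>A. F A $ i $ j) \<in> poly_fun"
  shows "continuous_map zariski zariski F"
  unfolding continuous_map_def
proof (intro conjI allI impI)
  fix U :: "'n cmat set" assume "openin zariski U"
  then obtain S where S: "S \<subseteq> poly_fun" "U = {A. \<exists>f\<in>S. f A \<noteq> 0}" unfolding openin_zariski by blast
  have "{x \<in> topspace zariski. F x \<in> U} = {A. \<exists>f\<in>(\<lambda>f A. f (F A)) ` S. f A \<noteq> 0}" using S(2) by auto
  moreover have "(\<lambda>f A. f (F A)) ` S \<subseteq> poly_fun" using S(1) poly_fun_compose[OF _ assms] by auto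
  ultimately show "openin zariski {x \<in> topspace zariski. F x \<in> U}" unfolding openin_zariski by blast
qed auto

lemma poly_fun_continuous: "f \<in> poly_fun \<Longrightarrow> continuous_on UNIV f"
  by (intro continuous_at_imp_continuous_on ballI differentiable_imp_continuous_within poly_fun_differentiable)

lemma zariski_open_is_open: "openin zariski U \<Longrightarrow> open U"
proof -
  assume "openin zariski U"
  then obtain S where S: "S \<subseteq> poly_fun" "U = {A. \<exists>f\<in>S. f A \<noteq> 0}" unfolding openin_zariski by blast
  have "open (f -` (- {0}))" if "f \<in> S" for f
    using S(1) that by (intro open_vimage poly_fun_continuous) auto
  then have "open (\<Union>f\<in>S. f -` (- {0}))" by blast
  moreover have "U = (\<Union>f\<in>S. f -` (- {0}))" using S(2) by auto
  ultimately show ?thesis by simp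
qed

lemma connected_imp_zariski_connected: "connected T \<Longrightarrow> connectedin zariski T"
  unfolding connectedin connected_def using zariski_open_is_open by (auto simp: Int_assoc)

lemma poly_fun_on_line:
  assumes "f \<in> poly_fun" shows "\<exists>p. \<forall>\<tau>. f (A + smul \<tau> B) = poly p \<tau>"
  using assms
proof (induction rule: poly_fun.induct)
  case (const c)
  show ?case by (rule exI[of _ "[:c:]"]) simp
next
  case (coord i j)
  show ?case by (rule exI[of _ "[:A $ i $ j, B $ i $ j:]"]) (simp add: mult.commute)
next
  case (add f g)
  then obtain p q where "\<forall>\<tau>. f (A + smul \<tau> B) = poly p \<tau>" "\<forall>\<tau>. g (A + smul \<tau> B) = poly q \<tau>" by blast
  then show ?case by (intro exI[of _ "p + q"]) simp
next
  case (mult f g)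
  then obtain p q where "\<forall>\<tau>. f (A + smul \<tau> B) = poly p \<tau>" "\<forall>\<tau>. g (A + smul \<tau> B) = poly q \<tau>" by blast
  then show ?case by (intro exI[of _ "p * q"]) simp
qed

section \<open>The adjoint action\<close>

lemma adjoint_simps:
  fixes g :: "'n::finite cmat"
  assumes "invertible g"
  shows "adjoint g (X ** Y) = adjoint g X ** adjoint g Y" "adjoint g (X + Y) = adjoint g X + adjoint g Y"
    "adjoint g (X - Y) = adjoint g X - adjoint g Y" "adjoint g (smul c X) = smul c (adjoint g X)"
    "adjoint g 0 = 0" "adjoint g (mat 1) = mat 1" "adjoint (matrix_inv g) (adjoint g X) = X"
    "adjoint g (adjoint (matrix_inv g) X) = X" "adjoint g X = adjoint g Y \<longleftrightarrow> X = Y"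
proof -
  have "adjoint g X ** adjoint g Y = g ** X ** (matrix_inv g ** g) ** Y ** matrix_inv g"
    by (simp add: adjoint_def matrix_mul_assoc)
  then show "adjoint g (X ** Y) = adjoint g X ** adjoint g Y"
    by (simp add: minv[OF assms] adjoint_def matrix_mul_assoc)
  have ii: "matrix_inv (matrix_inv g) = g" by (rule minvI(2)[OF minv(2)[OF assms]])
  have "adjoint (matrix_inv g) (adjoint g Z) = (matrix_inv g ** g) ** Z ** (matrix_inv g ** g)" for Z
    by (simp add: adjoint_def ii matrix_mul_assoc)
  then show inv: "adjoint (matrix_inv g) (adjoint g X) = X" by (simp add: minv[OF assms])
  have "adjoint g (adjoint (matrix_inv g) Z) = (g ** matrix_inv g) ** Z ** (g ** matrix_inv g)" for Z
    by (simp add: adjoint_def ii matrix_mul_assoc)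
  then show "adjoint g (adjoint (matrix_inv g) X) = X" by (simp add: minv[OF assms])
  show "adjoint g X = adjoint g Y \<longleftrightarrow> X = Y"
    using \<open>\<And>Z. adjoint (matrix_inv g) (adjoint g Z) = (matrix_inv g ** g) ** Z ** (matrix_inv g ** g)\<close>
    by (metis matrix_mul_lid matrix_mul_rid minv(2)[OF assms])
qed (simp_all add: adjoint_def mmul_simps minv[OF assms])

lemma matrix_inv_mult:
  fixes a b :: "'n::finite cmat"
  assumes "invertible a" "invertible b"
  shows "matrix_inv (a ** b) = matrix_inv b ** matrix_inv a"
proof (rule minvI(2))
  have "a ** b ** (matrix_inv b ** matrix_inv a) = a ** (b ** matrix_inv b) ** matrix_inv a"
    by (simp add: matrix_mul_assoc)
  then show "a ** b ** (matrix_inv b ** matrix_inv a) = mat 1" by (simp add: minv[OF assms(1)] minv[OF assms(2)])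
qed

lemma adjoint_adjoint:
  assumes "invertible g" "invertible h"
  shows "adjoint g (adjoint h X) = adjoint (g ** h) X"
  by (simp add: adjoint_def matrix_inv_mult[OF assms] matrix_mul_assoc)

lemma jordan_adjoint:
  fixes g :: "'n::finite cmat"
  assumes g: "invertible g" and J: "jordan_decomposition u s n"
  shows "jordan_decomposition (adjoint g u) (adjoint g s) (adjoint g n)"
proof -
  note A = adjoint_simps[OF g]
  have J': "u = s + n" "semisimple_mat s" "nilpotent_mat n" "s ** n = n ** s"
    using J by (auto simp: jordan_decomposition_def)
  obtain P :: "'n cmat" where P: "invertible P" "diagonal (matrix_inv P ** s ** P)"
    using J'(2) by (auto simp: semisimple_iff)
  have "matrix_inv (g ** P) ** adjoint g s ** (g ** P) = matrix_inv P ** (matrix_inv g ** g) ** s ** (matrix_inv g ** g) ** P"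
    by (simp add: matrix_inv_mult[OF g P(1)] adjoint_def matrix_mul_assoc)
  then have "semisimple_mat (adjoint g s)" unfolding semisimple_iff
    using P invertible_mult[OF g P(1)] by (intro exI[of _ "g ** P"]) (simp add: minv[OF g])
  moreover have "nilpotent_mat (adjoint g n)"
  proof -
    have "mpow (adjoint g n) k = adjoint g (mpow n k)" for k by (induction k) (simp_all add: mpow_Suc A)
    moreover obtain k where "mpow n k = 0" using J'(3) by (auto simp: nilpotent_mat_mpow)
    ultimately have "mpow (adjoint g n) k = 0" by (simp add: A(5))
    then show ?thesis by (auto simp: nilpotent_mat_mpow)
  qed
  moreover have "adjoint g s ** adjoint g n = adjoint g n ** adjoint g s"
    by (simp add: J'(4) flip: A(1))
  ultimately show ?thesis by (simp add: jordan_decomposition_def J'(1) A(2))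
qed

section \<open>The symmetric subgroup\<close>

context symmetric_pair
begin

definition "fixed_group = {g \<in> G. \<theta> g = g}"

lemma fixed_group_closed:
  "mat 1 \<in> fixed_group" "a \<in> fixed_group \<Longrightarrow> b \<in> fixed_group \<Longrightarrow> a ** b \<in> fixed_group"
  "a \<in> fixed_group \<Longrightarrow> matrix_inv a \<in> fixed_group"
  using group \<theta>_one \<theta>_mult \<theta>_inv by (auto simp: fixed_group_def)

lemma K_def: "K = connected_component_of_set (subtopology zariski fixed_group) (mat 1)"
  by (simp add: symmetric_subgroup_def identity_component_def fixed_group_def)

lemma K_connected: "connectedin (subtopology zariski fixed_group) K" "mat 1 \<in> K" "K \<subseteq> fixed_group"
proof -
  show "connectedin (subtopology zariski fixed_group) K"
    unfolding K_def by (rule connectedin_connected_component_of)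
  then show "K \<subseteq> fixed_group" using connectedin_subset_topspace by fastforce
  show "mat 1 \<in> K" unfolding K_def using fixed_group_closed(1) by (simp add: connected_component_of_refl)
qed

lemma K_maximal: "connectedin zariski T \<Longrightarrow> T \<subseteq> fixed_group \<Longrightarrow> mat 1 \<in> T \<Longrightarrow> T \<subseteq> K"
  unfolding K_def by (rule connected_component_of_maximal) (auto simp: connectedin_subtopology)

lemma K_left_quotient:
  assumes a: "a \<in> K" and b: "b \<in> K" shows "matrix_inv a ** b \<in> K"
proof -
  have aH: "a \<in> fixed_group" using a K_connected by blast
  then have ia: "invertible a" by (simp add: fixed_group_def group(4))
  have "continuous_map zariski zariski (\<lambda>A. matrix_inv a ** A)"
    by (rule continuous_map_zariski) (auto simp: mmul_nth intro!: poly_fun_sum poly_fun.intros)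
  moreover have "connectedin zariski K" using K_connected(1) by (simp add: connectedin_subtopology)
  ultimately have "connectedin zariski ((\<lambda>A. matrix_inv a ** A) ` K)" by (rule connectedin_continuous_map_image)
  moreover have "(\<lambda>A. matrix_inv a ** A) ` K \<subseteq> fixed_group"
    using K_connected(3) fixed_group_closed aH by auto
  moreover have "mat 1 \<in> (\<lambda>A. matrix_inv a ** A) ` K" using a minv(2)[OF ia] by (metis image_eqI)
  ultimately show ?thesis using K_maximal b by blast
qed

lemma K_group: "a \<in> K \<Longrightarrow> matrix_inv a \<in> K" "a \<in> K \<Longrightarrow> b \<in> K \<Longrightarrow> a ** b \<in> K" "a \<in> K \<Longrightarrow> a \<in> G"
  "a \<in> K \<Longrightarrow> \<theta> a = a" "a \<in> K \<Longrightarrow> invertible a"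
proof -
  show G: "a \<in> G" "\<theta> a = a" "invertible a" if "a \<in> K" for a
    using K_connected(3) that group(4) by (auto simp: fixed_group_def)
  show inv: "matrix_inv a \<in> K" if "a \<in> K" for a using K_left_quotient[OF that K_connected(2)] by simp
  show "a ** b \<in> K" if "a \<in> K" "b \<in> K"
    using K_left_quotient[OF inv[OF that(1)] that(2)] minvI(2)[OF minv(2)[OF G(3)[OF that(1)]]] by simp
qed

text \<open>The symmetric subgroup is closed in the group of fixed points of \<open>\<theta>\<close>, and on invertible
  matrices the equation of a fixed point becomes polynomial after multiplication with a power
  of the determinant.\<close>

lemma K_equations: "\<exists>S\<subseteq>poly_fun. K = {A. invertible A \<and> (\<forall>f\<in>S. f A = 0)}"
proof -
  obtain S where S: "S \<subseteq> poly_fun" "G = {A. invertible A \<and> (\<forall>f\<in>S. f A = 0)}" using group(5) by blast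
  have "\<exists>f k. f \<in> poly_fun \<and> (\<forall>A. invertible A \<longrightarrow> F A $ i $ j = f A / det A ^ k)" for i j
    using F unfolding regular_extension_def regular_map_def by blast
  then have "\<forall>i j. \<exists>h. h \<in> poly_fun \<and> (\<forall>A. invertible A \<longrightarrow> (F A $ i $ j = A $ i $ j \<longleftrightarrow> h A = 0))"
  proof (intro allI)
    fix i j
    obtain f k where f: "f \<in> poly_fun" "\<And>A. invertible A \<Longrightarrow> F A $ i $ j = f A / det A ^ k"
      using \<open>\<And>i j. \<exists>f k. f \<in> poly_fun \<and> (\<forall>A. invertible A \<longrightarrow> F A $ i $ j = f A / det A ^ k)\<close> by blast
    have "(\<lambda>A. f A - A $ i $ j * det A ^ k) \<in> poly_fun"
      by (intro poly_fun_diff f poly_fun.mult poly_fun.coord poly_fun_power poly_fun_det)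
    moreover have "F A $ i $ j = A $ i $ j \<longleftrightarrow> f A - A $ i $ j * det A ^ k = 0" if "invertible A" for A
      using f(2)[OF that] that by (auto simp: invertible_det_nz field_simps)
    ultimately show "\<exists>h. h \<in> poly_fun \<and> (\<forall>A. invertible A \<longrightarrow> (F A $ i $ j = A $ i $ j \<longleftrightarrow> h A = 0))"
      by (intro exI[of _ "\<lambda>A. f A - A $ i $ j * det A ^ k"]) simp
  qed
  then obtain h where h: "\<And>i j. h i j \<in> poly_fun"
    "\<And>i j A. invertible A \<Longrightarrow> F A $ i $ j = A $ i $ j \<longleftrightarrow> h i j A = 0" by metis
  have "closedin (subtopology zariski fixed_group) K" unfolding K_def by (rule closedin_connected_component_of)
  then obtain C where C: "closedin zariski C" "K = C \<inter> fixed_group" unfolding closedin_subtopology by blast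
  obtain S' where S': "S' \<subseteq> poly_fun" "C = {A. \<forall>f\<in>S'. f A = 0}" using C(1) unfolding closedin_zariski by blast
  let ?S = "S \<union> range (\<lambda>(i, j). h i j) \<union> S'"
  have "A \<in> fixed_group \<longleftrightarrow> invertible A \<and> (\<forall>f\<in>S. f A = 0) \<and> (\<forall>i j. h i j A = 0)" for A
  proof -
    have "A \<in> fixed_group \<longleftrightarrow> A \<in> G \<and> (\<forall>i j. F A $ i $ j = A $ i $ j)"
      using F_eq[of A] by (auto simp: fixed_group_def vec_eq_iff)
    then show ?thesis using h(2)[of A] S(2) by auto
  qed
  then have "A \<in> K \<longleftrightarrow> invertible A \<and> (\<forall>f\<in>?S. f A = 0)" for A
    using C(2) S'(2) by (simp add: ball_Un) blast
  then have "K = {A. invertible A \<and> (\<forall>f\<in>?S. f A = 0)}" by blast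
  moreover have "?S \<subseteq> poly_fun" using S(1) S'(1) h(1) by auto
  ultimately show ?thesis by blast
qed

text \<open>One-parameter groups of fixed points are connected in the Euclidean topology and contain
  the identity, hence stay in the identity component for the coarser Zariski topology.\<close>

lemma mexp_in_K:
  assumes X: "X \<in> eigenspace 1" shows "mexp X (of_real s) \<in> K"
proof -
  let ?T = "range (\<lambda>s. mexp X (of_real s))"
  have "connected ?T" by (rule connected_continuous_image[OF continuous_mexp_real]) (rule connected_UNIV)
  moreover have "?T \<subseteq> fixed_group"
    using \<theta>_mexp[OF X] mexp_in_group[OF G] X by (auto simp: fixed_group_def eigenspace_def)
  moreover have "mat 1 \<in> ?T" using rangeI[of "\<lambda>s. mexp X (of_real s)" 0] by simp
  ultimately show ?thesis using K_maximal[OF connected_imp_zariski_connected] by blast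
qed

section \<open>Centralizers and decomposition classes\<close>

lemma p_subspace: "subspace \<pp>" "X \<in> \<pp> \<Longrightarrow> smul c X \<in> \<pp>"
  using eigenspace_subspace by (auto simp: anisotropic_eq)

lemmas p_closed = subspace_add[OF p_subspace(1)] subspace_diff[OF p_subspace(1)] subspace_0[OF p_subspace(1)]

lemma adjoint_p:
  assumes g: "g \<in> K" and X: "X \<in> \<pp>" shows "adjoint g X \<in> \<pp>"
proof -
  have X': "X \<in> lie_algebra G" "X \<in> eigenspace (-1)" using X by (auto simp: anisotropic_eq eigenspace_def)
  show ?thesis unfolding anisotropic_eq
    using adjoint_lie_algebra[OF G K_group(3)[OF g] X'(1)] adjoint_eigenspace[OF K_group(3)[OF g] X'(2)]
    by (simp add: eigenspace_def K_group(4)[OF g])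
qed

lemma adjoint_p_iff: "g \<in> K \<Longrightarrow> adjoint g X \<in> \<pp> \<longleftrightarrow> X \<in> \<pp>"
  using adjoint_p[of g X] adjoint_p[OF K_group(1), of g "adjoint g X"] adjoint_simps(7)[OF K_group(5)] by metis

abbreviation (input) "cp u \<equiv> centralizer_in \<pp> u"

lemma cp_iff: "X \<in> cp u \<longleftrightarrow> X \<in> \<pp> \<and> X ** u = u ** X"
  by (simp add: centralizer_in_def)

lemma cp_subspace: "subspace (cp u)" "X \<in> cp u \<Longrightarrow> smul c X \<in> cp u"
  using p_subspace unfolding subspace_def
  by (auto simp: cp_iff mmul_simps scaleR_smul)

lemma adjoint_cp:
  assumes g: "g \<in> K" shows "adjoint g ` cp u = cp (adjoint g u)"
proof
  note A = adjoint_simps[OF K_group(5)[OF g]]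
  show "adjoint g ` cp u \<subseteq> cp (adjoint g u)" using adjoint_p[OF g] by (auto simp: cp_iff simp flip: A(1))
  show "cp (adjoint g u) \<subseteq> adjoint g ` cp u"
  proof
    fix Y assume Y: "Y \<in> cp (adjoint g u)"
    define X where "X = adjoint (matrix_inv g) Y"
    have YX: "Y = adjoint g X" by (simp add: X_def A)
    have "X \<in> \<pp>" using Y adjoint_p_iff[OF g] YX by (simp add: cp_iff)
    moreover have "adjoint g (X ** u) = adjoint g (u ** X)" using Y YX by (simp add: cp_iff A(1))
    then have "X ** u = u ** X" by (simp add: A(9))
    ultimately show "Y \<in> adjoint g ` cp u" using YX by (auto simp: cp_iff)
  qed
qed

lemma class_iff:
  assumes x: "x \<in> \<pp>" and J: "jordan_decomposition x s n"
  shows "v \<in> decomposition_class G \<theta> x \<longleftrightarrow> v \<in> \<pp> \<and>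
    (\<exists>vs vn. jordan_decomposition v vs vn \<and> (\<exists>g\<in>K. adjoint g ` cp s = cp vs \<and> adjoint g n = vn))"
  using x J jordan_unique[OF J] unfolding decomposition_class_def decomposition_rel_def by blast

lemma class_refl:
  assumes x: "x \<in> \<pp>" shows "x \<in> decomposition_class G \<theta> x"
proof -
  obtain s n where J: "jordan_decomposition x s n" using jordan_exists by blast
  have "matrix_inv (mat 1 :: 'n cmat) = mat 1" by (rule minvI(2)) simp
  then have "adjoint (mat 1) X = X" for X :: "'n cmat" by (simp add: adjoint_def)
  then show ?thesis unfolding class_iff[OF x J] using x J K_connected(2)
    by (intro conjI exI[of _ s] exI[of _ n] bexI[of _ "mat 1"]) simp_all
qed

text \<open>The semisimple members of the centre of the centralizer of \<open>s\<close> in \<open>\<pp>\<close>. They are the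
  directions in which the semisimple part \<open>s\<close> can move, without changing its centralizer as
  long as the move is small.\<close>

definition center :: "'n cmat \<Rightarrow> 'n cmat set" where
  "center s = {m \<in> \<pp>. semisimple_mat m \<and> (\<forall>Y\<in>cp s. Y ** m = m ** Y)}"

lemma center_commute:
  assumes x: "x \<in> \<pp>" and J: "jordan_decomposition x s n" and m: "m \<in> center s"
  shows "s ** m = m ** s" "n ** m = m ** n" "m \<in> cp s"
proof -
  have "s ** x = x ** s" using jordan_commute(1)[OF J, of x] by simp
  then have "x \<in> cp s" using x by (simp add: cp_iff)
  then have "x ** m = m ** x" using m by (simp add: center_def)
  then show "s ** m = m ** s" "n ** m = m ** n" using jordan_commute[OF J] by auto
  then show "m \<in> cp s" using m by (simp add: center_def cp_iff)
qed

lemma center_add: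
  assumes x: "x \<in> \<pp>" and J: "jordan_decomposition x s n" and m: "m \<in> center s" "m' \<in> center s"
  shows "m + m' \<in> center s"
proof -
  have "m ** m' = m' ** m" using center_commute(3)[OF x J m(1)] m(2) by (simp add: center_def)
  then show ?thesis using m semisimple_add[of m m'] p_closed by (auto simp: center_def mmul_simps)
qed

lemma center_smul: "m \<in> center s \<Longrightarrow> smul c m \<in> center s"
  using p_subspace(2) semisimple_smul by (auto simp: center_def mmul_simps)

lemma center_jordan:
  assumes x: "x \<in> \<pp>" and J: "jordan_decomposition x s n" and m: "m \<in> center s"
  shows "jordan_decomposition (s + m + n) (s + m) n" "s + m + n \<in> \<pp>" "cp s \<subseteq> cp (s + m)"
proof -
  have J': "x = s + n" "semisimple_mat s" "nilpotent_mat n" "s ** n = n ** s"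
    using J by (auto simp: jordan_decomposition_def)
  note c = center_commute[OF x J m]
  have "semisimple_mat (s + m)" using J'(2) m c(1) by (intro semisimple_add) (auto simp: center_def)
  then show "jordan_decomposition (s + m + n) (s + m) n"
    using J' c by (simp add: jordan_decomposition_def mmul_simps)
  have "x + m \<in> \<pp>" using x m p_closed by (auto simp: center_def)
  then show "s + m + n \<in> \<pp>" by (simp add: J'(1) add.commute add.left_commute)
  show "cp s \<subseteq> cp (s + m)" using m by (auto simp: cp_iff center_def mmul_simps)
qed

text \<open>Conjugating \<open>v\<close> by the inverse of \<open>g\<close> gives an element \<open>w = t + n\<close> whose semisimple part
  \<open>t\<close> has the same centralizer in \<open>\<pp>\<close> as \<open>s\<close>. Then \<open>s\<close> and \<open>t\<close> commute, and \<open>t - s\<close> is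
  semisimple and commutes with that centralizer.\<close>

lemma class_in_center_family:
  assumes x: "x \<in> \<pp>" and J: "jordan_decomposition x s n" and v: "v \<in> decomposition_class G \<theta> x"
  shows "\<exists>g\<in>K. \<exists>m\<in>center s. v = adjoint g (s + m + n)"
proof -
  obtain vs vn g where v': "v \<in> \<pp>" "jordan_decomposition v vs vn" "g \<in> K" "adjoint g ` cp s = cp vs" "adjoint g n = vn"
    using v unfolding class_iff[OF x J] by blast
  note A = adjoint_simps[OF K_group(5)[OF v'(3)]]
  have gi: "matrix_inv g \<in> K" by (rule K_group(1)[OF v'(3)])
  define t where "t = adjoint (matrix_inv g) vs"
  define w where "w = adjoint (matrix_inv g) v"
  have gt: "adjoint g t = vs" and gw: "adjoint g w = v" by (simp_all add: t_def w_def A)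
  have "adjoint g ` cp t = adjoint g ` cp s" using adjoint_cp[OF v'(3), of t] gt v'(4) by simp
  then have ct: "cp t = cp s" using A(9) by (metis inj_def inj_image_eq_iff)
  have Jw: "jordan_decomposition w t n"
    using jordan_adjoint[OF K_group(5)[OF gi] v'(2)] v'(5) A(7) by (auto simp: w_def t_def)
  have J': "x = s + n" "semisimple_mat s" using J by (auto simp: jordan_decomposition_def)
  have Jw': "w = t + n" "semisimple_mat t" using Jw by (auto simp: jordan_decomposition_def)
  have wp: "w \<in> \<pp>" using adjoint_p[OF gi v'(1)] by (simp add: w_def)
  have "t ** w = w ** t" using jordan_commute(1)[OF Jw, of w] by simp
  then have "w \<in> cp s" using wp ct by (auto simp: cp_iff)
  then have "t ** s = s ** t" using jordan_commute(1)[OF Jw, of s] by (simp add: cp_iff)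
  then have ss: "semisimple_mat (t - s)" by (rule semisimple_diff[OF Jw'(2) J'(2)])
  have "w - x \<in> \<pp>" using wp x p_closed by auto
  then have "t - s \<in> \<pp>" by (simp add: J'(1) Jw'(1))
  moreover have "Y ** (t - s) = (t - s) ** Y" if "Y \<in> cp s" for Y
  proof -
    have "Y \<in> cp t" using that ct by simp
    then show ?thesis using that by (simp add: cp_iff mmul_simps)
  qed
  ultimately have "t - s \<in> center s" using ss by (simp add: center_def)
  moreover have "v = adjoint g (s + (t - s) + n)" using gw Jw'(1) by simp
  ultimately show ?thesis using v'(3) by blast
qed

text \<open>The operator \<open>ad s\<close> is injective, hence bounded below, on the orthogonal complement of
  the centralizer in \<open>\<pp>\<close>, and this persists under small perturbations.\<close>

lemma cp_semicontinuous:
  assumes m: "cp s \<subseteq> cp m"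
  shows "\<exists>\<delta>>0. \<forall>\<tau>. cmod \<tau> < \<delta> \<longrightarrow> cp (s + smul \<tau> m) \<subseteq> cp s"
proof -
  define Q where "Q = \<pp> \<inter> {Y. \<forall>w\<in>cp s. Y \<bullet> w = 0}"
  have Q: "subspace Q" unfolding Q_def using p_subspace(1)
    by (auto simp: subspace_def inner_add_left)
  have "Y = 0" if Y: "Y \<in> Q" "ad s Y = 0" for Y
  proof -
    have "Y \<in> cp s" using Y by (simp add: Q_def cp_iff)
    then have "Y \<bullet> Y = 0" using Y(1) by (simp add: Q_def)
    then show ?thesis by simp
  qed
  then have "\<exists>e>0. \<forall>Y\<in>Q. norm (ad s Y) \<ge> e * norm Y"
    by (intro injective_imp_isometric closed_subspace Q bounded_linear_ad) blast
  then obtain e where e: "e > 0" "\<And>Y. Y \<in> Q \<Longrightarrow> e * norm Y \<le> norm (ad s Y)" by blast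
  obtain C where C: "C > 0" "\<And>Y. norm (ad m Y) \<le> norm Y * C"
    using bounded_linear.pos_bounded[OF bounded_linear_ad[of m]] by blast
  have "cp (s + smul \<tau> m) \<subseteq> cp s" if \<tau>: "cmod \<tau> < e / C" for \<tau>
  proof
    fix Y assume Y: "Y \<in> cp (s + smul \<tau> m)"
    obtain Y0 Y1 where Y01: "Y0 \<in> span (cp s)" "\<And>w. w \<in> span (cp s) \<Longrightarrow> orthogonal Y1 w" "Y = Y0 + Y1"
      using orthogonal_subspace_decomp_exists[of "cp s" Y] by metis
    have Y0: "Y0 \<in> cp s" using Y01(1) cp_subspace(1)[of s] by (metis span_eq_iff)
    have "Y1 = Y - Y0" using Y01(3) by simp
    then have "Y1 \<in> \<pp>" using Y Y0 p_closed by (auto simp: cp_iff)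
    then have Y1: "Y1 \<in> Q" using Y01(2) by (auto simp: Q_def orthogonal_def span_base)
    have "Y0 \<in> cp m" using m Y0 by blast
    then have "Y0 ** (s + smul \<tau> m) = (s + smul \<tau> m) ** Y0" using Y0 by (simp add: cp_iff mmul_simps)
    moreover have "Y ** (s + smul \<tau> m) = (s + smul \<tau> m) ** Y" using Y by (simp add: cp_iff)
    ultimately have "ad (s + smul \<tau> m) Y1 = 0"
      unfolding \<open>Y1 = Y - Y0\<close> mmul_simps(2,3) by simp
    then have "ad s Y1 = - smul \<tau> (ad m Y1)" by (simp add: mmul_simps smul_simps algebra_simps)
    moreover have "norm (smul \<tau> Z) = cmod \<tau> * norm Z" for Z :: "'n cmat"
      by (simp add: norm_vec_def smul_def norm_mult L2_set_right_distrib)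
    ultimately have "e * norm Y1 \<le> cmod \<tau> * norm (ad m Y1)" using e(2)[OF Y1] by simp
    also have "\<dots> \<le> cmod \<tau> * (norm Y1 * C)" by (intro mult_left_mono C) auto
    finally have "(e - cmod \<tau> * C) * norm Y1 \<le> 0" by (simp add: algebra_simps)
    moreover have "e - cmod \<tau> * C > 0" using \<tau> C(1) by (simp add: field_simps)
    ultimately have "Y1 = 0" by (metis mult_pos_pos not_less zero_less_norm_iff)
    then show "Y \<in> cp s" using Y0 Y01(3) by simp
  qed
  then show ?thesis using e(1) C(1) by (intro exI[of _ "e / C"]) auto
qed

text \<open>For small \<open>\<tau>\<close> the element \<open>s + \<tau> m\<close> has the same centralizer in \<open>\<pp>\<close> as \<open>s\<close>, so a
  polynomial function vanishing on the class vanishes at the conjugate of \<open>s + \<tau> m + n\<close>. It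
  depends polynomially on \<open>\<tau>\<close>, so it also vanishes for \<open>\<tau> = 1\<close>.\<close>

lemma center_family_in_closure:
  assumes x: "x \<in> \<pp>" and J: "jordan_decomposition x s n" and g: "g \<in> K" and m: "m \<in> center s"
    and f: "f \<in> poly_fun" "\<forall>A\<in>decomposition_class G \<theta> x. f A = 0"
  shows "f (adjoint g (s + m + n)) = 0"
proof -
  note A = adjoint_simps[OF K_group(5)[OF g]]
  have mc: "cp s \<subseteq> cp m" using m by (auto simp: cp_iff center_def)
  obtain \<delta> where \<delta>: "\<delta> > 0" "\<And>\<tau>. cmod \<tau> < \<delta> \<Longrightarrow> cp (s + smul \<tau> m) \<subseteq> cp s"
    using cp_semicontinuous[OF mc] by blast
  define h where "h = (\<lambda>\<tau>. adjoint g (s + smul \<tau> m + n))"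
  have "h \<tau> \<in> decomposition_class G \<theta> x" if \<tau>: "cmod \<tau> < \<delta>" for \<tau>
  proof -
    note cj = center_jordan[OF x J center_smul[OF m, of \<tau>]]
    have "cp (s + smul \<tau> m) = cp s" using \<delta>(2)[OF \<tau>] cj(3) by blast
    then have "adjoint g ` cp s = cp (adjoint g (s + smul \<tau> m))" using adjoint_cp[OF g, of "s + smul \<tau> m"] by simp
    then show ?thesis unfolding class_iff[OF x J] h_def
      using adjoint_p[OF g cj(2)] jordan_adjoint[OF K_group(5)[OF g] cj(1)] g by blast
  qed
  then have zero: "f (h \<tau>) = 0" if "cmod \<tau> < \<delta>" for \<tau> using f(2) that by blast
  have "h \<tau> = adjoint g (s + n) + smul \<tau> (adjoint g m)" for \<tau>
    unfolding h_def A(4)[symmetric] A(2)[symmetric] by (simp add: ac_simps)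
  then obtain p where p: "\<And>\<tau>. f (h \<tau>) = poly p \<tau>"
    using poly_fun_on_line[OF f(1), of "adjoint g (s + n)" "adjoint g m"] by metis
  have "p = 0"
  proof (rule ccontr)
    assume "p \<noteq> 0"
    from eventually_poly_nonzero[OF this, of 0] obtain d where d: "d > 0" "\<And>\<tau>. \<tau> \<noteq> 0 \<Longrightarrow> dist \<tau> 0 < d \<Longrightarrow> poly p \<tau> \<noteq> 0"
      unfolding eventually_at by blast
    define \<tau> where "\<tau> = complex_of_real (min d \<delta> / 2)"
    have "cmod \<tau> < \<delta>" "\<tau> \<noteq> 0" "dist \<tau> 0 < d" using d(1) \<delta>(1) by (auto simp: \<tau>_def min_def)
    then show False using d(2)[of \<tau>] zero[of \<tau>] p[of \<tau>] by simp
  qed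
  then have "f (h 1) = 0" using p by simp
  then show ?thesis by (simp add: h_def smul_simps)
qed

end

section \<open>Fitting decompositions\<close>

lemma linear_funpow: "linear T \<Longrightarrow> linear (T ^^ k)" for T :: "'a::real_vector \<Rightarrow> 'a"
  by (induction k) (auto intro: linear_compose linear_id)

text \<open>The images of \<open>V\<close> under the powers of \<open>T\<close> stabilize; from then on, subtracting an element
  of the stable image moves any vector into the kernel of a power.\<close>

lemma fitting:
  fixes T :: "'a::euclidean_space \<Rightarrow> 'a"
  assumes T: "linear T" and V: "subspace V" "T ` V \<subseteq> V"
  shows "\<exists>M>0. \<forall>v\<in>V. \<exists>b\<in>V. (T ^^ M) (v - (T ^^ M) b) = 0"
proof -
  have inv: "(T ^^ k) v \<in> V" if "v \<in> V" for k v using that V(2) by (induction k) auto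
  obtain M where M: "M > 0" "\<And>k. k > 0 \<Longrightarrow> dim ((T ^^ M) ` V) \<le> dim ((T ^^ k) ` V)"
  proof -
    define d where "d = (LEAST d. \<exists>k>0. dim ((T ^^ k) ` V) = d)"
    have "\<exists>k>0. dim ((T ^^ k) ` V) = d" unfolding d_def by (rule LeastI_ex) (auto intro: exI[of _ 1])
    then obtain M where "M > 0" "dim ((T ^^ M) ` V) = d" by blast
    moreover have "d \<le> dim ((T ^^ k) ` V)" if "k > 0" for k unfolding d_def by (rule Least_le) (use that in blast)
    ultimately show thesis using that by blast
  qed
  have sub: "(T ^^ (M + M)) ` V \<subseteq> (T ^^ M) ` V" using inv by (auto simp: funpow_add)
  have eq: "(T ^^ (M + M)) ` V = (T ^^ M) ` V"
    by (rule subspace_dim_equal[OF _ _ sub])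
      (use M V(1) in \<open>auto intro!: linear_subspace_image linear_funpow T\<close>)
  have "\<exists>b\<in>V. (T ^^ M) (v - (T ^^ M) b) = 0" if v: "v \<in> V" for v
  proof -
    obtain b where b: "b \<in> V" "(T ^^ M) v = (T ^^ (M + M)) b" using v eq by (metis image_iff image_eqI)
    then show ?thesis by (intro bexI[of _ b]) (auto simp: linear_diff[OF linear_funpow[OF T]] funpow_add)
  qed
  then show ?thesis using M(1) by blast
qed

lemma ad_funpow_commute:
  fixes v w :: "'n::finite cmat"
  assumes "v ** w = w ** v"
  shows "ad v ((ad w ^^ k) X) = (ad w ^^ k) (ad v X)"
proof (induction k)
  case (Suc k)
  have "ad v (ad w Y) = ad w (ad v Y)" for Y
  proof -
    have "ad v (ad w Y) - ad w (ad v Y) = (v ** w - w ** v) ** Y - Y ** (v ** w - w ** v)"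
      by (simp add: mmul_simps matrix_mul_assoc algebra_simps)
    then show ?thesis by (simp add: assms mmul_simps)
  qed
  then show ?case using Suc by simp
qed simp

text \<open>On the centralizer of \<open>s\<close> the operators \<open>ad w\<close> and \<open>ad n\<close> agree.\<close>

lemma jordan_ad_converse:
  assumes J: "jordan_decomposition w s n" and Y: "s ** Y = Y ** s"
  shows "\<exists>N. (ad w ^^ N) Y = 0"
proof -
  have J': "w = s + n" "nilpotent_mat n" "s ** n = n ** s" using J by (auto simp: jordan_decomposition_def)
  obtain k where "mpow n k = 0" using J'(2) by (auto simp: nilpotent_mat_mpow)
  from ad_nilpotent[OF this, of Y] have 1: "(ad n ^^ (k + k)) Y = 0" .
  have "(ad w ^^ j) Y = (ad n ^^ j) Y \<and> s ** (ad n ^^ j) Y = (ad n ^^ j) Y ** s" for j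
  proof (induction j)
    case (Suc j)
    have "ad s ((ad n ^^ Suc j) Y) = (ad n ^^ Suc j) (ad s Y)" by (rule ad_funpow_commute[OF J'(3)])
    also have "\<dots> = 0" using Y linear_0[OF linear_funpow[OF linear_ad[of n]]] by (simp del: funpow.simps)
    finally have "s ** (ad n ^^ Suc j) Y = (ad n ^^ Suc j) Y ** s" by simp
    moreover have "(ad w ^^ Suc j) Y = (ad n ^^ Suc j) Y"
      using Suc by (simp add: J'(1) mmul_simps)
    ultimately show ?case by simp
  qed (use Y in simp)
  then show ?thesis using 1 by metis
qed

text \<open>The kernel of \<open>ad y\<close> lies in that of \<open>ad t\<close>, which meets the range \<open>R\<close> of a large power
  of \<open>ad t\<close> in zero only. So \<open>ad y\<close> is injective on \<open>R\<close>, and so is \<open>ad w\<close> for \<open>w\<close> close to \<open>y\<close>.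
  If \<open>w\<close> commutes with \<open>t\<close>, then \<open>ad w\<close> respects the Fitting decomposition for \<open>ad t\<close>. A matrix
  that commutes with the semisimple part of \<open>w\<close> is killed by a power of \<open>ad w\<close>, hence has no
  component in \<open>R\<close>.\<close>

lemma centralizer_semicontinuous:
  fixes y :: "'n::finite cmat"
  assumes J: "jordan_decomposition y t n"
  shows "\<exists>\<delta>>0. \<forall>w ws wn Y. w ** t = t ** w \<and> norm (w - y) < \<delta> \<and> jordan_decomposition w ws wn \<and>
    ws ** Y = Y ** ws \<longrightarrow> t ** Y = Y ** t"
proof -
  have st: "semisimple_mat t" using J by (simp add: jordan_decomposition_def)
  obtain M where M: "M > 0" "\<And>v. \<exists>b. (ad t ^^ M) (v - (ad t ^^ M) b) = 0"
    using fitting[OF linear_ad[of t], of UNIV] by auto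
  define R where "R = range (ad t ^^ M)"
  have lin: "linear (ad t ^^ M)" by (rule linear_funpow[OF linear_ad])
  have R: "subspace R" unfolding R_def by (rule linear_subspace_image[OF lin subspace_UNIV])
  have kerR: "Z = 0" if Z: "Z \<in> R" "ad t Z = 0" for Z
  proof -
    obtain b where b: "Z = (ad t ^^ M) b" using Z(1) by (auto simp: R_def)
    then have "(ad t ^^ Suc M) b = 0" using Z(2) by simp
    from semisimple_kernel(2)[OF st this] have "ad t b = 0" by simp
    have "(ad t ^^ Suc (M - 1)) b = (ad t ^^ (M - 1)) (ad t b)" by (simp only: funpow_Suc_right o_apply)
    also have "\<dots> = 0" unfolding \<open>ad t b = 0\<close> by (rule linear_0[OF linear_funpow[OF linear_ad]])
    finally have "(ad t ^^ Suc (M - 1)) b = 0" .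
    then show ?thesis using b M(1) by (simp del: funpow.simps)
  qed
  have "Z = 0" if Z: "Z \<in> R" "ad y Z = 0" for Z
    using kerR[OF Z(1)] jordan_commute(1)[OF J, of Z] Z(2) by simp
  then have "\<exists>e>0. \<forall>Z\<in>R. norm (ad y Z) \<ge> e * norm Z"
    by (intro injective_imp_isometric closed_subspace R bounded_linear_ad) blast
  then obtain e where e: "e > 0" "\<And>Z. Z \<in> R \<Longrightarrow> e * norm Z \<le> norm (ad y Z)" by blast
  have "\<exists>C>0. \<forall>(A :: 'n cmat) (B :: 'n cmat). norm (A ** B) \<le> norm A * norm B * C"
    by (rule bounded_bilinear.pos_bounded[OF bounded_bilinear_mmul])
  then obtain C where C: "C > 0" "\<And>(A :: 'n cmat) (B :: 'n cmat). norm (A ** B) \<le> norm A * norm B * C" by blast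
  have "t ** Y = Y ** t"
    if w: "w ** t = t ** w" "norm (w - y) < e / (2 * C)" "jordan_decomposition w ws wn" "ws ** Y = Y ** ws" for w ws wn Y
  proof -
    have inj: "Z = 0" if Z: "Z \<in> R" "ad w Z = 0" for Z
    proof -
      have "ad y Z = - ((w - y) ** Z - Z ** (w - y))" using Z(2) by (simp add: mmul_simps)
      then have "e * norm Z \<le> norm ((w - y) ** Z - Z ** (w - y))" using e(2)[OF Z(1)] by (metis norm_minus_cancel)
      also have "\<dots> \<le> norm (w - y) * norm Z * C + norm Z * norm (w - y) * C"
        by (rule order.trans[OF norm_triangle_ineq4]) (intro add_mono C)
      finally have "(e - 2 * C * norm (w - y)) * norm Z \<le> 0" by (simp add: algebra_simps)
      moreover have "e - 2 * C * norm (w - y) > 0" using w(2) C(1) by (simp add: field_simps)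
      ultimately show ?thesis by (metis mult_pos_pos not_less zero_less_norm_iff)
    qed
    have wR: "(ad w ^^ k) Z \<in> R" if Z: "Z \<in> R" for k Z
    proof (induction k)
      case (Suc k)
      then obtain b where "(ad w ^^ k) Z = (ad t ^^ M) b" by (auto simp: R_def)
      then have "(ad w ^^ Suc k) Z = (ad t ^^ M) (ad w b)" using ad_funpow_commute[OF w(1)] by simp
      then show ?case by (auto simp: R_def)
    qed (use Z in simp)
    obtain b where b: "(ad t ^^ M) (Y - (ad t ^^ M) b) = 0" using M(2) by blast
    define Z where "Z = (ad t ^^ M) b"
    have ZR: "Z \<in> R" by (simp add: Z_def R_def)
    have tYZ: "ad t (Y - Z) = 0" using semisimple_kernel(2)[OF st b] by (simp add: Z_def)
    obtain N where N: "(ad w ^^ N) Y = 0" using jordan_ad_converse[OF w(3,4)] by blast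
    have "ad t ((ad w ^^ N) Z) = 0"
    proof -
      have "ad t ((ad w ^^ N) (Y - Z)) = (ad w ^^ N) (ad t (Y - Z))"
        by (rule ad_funpow_commute) (simp add: w(1))
      also have "\<dots> = 0" unfolding tYZ by (rule linear_0[OF linear_funpow[OF linear_ad]])
      finally have "ad t ((ad w ^^ N) Y - (ad w ^^ N) Z) = 0"
        by (simp add: linear_diff[OF linear_funpow[OF linear_ad]])
      then show ?thesis by (simp add: N mmul_simps)
    qed
    from kerR[OF wR[OF ZR] this] have N0: "(ad w ^^ N) Z = 0" .
    have "(ad w ^^ k) Z = 0 \<Longrightarrow> Z = 0" for k
    proof (induction k)
      case (Suc k)
      then show ?case using inj[OF wR[OF ZR, of k]] by simp
    qed simp
    then have "Z = 0" using N0 by blast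
    then show ?thesis using tYZ by simp
  qed
  then show ?thesis using e(1) C(1) by (intro exI[of _ "e / (2 * C)"]) auto
qed

section \<open>The exponential near zero\<close>

lemma entry_sum_le_norm:
  fixes X :: "'n::finite cmat"
  shows "entry_sum X \<le> real (CARD('n) * CARD('n)) * norm X"
proof -
  have "cmod (X $ i $ j) \<le> norm X" for i j
    by (rule order.trans[OF Finite_Cartesian_Product.norm_nth_le Finite_Cartesian_Product.norm_nth_le])
  then have "entry_sum X \<le> (\<Sum>i\<in>(UNIV :: 'n set). \<Sum>j\<in>(UNIV :: 'n set). norm X)"
    unfolding entry_sum_def by (intro sum_mono)
  then show ?thesis by simp
qed

lemma norm_le_entry_sum: "norm X \<le> entry_sum (X :: 'n::finite cmat)"
proof -
  have "norm X \<le> (\<Sum>i\<in>UNIV. norm (X $ i))" unfolding norm_vec_def[of X] by (rule L2_set_le_sum) simp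
  also have "\<dots> \<le> entry_sum X" unfolding entry_sum_def
    by (intro sum_mono) (auto simp: norm_vec_def intro!: L2_set_le_sum)
  finally show ?thesis .
qed

lemma continuous_mexp: "continuous_on UNIV (\<lambda>X :: 'n::finite cmat. mexp X 1)"
proof -
  have "continuous_on (ball 0 r) (\<lambda>X :: 'n cmat. \<Sum>k. (mpow X k $ i $ j / fact k) * 1 ^ k)" for i j r
  proof (rule uniform_limit_theorem)
    let ?B = "real (CARD('n) * CARD('n)) * r"
    show "uniform_limit (ball 0 r) (\<lambda>n X. \<Sum>k<n. (mpow X k $ i $ j / fact k) * 1 ^ k)
        (\<lambda>X :: 'n cmat. \<Sum>k. (mpow X k $ i $ j / fact k) * 1 ^ k) sequentially"
    proof (rule Weierstrass_m_test)
      show "summable (\<lambda>k. ?B ^ k /\<^sub>R fact k)" by (rule summable_exp_generic)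
      fix k and X :: "'n cmat" assume "X \<in> ball 0 r"
      then have "entry_sum X \<le> ?B"
        by (intro order.trans[OF entry_sum_le_norm] mult_left_mono) auto
      then have "entry_sum X ^ k /\<^sub>R fact k \<le> ?B ^ k /\<^sub>R fact k"
        by (intro scaleR_left_mono power_mono entry_sum_nonneg) auto
      moreover have "norm ((mpow X k $ i $ j / fact k) * 1 ^ k) \<le> entry_sum X ^ k /\<^sub>R fact k"
        using mexp_term_bound[of X k i j 1] by (simp only: norm_one mult_1_right)
      ultimately show "norm ((mpow X k $ i $ j / fact k) * 1 ^ k) \<le> ?B ^ k /\<^sub>R fact k" by (rule order.trans[rotated])
    qed
    have "(\<lambda>X :: 'n cmat. mpow X k $ i $ j) \<in> poly_fun" for k i j
    proof (induction k arbitrary: i j)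
      case (Suc k)
      then show ?case by (auto simp: mpow_Suc mmul_nth intro!: poly_fun_sum poly_fun.intros)
    qed (auto intro: poly_fun.const)
    then have c: "continuous_on (ball 0 r) (\<lambda>X :: 'n cmat. mpow X k $ i $ j)" for k
      using poly_fun_continuous continuous_on_subset by blast
    then show "\<forall>\<^sub>F n in sequentially. continuous_on (ball 0 r) (\<lambda>X :: 'n cmat. \<Sum>k<n. (mpow X k $ i $ j / fact k) * 1 ^ k)"
      by (intro always_eventually allI continuous_on_sum continuous_on_mult continuous_on_divide
          continuous_on_const c) auto
  qed simp
  then have *: "continuous_on (ball 0 r) (\<lambda>X :: 'n cmat. mexp X 1)" for r
    unfolding mexp_def by (intro continuous_on_vec_lambda)
  have "isCont (\<lambda>X. mexp X 1) X" for X :: "'n cmat"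
  proof -
    have "\<forall>x\<in>ball 0 (norm X + 1). isCont (\<lambda>X :: 'n cmat. mexp X 1) x"
      using *[of "norm X + 1"] continuous_on_eq_continuous_at[OF open_ball] by blast
    then show ?thesis by simp
  qed
  then show ?thesis by (simp add: continuous_on_eq_continuous_at)
qed

lemma mexp_zero [simp]: "mexp 0 t = mat 1"
  using mexp_smul[of 0 0 t] by (simp add: smul_simps)

text \<open>The terms of the exponential series of degree two and more are quadratically small.\<close>

lemma mexp_derivative_at_zero: "((\<lambda>X :: 'n::finite cmat. mexp X 1) has_derivative (\<lambda>X. X)) (at 0)"
proof (rule has_derivativeI_sandwich[of 1])
  let ?N = "real (CARD('n) * CARD('n))"
  let ?H = "\<lambda>X :: 'n cmat. ?N * (?N ^ 2 * norm X * exp (?N * norm X))"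
  have "(?H \<longlongrightarrow> ?N * (?N ^ 2 * norm (0 :: 'n cmat) * exp (?N * norm (0 :: 'n cmat)))) (at 0)" by (intro tendsto_intros)
  then show "(?H \<longlongrightarrow> 0) (at 0)" by simp
  fix X :: "'n cmat" assume X: "X \<noteq> 0"
  define B where "B = entry_sum X"
  have B: "B \<ge> 0" "B \<le> ?N * norm X" by (simp_all add: B_def entry_sum_nonneg entry_sum_le_norm del: of_nat_mult)
  define D where "D = mexp X 1 - mexp 0 1 - (X - 0)"
  have "cmod (D $ i $ j) \<le> B ^ 2 * exp B" for i j
  proof -
    let ?c = "\<lambda>k. (mpow X k $ i $ j / fact k) * 1 ^ k"
    have "mexp X 1 $ i $ j = (\<Sum>k. ?c (k + 2)) + (\<Sum>k<2. ?c k)"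
      unfolding mexp_def vec_lambda_beta by (rule suminf_split_initial_segment[OF mexp_summable])
    moreover have "(\<Sum>k<2. ?c k) = mat 1 $ i $ j + X $ i $ j"
      by (simp add: numeral_2_eq_2 mpow_Suc)
    ultimately have "D $ i $ j = (\<Sum>k. ?c (k + 2))" by (simp add: D_def)
    also have "cmod \<dots> \<le> (\<Sum>k. B ^ 2 * (B ^ k /\<^sub>R fact k))"
    proof (rule norm_suminf_le)
      show "summable (\<lambda>k. B ^ 2 * (B ^ k /\<^sub>R fact k))" by (intro summable_mult summable_exp_generic)
      fix k
      have "norm (?c (k + 2)) \<le> B ^ (k + 2) /\<^sub>R fact (k + 2)" using mexp_term_bound[of X "k + 2" i j 1] by (simp add: B_def)
      also have "\<dots> = B ^ (k + 2) / fact (k + 2)" by (simp add: divide_inverse mult.commute)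
      also have "\<dots> \<le> B ^ (k + 2) / fact k"
        using B(1) by (intro divide_left_mono fact_mono mult_pos_pos) auto
      also have "\<dots> = B ^ 2 * (B ^ k /\<^sub>R fact k)" by (simp add: power_add divide_inverse power2_eq_square)
      finally show "norm (?c (k + 2)) \<le> B ^ 2 * (B ^ k /\<^sub>R fact k)" .
    qed
    also have "\<dots> = B ^ 2 * exp B" unfolding exp_def by (rule suminf_mult[OF summable_exp_generic])
    finally show ?thesis .
  qed
  then have "entry_sum D \<le> (\<Sum>i\<in>(UNIV :: 'n set). \<Sum>j\<in>(UNIV :: 'n set). B ^ 2 * exp B)"
    unfolding entry_sum_def by (intro sum_mono)
  then have "norm D \<le> ?N * (B ^ 2 * exp B)" using norm_le_entry_sum[of D] by (simp add: algebra_simps)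
  also have "\<dots> \<le> ?N * ((?N * norm X) ^ 2 * exp (?N * norm X))"
    using B by (intro mult_left_mono mult_mono power_mono) auto
  also have "\<dots> = ?H X * norm X" by (simp add: power2_eq_square mult_ac)
  finally show "norm (mexp X 1 - mexp 0 1 - (X - 0)) / norm (X - 0) \<le> ?H X"
    using X by (simp add: D_def divide_le_eq)
qed (auto intro: bounded_linear_ident)

section \<open>Conjugates of a centralizer near a point\<close>

context symmetric_pair
begin

text \<open>The commutator with \<open>y\<close> interchanges \<open>\<pp>\<close> and the Lie algebra of \<open>K\<close>, so its square acts
  on \<open>\<pp>\<close> and the Fitting decomposition applies. The part in the image of a power is of the form
  \<open>ad y \<xi>\<close>, and the part killed by a power of \<open>ad y\<close> commutes with the semisimple part \<open>t\<close>.\<close>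

lemma p_decomposition:
  assumes y: "y \<in> \<pp>" and J: "jordan_decomposition y t n" and Y: "Y \<in> \<pp>"
  shows "\<exists>\<xi>\<in>eigenspace 1. \<exists>v\<in>cp t. \<xi> ** y - y ** \<xi> + v = Y"
proof -
  let ?T = "ad y ^^ 2"
  have pk: "ad y X \<in> eigenspace 1" if "X \<in> \<pp>" for X
    using bracket_eigenspace[of y "-1" X "-1"] y that by (simp add: anisotropic_eq)
  have kp: "ad y X \<in> \<pp>" if "X \<in> eigenspace 1" for X
    using bracket_eigenspace[of y "-1" X 1] y that by (simp add: anisotropic_eq)
  have T: "linear ?T" by (rule linear_funpow[OF linear_ad])
  have T': "?T ` \<pp> \<subseteq> \<pp>" using pk kp by (auto simp: numeral_2_eq_2)
  obtain M b where M: "M > 0" "b \<in> \<pp>" "(?T ^^ M) (Y - (?T ^^ M) b) = 0"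
    using fitting[OF T p_subspace(1) T'] Y by blast
  have inv: "(?T ^^ k) X \<in> \<pp>" if "X \<in> \<pp>" for k X using that T' by (induction k) auto
  define v where "v = Y - (?T ^^ M) b"
  have "(ad y ^^ (2 * M)) v = 0" using M(3) by (simp only: v_def funpow_mult[symmetric])
  from jordan_ad[OF J this] have "v \<in> cp t" using inv[OF M(2)] Y p_closed by (simp add: cp_iff v_def)
  moreover have "(?T ^^ M) b = ad y (ad y ((?T ^^ (M - 1)) b))"
    using M(1) by (cases M) (auto simp: numeral_2_eq_2)
  moreover define \<xi> where "\<xi> = - ad y ((?T ^^ (M - 1)) b)"
  have "\<xi> \<in> eigenspace 1" unfolding \<xi>_def
    using pk[OF inv[OF M(2)]] subspace_neg[OF eigenspace_subspace(1)] by blast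
  moreover have "\<xi> ** y - y ** \<xi> = ad y (- \<xi>)" by (simp add: mmul_simps)
  ultimately show ?thesis by (intro bexI[of _ \<xi>] bexI[of _ v]) (auto simp: \<xi>_def v_def)
qed

text \<open>By the decomposition of \<open>\<pp>\<close> just proved, the map sending a small \<open>\<xi>\<close> in the Lie algebra
  of \<open>K\<close> and a small \<open>v\<close> commuting with \<open>t\<close> to the conjugate of \<open>y + v\<close> by the exponential of
  \<open>\<xi>\<close> is a submersion at zero, so it is open there.\<close>

lemma local_slice:
  assumes y: "y \<in> \<pp>" and J: "jordan_decomposition y t n" and \<epsilon>: "\<epsilon> > 0"
  shows "\<exists>\<delta>>0. \<forall>w\<in>\<pp>. norm (w - y) < \<delta> \<longrightarrow> (\<exists>g\<in>K. \<exists>u\<in>cp t. norm (u - y) < \<epsilon> \<and> w = adjoint g u)"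
proof -
  define f where "f = (\<lambda>q :: 'n cmat \<times> 'n cmat. fst q ** y - y ** fst q + snd q)"
  have f: "linear f" unfolding f_def by (rule linearI) (auto simp: mmul_simps scaleR_smul smul_simps)
  have sub: "subspace (eigenspace 1 \<times> cp t)"
    by (rule subspace_Times[OF eigenspace_subspace(1) cp_subspace(1)])
  obtain R where R: "range R \<subseteq> eigenspace 1 \<times> cp t" "linear R" "\<And>v. v \<in> f ` (eigenspace 1 \<times> cp t) \<Longrightarrow> f (R v) = v"
    using linear_exists_right_inverse_on[OF f sub] by blast
  have fR: "f (R v) = v" if "v \<in> \<pp>" for v
    using p_decomposition[OF y J that] by (intro R(3)) (force simp: f_def)
  obtain \<pi> where \<pi>: "range \<pi> \<subseteq> \<pp>" "linear \<pi>" "\<And>v. v \<in> \<pp> \<Longrightarrow> \<pi> v = v"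
    using linear_exists_right_inverse_on[OF linear_id p_subspace(1)] by auto
  define a b where "a = (\<lambda>c. fst (R (\<pi> c)))" and "b = (\<lambda>c. snd (R (\<pi> c)))"
  have lin: "bounded_linear a" "bounded_linear b" "bounded_linear \<pi>"
    unfolding a_def b_def linear_conv_bounded_linear[symmetric]
    by (auto intro!: linearI simp: linear_add[OF \<pi>(2)] linear_add[OF R(2)] linear_cmul[OF \<pi>(2)] linear_cmul[OF R(2)])
  have a0: "a 0 = 0" and b0: "b 0 = 0" and \<pi>0: "\<pi> 0 = 0"
    using lin[THEN bounded_linear.linear, THEN linear_0] by auto
  have ak: "a c \<in> eigenspace 1" and bt: "b c \<in> cp t" for c
    using R(1) unfolding a_def b_def by (metis mem_Times_iff rangeI subsetD)+
  have ab: "a c ** y - y ** a c + b c = \<pi> c" for c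
    using fR[of "\<pi> c"] \<pi>(1) by (auto simp: f_def a_def b_def)
  \<comment> \<open>The last summand extends the map from \<open>\<pp>\<close> to all matrices, so that the derivative at zero
    is the identity; it vanishes wherever the value of the map is in \<open>\<pp>\<close>.\<close>
  define \<Psi> where "\<Psi> = (\<lambda>c. mexp (a c) 1 ** (y + b c) ** mexp (- a c) 1 + (c - \<pi> c))"
  have der_a: "((\<lambda>c. mexp (a c) 1) has_derivative a) (at 0)"
    using has_derivative_compose[OF bounded_linear_imp_has_derivative[OF lin(1)], of "\<lambda>X. mexp X 1" "\<lambda>X. X" 0]
      mexp_derivative_at_zero a0 by simp
  have "((\<lambda>c. - a c) has_derivative (\<lambda>c. - a c)) (at 0)"
    by (intro has_derivative_minus bounded_linear_imp_has_derivative lin)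
  from has_derivative_compose[OF this, of "\<lambda>X. mexp X 1" "\<lambda>X. X"]
  have der_a': "((\<lambda>c. mexp (- a c) 1) has_derivative (\<lambda>c. - a c)) (at 0)"
    using mexp_derivative_at_zero a0 by simp
  have der_b: "((\<lambda>c. y + b c) has_derivative b) (at 0)"
    using has_derivative_add[OF has_derivative_const bounded_linear_imp_has_derivative[OF lin(2)]] by simp
  note product = bounded_bilinear.FDERIV[OF bounded_bilinear_mmul]
  have "(\<Psi> has_derivative (\<lambda>c. (mexp (a 0) 1 ** (y + b 0)) ** (- a c) + (mexp (a 0) 1 ** b c + a c ** (y + b 0)) ** mexp (- a 0) 1
      + (c - \<pi> c))) (at 0)" unfolding \<Psi>_def
    by (intro has_derivative_add has_derivative_diff has_derivative_ident product der_a der_a' der_b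
        bounded_linear_imp_has_derivative lin)
  moreover have "(mexp (a 0) 1 ** (y + b 0)) ** (- a c) + (mexp (a 0) 1 ** b c + a c ** (y + b 0)) ** mexp (- a 0) 1
      + (c - \<pi> c) = c" for c
    using ab[of c] by (simp add: a0 b0 mmul_simps algebra_simps)
  ultimately have der: "(\<Psi> has_derivative id) (at 0)" by (simp add: id_def)
  have cont: "continuous_on UNIV \<Psi>" unfolding \<Psi>_def
    by (intro continuous_intros bounded_bilinear.continuous_on[OF bounded_bilinear_mmul]
        continuous_on_compose2[OF continuous_mexp] linear_continuous_on lin) auto
  obtain B where B: "B > 0" "\<And>c. norm (b c) \<le> norm c * B"
    using bounded_linear.pos_bounded[OF lin(2)] by blast
  have "\<Psi> 0 \<in> interior (\<Psi> ` ball 0 (\<epsilon> / B))"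
    by (rule sussmann_open_mapping[OF open_UNIV cont _ der bounded_linear_ident])
      (use \<epsilon> B(1) in \<open>auto simp: id_def o_def\<close>)
  moreover have "\<Psi> 0 = y" by (simp add: \<Psi>_def a0 b0 \<pi>0)
  ultimately obtain \<delta> where \<delta>: "\<delta> > 0" "ball y \<delta> \<subseteq> \<Psi> ` ball 0 (\<epsilon> / B)" by (auto simp: mem_interior)
  have "\<exists>g\<in>K. \<exists>u\<in>cp t. norm (u - y) < \<epsilon> \<and> w = adjoint g u" if w: "w \<in> \<pp>" "norm (w - y) < \<delta>" for w
  proof -
    have "w \<in> ball y \<delta>" using w(2) by (simp add: dist_norm norm_minus_commute)
    then obtain c where c: "norm c < \<epsilon> / B" "w = \<Psi> c" using \<delta>(2) by auto
    define g where "g = mexp (a c) 1"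
    have g: "g \<in> K" using mexp_in_K[OF ak, of c 1] by (simp add: g_def)
    have yt: "y \<in> cp t" using y jordan_commute(1)[OF J, of y] by (simp add: cp_iff)
    define u where "u = y + b c"
    have u: "u \<in> cp t" unfolding u_def by (rule subspace_add[OF cp_subspace(1) yt bt])
    have "mexp (- a c) 1 = matrix_inv g" using mexp_smul[of "-1" "a c" 1] by (simp add: g_def mexp_invertible smul_simps)
    then have wu: "w = adjoint g u + (c - \<pi> c)" by (simp add: c(2) \<Psi>_def adjoint_def g_def u_def)
    have "adjoint g u \<in> \<pp>" using adjoint_p[OF g] u by (simp add: cp_iff)
    then have cp: "c - \<pi> c \<in> \<pp>" using p_closed(2)[OF w(1), of "adjoint g u"] wu by simp
    have "\<pi> (c - \<pi> c) = 0" using \<pi>(3)[of "\<pi> c"] \<pi>(1) by (simp add: linear_diff[OF \<pi>(2)] range_subsetD)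
    then have "c - \<pi> c = 0" using \<pi>(3)[OF cp] by simp
    moreover have "norm (u - y) < \<epsilon>"
      using B(2)[of c] c(1) B(1) by (simp add: u_def field_simps)
    ultimately show ?thesis using wu g u by auto
  qed
  then show ?thesis using \<delta>(1) by blast
qed

end

section \<open>Closures of decomposition classes\<close>

lemma polyfun_to_poly_fun:
  assumes "Q \<in> polyfun (UNIV :: ('n::finite \<times> 'n) set)"
  shows "(\<lambda>A :: 'n::finite cmat. Q (\<lambda>p. A $ fst p $ snd p)) \<in> poly_fun"
  using assms by (induction rule: polyfun.induct) (auto intro: poly_fun.intros)

lemma poly_fun_to_polyfun:
  fixes \<Phi> :: "('v \<Rightarrow> complex) \<Rightarrow> 'n::finite cmat"
  assumes "f \<in> poly_fun" "\<And>i j. (\<lambda>x. \<Phi> x $ i $ j) \<in> polyfun V"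
  shows "(\<lambda>x. f (\<Phi> x)) \<in> polyfun V"
  using assms(1) by (induction rule: poly_fun.induct) (auto intro: polyfun.intros assms(2))

context symmetric_pair
begin

text \<open>This family contains the decomposition class of \<open>s + n\<close> as a Zariski dense subset. Unlike
  the class itself, it is visibly the image of an algebraic set.\<close>

definition class_family :: "'n cmat \<Rightarrow> 'n cmat \<Rightarrow> 'n cmat set" where
  "class_family s n = {adjoint g (s + m + n) | g m. g \<in> K \<and> m \<in> center s}"

lemma class_family_adjoint:
  assumes g: "g \<in> K" and v: "v \<in> class_family s n" shows "adjoint g v \<in> class_family s n"
proof -
  obtain h m where h: "h \<in> K" "m \<in> center s" "v = adjoint h (s + m + n)" using v unfolding class_family_def by blast
  have "adjoint g v = adjoint (g ** h) (s + m + n)"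
    unfolding h(3) by (rule adjoint_adjoint[OF K_group(5)[OF g] K_group(5)[OF h(1)]])
  then show ?thesis using K_group(2)[OF g h(1)] h(2) unfolding class_family_def by blast
qed

text \<open>The family is the image of an algebraic set under the polynomial map \<open>\<Phi>\<close>. The coordinates
  of the source are the entries of a group element, those of its inverse, and the coefficients
  of \<open>m\<close> in a basis of \<open>center s\<close>.\<close>

lemma class_family_limit:
  assumes x: "x \<in> \<pp>" and J: "jordan_decomposition x s n"
    and y: "y \<in> zariski closure_of decomposition_class G \<theta> x" and \<epsilon>: "\<epsilon> > 0"
  shows "\<exists>v\<in>class_family s n. norm (v - y) < \<epsilon>"
proof -
  have sub: "subspace (center s)" unfolding subspace_def
    using center_add[OF x J] center_smul[of _ s] center_smul[of _ s 0]
  proof (intro conjI ballI allI)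
    have "semisimple_mat (0 :: 'n cmat)" using x J semisimple_smul[of s 0] by (simp add: jordan_decomposition_def smul_simps)
    then show "0 \<in> center s" using p_closed(3) by (simp add: center_def mmul_simps)
  qed (simp_all add: scaleR_smul)
  obtain B where B: "B \<subseteq> center s" "independent B" "center s \<subseteq> span B"
    using maximal_independent_subset[of "center s"] by metis
  have finB: "finite B" by (rule independent_imp_finite[OF B(2)])
  define V where "V = Inl ` B \<union> Inr ` (UNIV :: (bool \<times> 'n \<times> 'n) set)"
  have V: "finite V" using finB by (simp add: V_def)
  define gm where "gm = (\<lambda>e (z :: 'n cmat + bool \<times> 'n \<times> 'n \<Rightarrow> complex). (\<chi> i j. z (Inr (e, i, j))) :: 'n cmat)"
  define mm where "mm = (\<lambda>z :: 'n cmat + bool \<times> 'n \<times> 'n \<Rightarrow> complex. \<Sum>b\<in>B. smul (z (Inl b)) b)"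
  define \<Phi> where "\<Phi> = (\<lambda>z. gm True z ** (s + mm z + n) ** gm False z)"
  have gm_poly: "(\<lambda>z. gm e z $ i $ j) \<in> polyfun V" for e i j
    by (auto simp: gm_def V_def intro: polyfun.coord)
  have mm_poly: "(\<lambda>z. mm z $ i $ j) \<in> polyfun V" for i j
    unfolding mm_def sum_component smul_nth V_def
    by (intro polyfun_sum polyfun.mult polyfun.coord polyfun.const) simp
  have \<Phi>_poly: "(\<lambda>z. \<Phi> z $ i $ j) \<in> polyfun V" for i j
    unfolding \<Phi>_def mmul_nth vector_add_component
    by (intro polyfun_sum polyfun.mult gm_poly polyfun.add mm_poly polyfun.const)
  obtain S where S: "S \<subseteq> poly_fun" "K = {A. invertible A \<and> (\<forall>f\<in>S. f A = 0)}" using K_equations by blast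
  define J1 where "J1 = (\<lambda>(i, j). (\<lambda>z. (gm True z ** gm False z) $ i $ j - mat 1 $ i $ j)) ` UNIV"
  define J2 where "J2 = (\<lambda>f z. f (gm True z)) ` S"
  have "(\<lambda>z. (gm True z ** gm False z) $ i $ j - mat 1 $ i $ j) \<in> polyfun V" for i j
    unfolding mmul_nth by (intro polyfun_diff polyfun_sum polyfun.mult gm_poly polyfun.const)
  then have "J1 \<subseteq> polyfun V" by (auto simp: J1_def)
  moreover have "(\<lambda>z. f (gm True z)) \<in> polyfun V" if "f \<in> S" for f
    by (rule poly_fun_to_polyfun[where \<Phi> = "gm True", OF subsetD[OF S(1) that] gm_poly])
  then have "J2 \<subseteq> polyfun V" by (auto simp: J2_def)
  ultimately have J12: "J1 \<union> J2 \<subseteq> polyfun V" by simp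
  have locus: "z \<in> zero_locus (J1 \<union> J2) \<longleftrightarrow> gm True z ** gm False z = mat 1 \<and> (\<forall>f\<in>S. f (gm True z) = 0)" for z
  proof -
    have "(\<forall>Q\<in>J1. Q z = 0) \<longleftrightarrow> gm True z ** gm False z = mat 1"
      unfolding J1_def vec_eq_iff by (simp add: case_prod_beta)
    moreover have "(\<forall>Q\<in>J2. Q z = 0) \<longleftrightarrow> (\<forall>f\<in>S. f (gm True z) = 0)"
      unfolding J2_def by simp
    ultimately show ?thesis by (simp add: ball_Un)
  qed
  have center_mm: "mm z \<in> center s" for z
  proof -
    have "smul (z (Inl b)) b \<in> center s" if "b \<in> B" for b using B(1) that center_smul by blast
    then show ?thesis unfolding mm_def by (rule subspace_sum[OF sub])
  qed
  have in_family: "\<Phi> z \<in> class_family s n" if z: "z \<in> zero_locus (J1 \<union> J2)" for z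
  proof -
    have gg: "gm True z ** gm False z = mat 1" "\<forall>f\<in>S. f (gm True z) = 0" using z locus by auto
    have "gm True z \<in> K" using S(2) minvI(1)[OF gg(1)] gg(2) by simp
    moreover have "\<Phi> z = adjoint (gm True z) (s + mm z + n)" by (simp add: \<Phi>_def adjoint_def minvI(2)[OF gg(1)])
    ultimately show ?thesis using center_mm unfolding class_family_def by blast
  qed
  have surj: "\<exists>z\<in>zero_locus (J1 \<union> J2). v = \<Phi> z" if v: "v \<in> class_family s n" for v
  proof -
    obtain g m where g: "g \<in> K" "m \<in> center s" "v = adjoint g (s + m + n)" using v unfolding class_family_def by blast
    obtain r where r: "m = (\<Sum>b\<in>B. r b *\<^sub>R b)" using B(3) g(2) span_finite[OF finB] by auto
    define z where "z = (\<lambda>k. case k of Inl b \<Rightarrow> complex_of_real (r b)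
      | Inr (e, i, j) \<Rightarrow> (if e then g $ i $ j else matrix_inv g $ i $ j))"
    have gz: "gm True z = g" "gm False z = matrix_inv g" by (auto simp: gm_def z_def vec_eq_iff)
    have "mm z = m" unfolding mm_def r by (simp add: z_def scaleR_smul)
    then have "v = \<Phi> z" using g(3) gz by (simp add: \<Phi>_def adjoint_def)
    moreover have "z \<in> zero_locus (J1 \<union> J2)" unfolding locus gz
      using g(1) S(2) minv(1)[OF K_group(5)[OF g(1)]] by auto
    ultimately show ?thesis by blast
  qed
  define N where "N = real (CARD('n) * CARD('n))"
  have N: "N > 0" by (simp add: N_def)
  have "\<exists>z\<in>zero_locus (J1 \<union> J2). \<forall>p. cmod (\<Phi> z $ fst p $ snd p - y $ fst p $ snd p) < \<epsilon> / N"
  proof (rule zariski_limit_is_limit[OF V _ J12, where \<phi> = "\<lambda>p z. \<Phi> z $ fst p $ snd p" and y = "\<lambda>p. y $ fst p $ snd p"])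
    show "(\<lambda>z. \<Phi> z $ fst p $ snd p) \<in> polyfun V" for p by (rule \<Phi>_poly)
    show "\<epsilon> / N > 0" using \<epsilon> N by simp
    fix Q assume Q: "Q \<in> polyfun UNIV" "\<And>z. z \<in> zero_locus (J1 \<union> J2) \<Longrightarrow> Q (\<lambda>p. \<Phi> z $ fst p $ snd p) = 0"
    have "Q (\<lambda>p. A $ fst p $ snd p) = 0" if A: "A \<in> decomposition_class G \<theta> x" for A
    proof -
      have "A \<in> class_family s n"
        using class_in_center_family[OF x J A] unfolding class_family_def by blast
      from surj[OF this] obtain z where z: "z \<in> zero_locus (J1 \<union> J2)" "A = \<Phi> z" ..
      show ?thesis unfolding z(2) by (rule Q(2)[OF z(1)])
    qed
    then show "Q (\<lambda>p. y $ fst p $ snd p) = 0"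
      using bspec[OF y[unfolded in_zariski_closure] polyfun_to_poly_fun[OF Q(1)]] by simp
  qed
  then obtain z where z: "z \<in> zero_locus (J1 \<union> J2)"
    "\<forall>p. cmod (\<Phi> z $ fst p $ snd p - y $ fst p $ snd p) < \<epsilon> / N" ..
  have "norm (\<Phi> z - y) \<le> entry_sum (\<Phi> z - y)" by (rule norm_le_entry_sum)
  also have "\<dots> < (\<Sum>i\<in>(UNIV :: 'n set). \<Sum>j\<in>(UNIV :: 'n set). \<epsilon> / N)"
    unfolding entry_sum_def by (intro sum_strict_mono) (use z(2)[rule_format, of "(_, _)"] in auto)
  also have "\<dots> = \<epsilon>" using N by (simp add: N_def)
  finally show ?thesis using in_family[OF z(1)] by blast
qed

text \<open>Write \<open>y = t + r\<close>. Up to conjugation \<open>v\<close> is \<open>y + m\<close> with \<open>m\<close> in \<open>center t\<close>. Points of the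
  family close to \<open>y\<close> can be conjugated into the centralizer of \<open>t\<close>, staying close to \<open>y\<close>.
  There the centralizer of their semisimple part is contained in that of \<open>t\<close>, so that \<open>m\<close>
  commutes with it and adding \<open>m\<close> does not lead out of the family. In the limit \<open>y + m\<close> is in
  the closure.\<close>

lemma class_closure_invariant:
  assumes x: "x \<in> \<pp>" and y: "y \<in> \<pp>" "y \<in> zariski closure_of decomposition_class G \<theta> x"
    and v: "v \<in> decomposition_class G \<theta> y"
  shows "v \<in> zariski closure_of decomposition_class G \<theta> x"
proof -
  obtain s n where J: "jordan_decomposition x s n" using jordan_exists by blast
  obtain t r where J': "jordan_decomposition y t r" using jordan_exists by blast
  have y': "y = t + r" using J' by (simp add: jordan_decomposition_def)
  obtain h m where h: "h \<in> K" "m \<in> center t" "v = adjoint h (t + m + r)"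
    using class_in_center_family[OF y(1) J' v] by blast
  have v': "v = adjoint h (y + m)" using h(3) y' by (simp add: ac_simps)
  obtain \<delta> where \<delta>: "\<delta> > 0" "\<And>w ws wn Y. w ** t = t ** w \<Longrightarrow> norm (w - y) < \<delta> \<Longrightarrow> jordan_decomposition w ws wn \<Longrightarrow>
    ws ** Y = Y ** ws \<Longrightarrow> t ** Y = Y ** t"
    using centralizer_semicontinuous[OF J'] by blast
  have translate: "u + m \<in> class_family s n"
    if u: "u \<in> class_family s n" "u \<in> cp t" "norm (u - y) < \<delta>" for u
  proof -
    obtain g m1 where g: "g \<in> K" "m1 \<in> center s" "u = adjoint g (s + m1 + n)" using u(1) unfolding class_family_def by blast
    note A = adjoint_simps[OF K_group(5)[OF g(1)]]
    note cj = center_jordan[OF x J g(2)]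
    have Ju: "jordan_decomposition u (adjoint g (s + m1)) (adjoint g n)"
      unfolding g(3) by (rule jordan_adjoint[OF K_group(5)[OF g(1)] cj(1)])
    define m2 where "m2 = adjoint (matrix_inv g) m"
    have gm2: "adjoint g m2 = m" by (simp add: m2_def A)
    have "m2 \<in> center s" unfolding center_def
    proof (intro CollectI conjI ballI)
      show "m2 \<in> \<pp>" using adjoint_p_iff[OF g(1), of m2] gm2 h(2) by (simp add: center_def)
      have "jordan_decomposition m m 0" using h(2)
        by (auto simp: jordan_decomposition_def center_def nilpotent_mat_mpow mmul_simps intro!: exI[of _ 1] simp: mpow_Suc)
      then have "jordan_decomposition m2 m2 (adjoint (matrix_inv g) 0)"
        unfolding m2_def by (rule jordan_adjoint[OF K_group(5)[OF K_group(1)[OF g(1)]]])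
      then show "semisimple_mat m2" by (simp add: jordan_decomposition_def)
      fix Y assume Y: "Y \<in> cp s"
      have "Y \<in> cp (s + m1)" using Y cj(3) by blast
      then have gY: "adjoint g Y \<in> cp (adjoint g (s + m1))" using adjoint_cp[OF g(1)] by blast
      have "t ** adjoint g Y = adjoint g Y ** t"
        by (rule \<delta>(2)[OF _ u(3) Ju]) (use u(2) gY in \<open>auto simp: cp_iff\<close>)
      then have "adjoint g Y \<in> cp t" using gY by (simp add: cp_iff)
      then have "adjoint g Y ** adjoint g m2 = adjoint g m2 ** adjoint g Y" using h(2) gm2 by (simp add: center_def)
      then have "adjoint g (Y ** m2) = adjoint g (m2 ** Y)" by (simp add: A(1))
      then show "Y ** m2 = m2 ** Y" by (simp add: A(9))
    qed
    then have "m1 + m2 \<in> center s" by (rule center_add[OF x J g(2)])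
    moreover have "u + m = adjoint g (s + (m1 + m2) + n)"
      unfolding g(3) gm2[symmetric] A(2)[symmetric] by (simp add: ac_simps)
    ultimately show ?thesis using g(1) unfolding class_family_def by blast
  qed
  show ?thesis unfolding in_zariski_closure
  proof (intro ballI impI)
    fix f assume f: "f \<in> poly_fun" "\<forall>A\<in>decomposition_class G \<theta> x. f A = 0"
    have fam: "f A = 0" if "A \<in> class_family s n" for A
      using that center_family_in_closure[OF x J _ _ f] unfolding class_family_def by blast
    have near: "\<exists>u\<in>class_family s n. u + m \<in> class_family s n \<and> norm (u - y) < \<epsilon>" if \<epsilon>: "\<epsilon> > 0" for \<epsilon>
    proof -
      have "min \<epsilon> \<delta> > 0" using \<epsilon> \<delta>(1) by simp
      from local_slice[OF y(1) J' this] obtain \<eta> where \<eta>: "\<eta> > 0" "\<And>w. w \<in> \<pp> \<Longrightarrow> norm (w - y) < \<eta> \<Longrightarrow>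
          \<exists>g\<in>K. \<exists>u\<in>cp t. norm (u - y) < min \<epsilon> \<delta> \<and> w = adjoint g u"
        by metis
      obtain w where w: "w \<in> class_family s n" "norm (w - y) < \<eta>"
        using class_family_limit[OF x J y(2) \<eta>(1)] by blast
      obtain g0 m0 where "g0 \<in> K" "m0 \<in> center s" "w = adjoint g0 (s + m0 + n)" using w(1) unfolding class_family_def by blast
      then have "w \<in> \<pp>" using adjoint_p center_jordan(2)[OF x J] by blast
      then obtain g u where u: "g \<in> K" "u \<in> cp t" "norm (u - y) < min \<epsilon> \<delta>" "w = adjoint g u" using \<eta>(2) w(2) by blast
      have "u = adjoint (matrix_inv g) w" using u(4) adjoint_simps(7)[OF K_group(5)[OF u(1)]] by simp
      then have "u \<in> class_family s n" using class_family_adjoint[OF K_group(1)[OF u(1)] w(1)] by simp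
      then show ?thesis using translate[of u] u(2,3) by auto
    qed
    have fh: "(\<lambda>A. f (adjoint h A)) \<in> poly_fun" unfolding adjoint_def by (rule poly_fun_conjugation[OF f(1)])
    have "\<forall>k. \<exists>u. u + m \<in> class_family s n \<and> norm (u - y) < inverse (real (Suc k))"
    proof
      fix k show "\<exists>u. u + m \<in> class_family s n \<and> norm (u - y) < inverse (real (Suc k))"
        using near[of "inverse (real (Suc k))"] by auto
    qed
    from choice[OF this] obtain u where u: "\<And>k. u k + m \<in> class_family s n" "\<And>k. norm (u k - y) < inverse (real (Suc k))" by blast
    have "(\<lambda>k. u k - y) \<longlonglongrightarrow> 0"
      by (rule Lim_null_comparison[OF _ LIMSEQ_inverse_real_of_nat]) (intro always_eventually allI less_imp_le u(2))
    then have "(\<lambda>k. (u k - y) + (y + m)) \<longlonglongrightarrow> 0 + (y + m)" by (intro tendsto_intros)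
    then have lim: "(\<lambda>k. u k + m) \<longlonglongrightarrow> y + m" by simp
    have "(\<lambda>k. f (adjoint h (u k + m))) \<longlonglongrightarrow> f (adjoint h (y + m))"
      by (rule continuous_on_tendsto_compose[OF poly_fun_continuous[OF fh] lim]) auto
    moreover have "f (adjoint h (u k + m)) = 0" for k
      by (rule fam[OF class_family_adjoint[OF h(1) u(1)]])
    ultimately show "f v = 0" using LIMSEQ_unique[OF _ tendsto_const[of 0]] v' by auto
  qed
qed

end

theorem theoremB1:
  fixes G :: "'n::finite cmat set" and \<theta> :: "'n cmat \<Rightarrow> 'n cmat" and x :: "'n cmat"
  assumes "reductive_symmetric_pair G \<theta>"
    and "x \<in> anisotropic_space G \<theta>"
  shows "\<exists>Y \<subseteq> anisotropic_space G \<theta>.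
           subtopology zariski (anisotropic_space G \<theta>) closure_of decomposition_class G \<theta> x
             = (\<Union>y\<in>Y. decomposition_class G \<theta> y)"
proof -
  obtain F where F: "regular_extension G \<theta> F" using symmetric_pairD(2)[OF assms(1)] by blast
  interpret symmetric_pair G \<theta> F
    by unfold_locales (use symmetric_pairD[OF assms(1)] F in auto)
  let ?p = "anisotropic_space G \<theta>"
  let ?Y = "?p \<inter> zariski closure_of decomposition_class G \<theta> x"
  have in_p: "decomposition_class G \<theta> y \<subseteq> ?p" for y
    by (auto simp: decomposition_class_def decomposition_rel_def)
  then have "?p \<inter> decomposition_class G \<theta> x = decomposition_class G \<theta> x" by blast
  then have "subtopology zariski ?p closure_of decomposition_class G \<theta> x = ?Y"
    by (simp add: closure_of_subtopology)
  also have "?Y = (\<Union>y\<in>?Y. decomposition_class G \<theta> y)"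
  proof
    show "?Y \<subseteq> (\<Union>y\<in>?Y. decomposition_class G \<theta> y)" using class_refl by blast
    show "(\<Union>y\<in>?Y. decomposition_class G \<theta> y) \<subseteq> ?Y"
      using class_closure_invariant[OF assms(2)] in_p by blast
  qed
  finally show ?thesis by blast
qed

end
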